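(* Let $n\ge2$, $k_1,k_2\in[n-1]$ and $L_1,L_2\ge0$. Let $E:\mathbb X_{k_1}\times\mathbb X_{k_2}\to\mathbb C$ be given by $E(u,v)=\Delta_{[n-k+1,n],[k]}(g(u)g(v))$ with $k=\min(k_1,k_2)$, and let $\widehat E=\mathrm{Trop}(E\circ(\Theta_{k_1}\times\Theta_{k_2})):\widetilde{\mathbb T}_{n-k_1}\times\widetilde{\mathbb T}_{n-k_2}\to\mathbb Z$. The restriction of $\widehat E$ to $B^{n-k_1,L_1}\otimes B^{n-k_2,L_2}$ is equal to $\widetilde E$.
   Context: Notation. Fix $n\ge2$; $[m]=\{1,\dots,m\}$, $[i,j]=\{m\in\mathbb Z: i\le m\le j\}$. $\Delta_{I,J}(X)$ is the minor of $X$ with rows $I$ and columns $J$. For $k\in[n-1]$, $\mathbb X_k=\mathrm{Gr}(k,n)\times\mathbb C^\times$, with points written $N|t$. A subspace $N\in\mathrm{Gr}(k,n)$ is the column span of a full-rank $n\times k$ matrix, and $P_J(N)$ is the maximal minor of that matrix with row set $J$ (rows in increasing order), defined up to a common nonzero scalar. Index sets of integers are reduced modulo $n$ to subsets of $[n]$, and $P_I:=0$ if the reduced set does not have exactly $k$ elements. The map $g$. $\lambda$ is an indeterminate. $g(N|t)$ is the $n\times n$ matrix with entries $g(N|t)_{ij}=c_{ij}\,P_{[j-k+1,j-1]\cup\{i\}}(N)/P_{[j-k,j-1]}(N)$, where $c_{ij}=1$ if $j\le k$; $c_{ij}=t$ if $j>k$ and $i\ge j$; $c_{ij}=\lambda$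 if $j>k$ and $i<j$. The minor defining $E$ does not depend on $\lambda$, so $E$ is complex-valued. Parametrization. For $m\in[n-1]$ let $\mathcal R_m=\{(i,j):1\le i\le m,\ i\le j\le i+n-m-1\}$ and $\mathbb T_m=(\mathbb C^\times)^{\mathcal R_m}\times\mathbb C^\times$, with points $(X_{ij},t)$. Put $x_{ij}=X_{ij}/X_{i,j-1}$ for $1\le i\le m$, $i\le j\le i+n-m$, where $X_{i,i-1}:=1$ and $X_{i,i+n-m}:=t$. For $1\le a\le b\le n$ let $M_{[a,b]}(z_a,\dots,z_b)=\sum_{i\in[a,b]}z_iE_{ii}+\sum_{i\notin[a,b]}E_{ii}+\sum_{i\in[a+1,b]}E_{i,i-1}$ (here $E_{ij}$ are matrix units). Let $\Phi_m(X_{ij},t)=\prod_{i=m}^{1}M_{[i,i+n-m]}(x_{ii},\dots,x_{i,i+n-m})$, factors ordered left to right in decreasing order of $i$. Then $\Theta_k:\mathbb T_{n-k}\to\mathbb X_k$ sends $(X_{ij},t)$ to $N|t$, where $N$ is the span of the first $k$ columns of $\Phi_{n-k}(X_{ij},t)$; it is a birational isomorphism. The function $E\circ(\Theta_{k_1}\times\Theta_{k_2})$ is positive, i.e. a ratio of nonzero polynomials with positive integer coefficients. Tropicalization. For a nonzero polynomial $p=\sum c_{m}z_1^{m_1}\cdots z_d^{m_d}$ with positive integer coefficients, $\mathrm{Trop}(p)=\min_{m}(m_1z_1+\cdots+m_dz_d)$ over monomials occurring in $p$; $\mathrm{Trop}(p/q)=\mathrm{Trop}(p)-\mathrm{Trop}(q)$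 (well defined as a function on $\mathbb Z^d$). Put $\widetilde{\mathbb T}_m=\mathbb Z^{\mathcal R_m}\times\mathbb Z$. Rectangles and tableaux. A point $(B_{ij},L)\in\widetilde{\mathbb T}_m$ is an $m$-rectangle if the triangular array $(A_{ij})_{1\le i\le j\le n}$ given by $A_{ij}=B_{ij}$ for $(i,j)\in\mathcal R_m$, $A_{ij}=L$ if $j>i+n-m-1$, and $A_{ij}=0$ if $i>m$, is a Gelfand--Tsetlin pattern, i.e. consists of nonnegative integers with $A_{i,j+1}\ge A_{ij}\ge A_{i+1,j+1}$ for $1\le i\le j\le n-1$. An $m$-rectangle $(B_{ij},L)$ is identified with the semistandard Young tableau (entries in $[n]$) of rectangular shape with $m$ rows and $L$ columns in which the number of $j$'s in row $i$ is $B_{ij}-B_{i,j-1}$ ($B_{i,i-1}:=0$, $B_{i,i+n-m}:=L$). $B^{m,L}$ is the set of such tableaux with $L$ columns, viewed inside $\widetilde{\mathbb T}_m$; elements of $B^{m,L}\otimes B^{m',L'}$ are pairs $T\otimes U$. Coenergy. For $T\in B^{n-k_1,L_1}$ and $U\in B^{n-k_2,L_2}$, $\widetilde E(T\otimes U)$ is the number of boxes of the tableau $T*U$ which are not in the first $\max(n-k_1,n-k_2)$ rows, where $T*U$ is the tableau product: the result of Schensted row-inserting into $T$ the entries of $U$ read row by row from the bottom row to the top row, left to right in each row. *)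

theory Defs
  imports
    "HOL-Library.Poly_Mapping"
    "HOL-Library.FuncSet"
    "HOL-Computational_Algebra.Polynomial"
    "Jordan_Normal_Form.DL_Rank_Submatrix"
begin

section \<open>The Grassmannian and the matrix \<open>g\<close>\<close>

text \<open>
  Matrices of \<open>Jordan_Normal_Form\<close> are indexed from 0, while all index sets below are subsets of
  \<open>{1..n}\<close>, so that the matrix entry \<open>A $$ (i - 1, j - 1)\<close> is the one in row \<open>i\<close> and column \<open>j\<close>.
\<close>

definition minor :: "nat set \<Rightarrow> nat set \<Rightarrow> 'a::comm_ring_1 mat \<Rightarrow> 'a" where
  "minor I J A = det (submatrix A ((\<lambda>i. i - 1) ` I) ((\<lambda>j. j - 1) ` J))"

definition full_rank_mats :: "nat \<Rightarrow> nat \<Rightarrow> complex mat set" where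
  "full_rank_mats n k = {A \<in> carrier_mat n k. vec_space.rank n A = k}"

definition Gr :: "nat \<Rightarrow> nat \<Rightarrow> complex vec set set" where
  "Gr k n = vec_space.col_space n ` full_rank_mats n k"

definition XX :: "nat \<Rightarrow> nat \<Rightarrow> (complex vec set \<times> complex) set" where
  "XX n k = Gr k n \<times> (UNIV - {0})"

definition red :: "nat \<Rightarrow> int \<Rightarrow> nat" where
  "red n i = nat ((i - 1) mod int n) + 1"

text \<open>
  Pluecker coordinates are only determined up to a common nonzero scalar, which is fixed here by
  choosing a matrix with column span \<open>N\<close>; only ratios of values of \<open>plucker n k N\<close> are used.
\<close>

definition plucker :: "nat \<Rightarrow> nat \<Rightarrow> complex vec set \<Rightarrow> int set \<Rightarrow> complex" where
  "plucker n k N I =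
     (let A = (SOME A. A \<in> full_rank_mats n k \<and> vec_space.col_space n A = N)
      in if card (red n ` I) = k then minor (red n ` I) {1..k} A else 0)"

text \<open>The indeterminate \<open>\<lambda>\<close> is the polynomial variable \<open>[:0, 1:]\<close>.\<close>

definition g_coeff :: "nat \<Rightarrow> complex \<Rightarrow> nat \<Rightarrow> nat \<Rightarrow> complex poly" where
  "g_coeff k t i j = (if j \<le> k then 1 else if i \<ge> j then [:t:] else [:0, 1:])"

definition g_mat :: "nat \<Rightarrow> nat \<Rightarrow> complex vec set \<times> complex \<Rightarrow> complex poly mat" where
  "g_mat n k = (\<lambda>(N, t). mat n n (\<lambda>(i', j').
     let i = i' + 1; j = j' + 1 in
     g_coeff k t i j *
       [: plucker n k N ({int j - int k + 1 .. int j - 1} \<union> {int i})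
          / plucker n k N {int j - int k .. int j - 1} :]))"

text \<open>The minor does not involve \<open>\<lambda>\<close>; the complex number is the value of this constant polynomial.\<close>

definition E_fun ::
  "nat \<Rightarrow> nat \<Rightarrow> nat \<Rightarrow> (complex vec set \<times> complex) \<times> (complex vec set \<times> complex) \<Rightarrow> complex" where
  "E_fun n k1 k2 = restrict
     (\<lambda>(u, v). let k = min k1 k2 in
        THE e. minor {n - k + 1..n} {1..k} (g_mat n k1 u * g_mat n k2 v) = [:e:])
     (XX n k1 \<times> XX n k2)"


section \<open>The parametrization\<close>

definition RR :: "nat \<Rightarrow> nat \<Rightarrow> (nat \<times> nat) set" where
  "RR n m = {(i, j). 1 \<le> i \<and> i \<le> m \<and> i \<le> j \<and> j \<le> i + n - m - 1}"

text \<open>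
  Names of the coordinates \<open>X\<^sub>i\<^sub>j\<close> and \<open>t\<close>. A point of a torus, or of its tropicalization, is a function
  on the set of coordinate names; points of a product of two tori are indexed by the disjoint sum.
\<close>

datatype coord = Xc nat nat | Tc

definition coords :: "nat \<Rightarrow> nat \<Rightarrow> coord set" where
  "coords n m = (\<lambda>(i, j). Xc i j) ` RR n m \<union> {Tc}"

definition torus :: "'v set \<Rightarrow> ('v \<Rightarrow> complex) set" where
  "torus V = V \<rightarrow>\<^sub>E (UNIV - {0})"

definition trop_torus :: "'v set \<Rightarrow> ('v \<Rightarrow> int) set" where
  "trop_torus V = V \<rightarrow>\<^sub>E UNIV"

definition X_ext :: "nat \<Rightarrow> nat \<Rightarrow> (coord \<Rightarrow> complex) \<Rightarrow> nat \<Rightarrow> nat \<Rightarrow> complex" where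
  "X_ext n m z i j = (if j + 1 = i then 1 else if j = i + n - m then z Tc else z (Xc i j))"

definition x_ratio :: "nat \<Rightarrow> nat \<Rightarrow> (coord \<Rightarrow> complex) \<Rightarrow> nat \<Rightarrow> nat \<Rightarrow> complex" where
  "x_ratio n m z i j = X_ext n m z i j / X_ext n m z i (j - 1)"

definition M_mat :: "nat \<Rightarrow> nat \<Rightarrow> nat \<Rightarrow> (nat \<Rightarrow> complex) \<Rightarrow> complex mat" where
  "M_mat n a b z = mat n n (\<lambda>(i', j').
     let i = i' + 1; j = j' + 1 in
     if i = j then (if i \<in> {a..b} then z i else 1)
     else if i = j + 1 \<and> i \<in> {a + 1..b} then 1 else 0)"

definition Phi :: "nat \<Rightarrow> nat \<Rightarrow> (coord \<Rightarrow> complex) \<Rightarrow> complex mat" where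
  "Phi n m z =
     foldr (*) (map (\<lambda>i. M_mat n i (i + n - m) (x_ratio n m z i)) (rev [1..<m + 1])) (1\<^sub>m n)"

definition Theta :: "nat \<Rightarrow> nat \<Rightarrow> (coord \<Rightarrow> complex) \<Rightarrow> complex vec set \<times> complex" where
  "Theta n k z =
     (vec_space.col_space n (mat n k (\<lambda>(i, j). Phi n (n - k) z $$ (i, j))), z Tc)"


section \<open>Tropicalization\<close>

text \<open>
  Polynomials over the complex numbers in variables from \<open>'v\<close>: finitely supported maps from
  exponent vectors to coefficients.
\<close>

type_synonym 'v mpoly = "('v \<Rightarrow>\<^sub>0 nat) \<Rightarrow>\<^sub>0 complex"

definition mpoly_in :: "'v set \<Rightarrow> 'v mpoly \<Rightarrow> bool" where
  "mpoly_in V p \<longleftrightarrow> (\<forall>m \<in> Poly_Mapping.keys p. Poly_Mapping.keys m \<subseteq> V)"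

definition mpoly_eval :: "'v mpoly \<Rightarrow> ('v \<Rightarrow> complex) \<Rightarrow> complex" where
  "mpoly_eval p z =
     (\<Sum>m \<in> Poly_Mapping.keys p. Poly_Mapping.lookup p m *
        (\<Prod>v \<in> Poly_Mapping.keys m. z v ^ Poly_Mapping.lookup m v))"

definition positive_mpoly :: "'v set \<Rightarrow> 'v mpoly \<Rightarrow> bool" where
  "positive_mpoly V p \<longleftrightarrow> p \<noteq> 0 \<and> mpoly_in V p \<and>
     (\<forall>m \<in> Poly_Mapping.keys p. \<exists>c::nat. c > 0 \<and> Poly_Mapping.lookup p m = of_nat c)"

text \<open>
  \<open>f = p / q\<close> as rational functions on the torus, i.e. on a nonempty Zariski open subset (the locus
  \<open>d \<noteq> 0\<close>). Outside of such a set \<open>f\<close> may be undefined in the sense of rational maps; there its value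
  in HOL is irrelevant.
\<close>

definition equals_ratio :: "'v set \<Rightarrow> (('v \<Rightarrow> complex) \<Rightarrow> complex) \<Rightarrow> 'v mpoly \<Rightarrow> 'v mpoly \<Rightarrow> bool" where
  "equals_ratio V f p q \<longleftrightarrow>
     (\<exists>d. d \<noteq> 0 \<and> mpoly_in V d \<and>
        (\<forall>z \<in> torus V. mpoly_eval d z \<noteq> 0 \<longrightarrow>
           mpoly_eval q z \<noteq> 0 \<and> f z = mpoly_eval p z / mpoly_eval q z))"

definition trop_mpoly :: "'v mpoly \<Rightarrow> ('v \<Rightarrow> int) \<Rightarrow> int" where
  "trop_mpoly p b =
     Min ((\<lambda>m. \<Sum>v \<in> Poly_Mapping.keys m. int (Poly_Mapping.lookup m v) * b v) ` Poly_Mapping.keys p)"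

text \<open>
  The tropicalization of a positive rational function: the common value of
  \<open>Trop p - Trop q\<close> over all representations \<open>f = p / q\<close> with \<open>p\<close>, \<open>q\<close> positive.
\<close>

definition trop :: "'v set \<Rightarrow> (('v \<Rightarrow> complex) \<Rightarrow> complex) \<Rightarrow> ('v \<Rightarrow> int) \<Rightarrow> int" where
  "trop V f = (\<lambda>b \<in> trop_torus V. THE e. \<exists>p q.
     positive_mpoly V p \<and> positive_mpoly V q \<and> equals_ratio V f p q \<and>
     e = trop_mpoly p b - trop_mpoly q b)"

definition E_hat :: "nat \<Rightarrow> nat \<Rightarrow> nat \<Rightarrow> (coord \<Rightarrow> int) \<times> (coord \<Rightarrow> int) \<Rightarrow> int" where
  "E_hat n k1 k2 = (\<lambda>(b, b').
     trop (coords n (n - k1) <+> coords n (n - k2))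
       (\<lambda>z. E_fun n k1 k2 (Theta n k1 (z \<circ> Inl), Theta n k2 (z \<circ> Inr)))
       (case_sum b b'))"


section \<open>Rectangles and tableaux\<close>

definition gt_pattern :: "nat \<Rightarrow> (nat \<Rightarrow> nat \<Rightarrow> int) \<Rightarrow> bool" where
  "gt_pattern n A \<longleftrightarrow>
     (\<forall>i j. 1 \<le> i \<and> i \<le> j \<and> j \<le> n \<longrightarrow> A i j \<ge> 0) \<and>
     (\<forall>i j. 1 \<le> i \<and> i \<le> j \<and> j \<le> n - 1 \<longrightarrow> A i (j + 1) \<ge> A i j \<and> A i j \<ge> A (i + 1) (j + 1))"

definition rect_array :: "nat \<Rightarrow> nat \<Rightarrow> (coord \<Rightarrow> int) \<Rightarrow> nat \<Rightarrow> nat \<Rightarrow> int" where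
  "rect_array n m b i j =
     (if i > m then 0 else if j > i + n - m - 1 then b Tc else b (Xc i j))"

definition BB :: "nat \<Rightarrow> nat \<Rightarrow> nat \<Rightarrow> (coord \<Rightarrow> int) set" where
  "BB n m L = {b \<in> trop_torus (coords n m). gt_pattern n (rect_array n m b) \<and> b Tc = int L}"

text \<open>A tableau is the list of its rows, from top to bottom; rows may be empty.\<close>

definition B_ext :: "nat \<Rightarrow> nat \<Rightarrow> (coord \<Rightarrow> int) \<Rightarrow> nat \<Rightarrow> nat \<Rightarrow> int" where
  "B_ext n m b i j = (if j + 1 = i then 0 else if j = i + n - m then b Tc else b (Xc i j))"

definition tableau :: "nat \<Rightarrow> nat \<Rightarrow> (coord \<Rightarrow> int) \<Rightarrow> nat list list" where
  "tableau n m b =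
     map (\<lambda>i. concat (map (\<lambda>j. replicate (nat (B_ext n m b i j - B_ext n m b i (j - 1))) j)
                        [i..<i + n - m + 1]))
       [1..<m + 1]"

fun row_insert :: "nat \<Rightarrow> nat list \<Rightarrow> nat list \<times> nat option" where
  "row_insert x [] = ([x], None)"
| "row_insert x (y # ys) =
     (if x < y then (x # ys, Some y)
      else (case row_insert x ys of (r, bumped) \<Rightarrow> (y # r, bumped)))"

fun tab_insert :: "nat \<Rightarrow> nat list list \<Rightarrow> nat list list" where
  "tab_insert x [] = [[x]]"
| "tab_insert x (r # rs) =
     (case row_insert x r of
        (r', None) \<Rightarrow> r' # rs
      | (r', Some y) \<Rightarrow> r' # tab_insert y rs)"

definition tab_prod :: "nat list list \<Rightarrow> nat list list \<Rightarrow> nat list list" where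
  "tab_prod T U = fold tab_insert (concat (rev U)) T"

definition coenergy :: "nat \<Rightarrow> nat \<Rightarrow> nat \<Rightarrow> nat list list \<Rightarrow> nat list list \<Rightarrow> nat" where
  "coenergy n k1 k2 T U =
     sum_list (map length (drop (max (n - k1) (n - k2)) (tab_prod T U)))"

end

theory Submission
  imports Defs
begin

text \<open>
  Write \<open>m\<^sub>1 = n - k\<^sub>1\<close>, \<open>m\<^sub>2 = n - k\<^sub>2\<close> and \<open>m =
  max m\<^sub>1 m\<^sub>2\<close>, so that \<open>min k\<^sub>1 k\<^sub>2 = n - m\<close>.

  A column of \<open>g(N|t)\<close> lists ratios of Pluecker coordinates of \<open>N\<close> whose index
  sets differ in one element. By Cramer's rule such ratios are the coordinates of a vector of
  \<open>N\<close> that vanishes on a cyclic interval of \<open>k - 1\<close> positions. The columns of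
  \<open>Phi\<close> come from vectors of this kind (\<open>exists_span_vec\<close>,
  \<open>window_exchange\<close>), so the entries of \<open>g\<close> that enter the minor are those of
  \<open>Phi\<close>, and the energy function in the coordinates is the lower left minor of size \<open>n
  - m\<close> of \<open>Phi Phi'\<close> (\<open>E_fun_Theta\<close>). This is a product of one bidiagonal
  matrix for every row of the two tableaux, in the order in which the rows occur in the reading word.

  Refactorization of such products is row insertion: a product \<open>M(x) M(w)\<close> of two bidiagonal
  matrices can be written as \<open>M(z) M(y)\<close>, where the entries of \<open>z\<close> and
  \<open>y\<close> are given by subtraction-free formulas in those of \<open>x\<close> and
  \<open>w\<close> (\<open>row_mat_refactor\<close>). If the tropical values of \<open>x\<close> and
  \<open>w\<close> are the numbers of letters in two words, the tropical values of \<open>y\<close> and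
  \<open>z\<close> are the numbers of letters in the row obtained from inserting \<open>w\<close> into
  \<open>x\<close> and in the word that is bumped out. All rows of \<open>U\<close> are moved in this way,
  the lowest row first, to the left through the matrices of \<open>T\<close>, which is extended by empty
  rows to \<open>m\<close> rows. On the left there appears one matrix for the word pushed out of row
  \<open>m\<close> by each row of \<open>U\<close>; these matrices respect the partition of the indices
  into the first \<open>m\<close> and the remaining ones, and the minor is the product of their diagonal
  entries at the latter (\<open>minor_eq_prod_out\<close>). Hence the energy function is a ratio of
  positive polynomials, and its tropical value is the number of letters pushed out of row
  \<open>m\<close>. This is the number of boxes of \<open>T * U\<close> below row \<open>m\<close>
  (\<open>coenergy_eq_sum_out\<close>).

  The rectangular shape is needed because the matrices of \<open>Phi\<close> have vanishing subdiagonal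
  entries outside a band that moves with the row. At the ends of the bands, the sums \<open>x p + carry (p
  - 1)\<close> in the formulas for \<open>z\<close> lose one of their two summands, and one tropical value
  takes the place of the minimum of two. That the result is nevertheless right follows from
  column-strictness: either all incoming letters bump a letter (\<open>all_bumped\<close>), because
  neighbouring rows of a rectangle have equal length, or all letters that an earlier word left in the row
  are bumped (\<open>all_old_bumped\<close>), because the rows of \<open>U\<close> are columnwise strict
  and insertion preserves this.

  The tropicalization is a unique value because a positive polynomial on a curve \<open>z\<^sub>v =
  s\<^bsup>b v\<^esup>\<close> has, for small \<open>s > 0\<close>, the order of magnitude
  \<open>s\<^bsup>e\<^esup>\<close> where \<open>e\<close> is its tropical value
  (\<open>trop_mpoly_eq_of_generic_eq\<close>).
\<close>

section \<open>Positive rational functions and their tropicalization\<close>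

abbreviation (input) "supp \<equiv> Poly_Mapping.keys"
abbreviation (input) "coef \<equiv> Poly_Mapping.lookup"

definition monom_wt :: "('v \<Rightarrow> int) \<Rightarrow> ('v \<Rightarrow>\<^sub>0 nat) \<Rightarrow> int" where
  "monom_wt b m = (\<Sum>v \<in> supp m. int (coef m v) * b v)"

definition monom_eval :: "('v \<Rightarrow> complex) \<Rightarrow> ('v \<Rightarrow>\<^sub>0 nat) \<Rightarrow> complex" where
  "monom_eval z m = (\<Prod>v \<in> supp m. z v ^ coef m v)"

lemma trop_mpoly_alt: "trop_mpoly p b = Min (monom_wt b ` supp p)"
  by (simp add: trop_mpoly_def monom_wt_def)

lemma mpoly_eval_alt:
  "mpoly_eval p z = (\<Sum>m \<in> supp p. coef p m * monom_eval z m)"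
  by (simp add: mpoly_eval_def monom_eval_def)

lemma monom_wt_superset:
  "finite A \<Longrightarrow> supp m \<subseteq> A \<Longrightarrow>
    monom_wt b m = (\<Sum>v\<in>A. int (coef m v) * b v)"
  unfolding monom_wt_def by (rule sum.mono_neutral_left) (auto simp: in_keys_iff)

lemma monom_eval_superset:
  "finite A \<Longrightarrow> supp m \<subseteq> A \<Longrightarrow>
    monom_eval z m = (\<Prod>v\<in>A. z v ^ coef m v)"
  unfolding monom_eval_def by (rule prod.mono_neutral_left) (auto simp: in_keys_iff)

lemma keys_plus_nat:
  fixes m m' :: "'v \<Rightarrow>\<^sub>0 nat"
  shows "supp (m + m') = supp m \<union> supp m'"
  by (auto simp: in_keys_iff lookup_add)

lemma monom_wt_add: "monom_wt b (m + m') = monom_wt b m + monom_wt b m'"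
  by (simp add: monom_wt_superset[where A = "supp m \<union> supp m'"]
      keys_plus_nat lookup_add algebra_simps sum.distrib)

lemma monom_eval_add: "monom_eval z (m + m') = monom_eval z m * monom_eval z m'"
  by (simp add: monom_eval_superset[where A = "supp m \<union> supp m'"]
      keys_plus_nat lookup_add power_add prod.distrib)

lemma mpoly_eval_superset:
  "finite A \<Longrightarrow> supp p \<subseteq> A \<Longrightarrow>
    mpoly_eval p z = (\<Sum>m\<in>A. coef p m * monom_eval z m)"
  unfolding mpoly_eval_alt by (rule sum.mono_neutral_left) (auto simp: in_keys_iff)

lemma mpoly_eval_add: "mpoly_eval (p + q) z = mpoly_eval p z + mpoly_eval q z"
  using keys_add[of p q]
  by (simp add: mpoly_eval_superset[where A = "supp p \<union> supp q"]
      lookup_add algebra_simps sum.distrib)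

lemma mpoly_eval_zero: "mpoly_eval 0 z = 0"
  by (simp add: mpoly_eval_def)

lemma mpoly_eval_single: "mpoly_eval (Poly_Mapping.single m c) z = c * monom_eval z m"
  by (simp add: mpoly_eval_superset[where A = "{m}"])

lemma mpoly_eval_sum: "mpoly_eval (\<Sum>i\<in>A. f i) z = (\<Sum>i\<in>A. mpoly_eval (f i) z)"
  by (induction A rule: infinite_finite_induct) (auto simp: mpoly_eval_add mpoly_eval_zero)

lemma poly_mapping_sum_monomials:
  fixes p :: "'a \<Rightarrow>\<^sub>0 'b::comm_monoid_add"
  shows "(\<Sum>m\<in>supp p. Poly_Mapping.single m (coef p m)) = p"
  by (rule poly_mapping_eqI) (simp add: lookup_sum lookup_single when_def in_keys_iff)

lemma mpoly_mult_expand: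
  fixes p q :: "'v mpoly"
  shows "p * q = (\<Sum>m\<in>supp p. \<Sum>m'\<in>supp q.
     Poly_Mapping.single (m + m') (coef p m * coef q m'))"
proof -
  have "p * q = (\<Sum>m\<in>supp p. Poly_Mapping.single m (coef p m)) *
     (\<Sum>m\<in>supp q. Poly_Mapping.single m (coef q m))"
    by (simp only: poly_mapping_sum_monomials)
  then show ?thesis
    by (simp add: sum_product mult_single)
qed

lemma mpoly_eval_mult: "mpoly_eval (p * q) z = mpoly_eval p z * mpoly_eval q z"
  unfolding mpoly_mult_expand mpoly_eval_sum mpoly_eval_single monom_eval_add
  by (simp add: mpoly_eval_alt sum_product algebra_simps)

lemma lookup_mpoly_mult:
  fixes p q :: "'v mpoly"
  shows "coef (p * q) k =
    (\<Sum>m\<in>supp p. \<Sum>m'\<in>supp q.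
     (if m + m' = k then coef p m * coef q m' else 0))"
  by (simp add: mpoly_mult_expand lookup_sum lookup_single when_def)

lemma positive_mpoly_iff:
  "positive_mpoly V p \<longleftrightarrow> p \<noteq> 0 \<and> mpoly_in V p \<and> (\<forall>m. coef p m \<in> \<nat>)"
proof
  assume p: "positive_mpoly V p"
  have "coef p m \<in> \<nat>" for m
  proof (cases "m \<in> supp p")
    case True
    with p obtain c where "coef p m = of_nat c" unfolding positive_mpoly_def by blast
    then show ?thesis by simp
  qed (simp add: in_keys_iff)
  with p show "p \<noteq> 0 \<and> mpoly_in V p \<and> (\<forall>m. coef p m \<in> \<nat>)"
    by (auto simp: positive_mpoly_def)
next
  assume p: "p \<noteq> 0 \<and> mpoly_in V p \<and> (\<forall>m. coef p m \<in> \<nat>)"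
  show "positive_mpoly V p"
    unfolding positive_mpoly_def
  proof (intro conjI ballI)
    fix m assume "m \<in> supp p"
    moreover obtain c where "coef p m = of_nat c" using p by (metis Nats_cases)
    ultimately show "\<exists>c>0. coef p m = of_nat c" by (intro exI[of _ c]) (auto simp: in_keys_iff)
  qed (use p in auto)
qed

lemma keys_add_positive:
  assumes "positive_mpoly V p" "positive_mpoly V q"
  shows "supp (p + q) = supp p \<union> supp q"
proof -
  have "coef p m + coef q m = 0 \<longleftrightarrow>
        coef p m = 0 \<and> coef q m = 0" for m
  proof -
    have "coef p m \<in> \<nat>" "coef q m \<in> \<nat>"
      using assms by (auto simp: positive_mpoly_iff)
    then obtain a c where "coef p m = of_nat a" "coef q m = of_nat c"
      by (metis Nats_cases)
    then show ?thesis by (simp flip: of_nat_add)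
  qed
  then show ?thesis unfolding set_eq_iff Un_iff in_keys_iff lookup_add by blast
qed

text \<open>Positive coefficients cannot cancel, so every product of two monomials survives.\<close>
lemma keys_mult_positive:
  assumes "positive_mpoly V p" "positive_mpoly V q"
  shows "supp (p * q) =
    (\<lambda>(m, m'). m + m') ` (supp p \<times> supp q)"
proof -
  have "\<forall>m. \<exists>a. coef p m = of_nat a" "\<forall>m. \<exists>a. coef q m = of_nat a"
    using assms unfolding positive_mpoly_iff by (metis Nats_cases)+
  then obtain a c where a: "\<And>m. coef p m = of_nat (a m)"
    and c: "\<And>m. coef q m = of_nat (c m)" by metis
  have "coef (p * q) k = of_nat (\<Sum>m\<in>supp p. \<Sum>m'\<in>supp q.
     (if m + m' = k then a m * c m' else 0))" for k
    unfolding lookup_mpoly_mult by (simp add: a c if_distrib cong: if_cong)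
  then have *: "coef (p * q) k \<noteq> 0 \<longleftrightarrow>
     (\<exists>m\<in>supp p. \<exists>m'\<in>supp q. m + m' = k \<and> a m * c m' \<noteq> 0)" for k
    by (simp del: of_nat_sum) auto
  have nz: "a m * c m' \<noteq> 0" if "m \<in> supp p" "m' \<in> supp q" for m m'
    using that by (simp add: in_keys_iff a c)
  show ?thesis
  proof (rule equalityI; rule subsetI)
    fix k assume "k \<in> supp (p * q)"
    then obtain m m' where "m \<in> supp p" "m' \<in> supp q" "m + m' = k"
      using *[of k] in_keys_iff[of k "p * q"] by blast
    then show "k \<in> (\<lambda>(m, m'). m + m') ` (supp p \<times> supp q)" by force
  next
    fix k assume "k \<in> (\<lambda>(m, m'). m + m') ` (supp p \<times> supp q)"
    then obtain m m' where "m \<in> supp p" "m' \<in> supp q" "m + m' = k" by auto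
    then show "k \<in> supp (p * q)"
      using *[of k] in_keys_iff[of k "p * q"] nz by blast
  qed
qed

lemma positive_mpoly_nonempty: "positive_mpoly V p \<Longrightarrow> supp p \<noteq> {}"
  unfolding positive_mpoly_def by simp

lemma positive_mpolyI:
  assumes "supp p \<noteq> {}" "mpoly_in V p" "\<And>m. coef p m \<in> \<nat>"
  shows "positive_mpoly V p"
  using assms unfolding positive_mpoly_iff by (metis keys_zero)

lemma positive_mpoly_coeff: "positive_mpoly V p \<Longrightarrow> coef p m \<in> \<nat>"
  unfolding positive_mpoly_iff by blast

lemma positive_mpoly_vars:
  "positive_mpoly V p \<Longrightarrow> m \<in> supp p \<Longrightarrow> supp m \<subseteq> V"
  unfolding positive_mpoly_iff mpoly_in_def by blast

lemma positive_mpoly_add: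
  assumes "positive_mpoly V p" "positive_mpoly V q"
  shows "positive_mpoly V (p + q)"
proof (rule positive_mpolyI)
  show "supp (p + q) \<noteq> {}"
    unfolding keys_add_positive[OF assms] using positive_mpoly_nonempty[OF assms(1)] by blast
  show "mpoly_in V (p + q)"
    unfolding mpoly_in_def keys_add_positive[OF assms]
    using positive_mpoly_vars[OF assms(1)] positive_mpoly_vars[OF assms(2)] by blast
  show "coef (p + q) m \<in> \<nat>" for m
    unfolding lookup_add by (intro Nats_add positive_mpoly_coeff[OF assms(1)] positive_mpoly_coeff[OF assms(2)])
qed

lemma Nats_sum: "(\<And>i. i \<in> A \<Longrightarrow> f i \<in> \<nat>) \<Longrightarrow> sum f A \<in> \<nat>"
  by (induction A rule: infinite_finite_induct) auto

lemma positive_mpoly_mult: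
  assumes "positive_mpoly V p" "positive_mpoly V q"
  shows "positive_mpoly V (p * q)"
proof (rule positive_mpolyI)
  show "supp (p * q) \<noteq> {}"
    unfolding keys_mult_positive[OF assms]
    using positive_mpoly_nonempty[OF assms(1)] positive_mpoly_nonempty[OF assms(2)] by blast
  show "mpoly_in V (p * q)"
    unfolding mpoly_in_def keys_mult_positive[OF assms]
    using positive_mpoly_vars[OF assms(1)] positive_mpoly_vars[OF assms(2)]
    by (auto simp only: keys_plus_nat split_beta) blast+
  have "(if m + m' = k then coef p m * coef q m' else 0) \<in> \<nat>" for m m' k
    using positive_mpoly_coeff[OF assms(1)] positive_mpoly_coeff[OF assms(2)] by simp
  then show "coef (p * q) k \<in> \<nat>" for k
    unfolding lookup_mpoly_mult by (intro Nats_sum)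
qed

lemma trop_mpoly_add:
  assumes "positive_mpoly V p" "positive_mpoly V q"
  shows "trop_mpoly (p + q) b = min (trop_mpoly p b) (trop_mpoly q b)"
  unfolding trop_mpoly_alt keys_add_positive[OF assms] image_Un
  using assms by (intro Min_Un) (auto simp: positive_mpoly_def)

lemma trop_mpoly_attained:
  assumes "positive_mpoly V p"
  obtains m where "m \<in> supp p" "trop_mpoly p b = monom_wt b m"
proof -
  have "trop_mpoly p b \<in> monom_wt b ` supp p"
    unfolding trop_mpoly_alt using assms by (intro Min_in) (auto simp: positive_mpoly_def)
  then show ?thesis using that by auto
qed

lemma trop_mpoly_le: "m \<in> supp p \<Longrightarrow> trop_mpoly p b \<le> monom_wt b m"
  by (simp add: trop_mpoly_alt)

lemma trop_mpoly_mult: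
  assumes "positive_mpoly V p" "positive_mpoly V q"
  shows "trop_mpoly (p * q) b = trop_mpoly p b + trop_mpoly q b"
proof (rule antisym)
  obtain m where m: "m \<in> supp p" "trop_mpoly p b = monom_wt b m"
    using trop_mpoly_attained[OF assms(1)] .
  obtain m' where m': "m' \<in> supp q" "trop_mpoly q b = monom_wt b m'"
    using trop_mpoly_attained[OF assms(2)] .
  have "m + m' \<in> supp (p * q)" using m m' by (auto simp: keys_mult_positive[OF assms])
  then show "trop_mpoly (p * q) b \<le> trop_mpoly p b + trop_mpoly q b"
    using trop_mpoly_le[of "m + m'" "p * q" b] by (simp add: monom_wt_add m m')
  obtain k where k: "k \<in> supp (p * q)" "trop_mpoly (p * q) b = monom_wt b k"
    using trop_mpoly_attained[OF positive_mpoly_mult[OF assms]] .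
  then show "trop_mpoly p b + trop_mpoly q b \<le> trop_mpoly (p * q) b"
    by (auto simp: keys_mult_positive[OF assms] monom_wt_add intro!: add_mono trop_mpoly_le)
qed

text \<open>
  The exceptional set is the zero set of a positive polynomial. Such sets are closed under finite
  unions, since a product of positive polynomials is again positive.
\<close>
definition generically :: "'v set \<Rightarrow> (('v \<Rightarrow> complex) \<Rightarrow> bool) \<Rightarrow> bool" where
  "generically V Q \<longleftrightarrow>
     (\<exists>d. positive_mpoly V d \<and> (\<forall>z\<in>torus V. mpoly_eval d z \<noteq> 0 \<longrightarrow> Q z))"

lemma positive_mpoly_one: "positive_mpoly V 1"
  by (simp add: positive_mpoly_iff mpoly_in_def lookup_one when_def)

lemma monom_eval_0: "monom_eval z 0 = 1" by (simp add: monom_eval_def)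

lemma mpoly_eval_one: "mpoly_eval 1 z = 1"
  using mpoly_eval_single[of 0 1 z] by (simp add: monom_eval_0)

lemma trop_mpoly_one: "trop_mpoly 1 b = 0"
  by (simp add: trop_mpoly_alt monom_wt_def)

lemma generically_all: "(\<And>z. z \<in> torus V \<Longrightarrow> Q z) \<Longrightarrow> generically V Q"
  unfolding generically_def using positive_mpoly_one by blast

lemma generically_mono:
  "generically V Q \<Longrightarrow> (\<And>z. z \<in> torus V \<Longrightarrow> Q z \<Longrightarrow> Q' z) \<Longrightarrow> generically V Q'"
  unfolding generically_def by blast

lemma generically_conj:
  assumes "generically V Q" "generically V Q'"
  shows "generically V (\<lambda>z. Q z \<and> Q' z)"
proof -
  obtain d where d: "positive_mpoly V d" "\<forall>z\<in>torus V. mpoly_eval d z \<noteq> 0 \<longrightarrow> Q z"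
    using assms by (auto simp: generically_def)
  obtain d' where d': "positive_mpoly V d'" "\<forall>z\<in>torus V. mpoly_eval d' z \<noteq> 0 \<longrightarrow> Q' z"
    using assms by (auto simp: generically_def)
  show ?thesis unfolding generically_def
    using d d' by (intro exI[of _ "d * d'"]) (auto simp: positive_mpoly_mult mpoly_eval_mult)
qed

lemma generically_ball:
  "finite A \<Longrightarrow> (\<And>i. i \<in> A \<Longrightarrow> generically V (Q i)) \<Longrightarrow> generically V (\<lambda>z. \<forall>i\<in>A. Q i z)"
proof (induction A rule: finite_induct)
  case empty
  then show ?case by (simp add: generically_all)
next
  case (insert i A)
  then show ?case
    using generically_conj[of V "Q i" "\<lambda>z. \<forall>i\<in>A. Q i z"] by simp
qed

text \<open>
  The tropical value is taken at one point \<open>b\<close> only, because the formulas for it below use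
  inequalities between the coordinates of \<open>b\<close>. The numerator is generically nonzero as well, so that
  quotients can be formed.
\<close>
definition has_trop ::
  "'v set \<Rightarrow> ('v \<Rightarrow> int) \<Rightarrow> (('v \<Rightarrow> complex) \<Rightarrow> complex) \<Rightarrow> int \<Rightarrow> bool" where
  "has_trop V b f e \<longleftrightarrow> (\<exists>p q. positive_mpoly V p \<and> positive_mpoly V q \<and>
     e = trop_mpoly p b - trop_mpoly q b \<and>
     generically V (\<lambda>z. mpoly_eval p z \<noteq> 0 \<and> mpoly_eval q z \<noteq> 0 \<and>
                        f z = mpoly_eval p z / mpoly_eval q z))"

lemma has_trop_nonzero:
  "has_trop V b f e \<Longrightarrow> generically V (\<lambda>z. f z \<noteq> 0)"
  unfolding has_trop_def by (auto elim!: generically_mono)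

lemma generically_positive: "positive_mpoly V p \<Longrightarrow> generically V (\<lambda>z. mpoly_eval p z \<noteq> 0)"
  unfolding generically_def by blast

lemma has_tropE:
  assumes "has_trop V b f e"
  obtains p q where "positive_mpoly V p" "positive_mpoly V q"
     "e = trop_mpoly p b - trop_mpoly q b"
     "generically V (\<lambda>z. mpoly_eval p z \<noteq> 0 \<and> mpoly_eval q z \<noteq> 0 \<and> f z = mpoly_eval p z / mpoly_eval q z)"
  using assms unfolding has_trop_def by blast

lemma has_tropI:
  assumes "positive_mpoly V p" "positive_mpoly V q" "e = trop_mpoly p b - trop_mpoly q b"
    "generically V (\<lambda>z. mpoly_eval p z \<noteq> 0 \<and> mpoly_eval q z \<noteq> 0 \<and> f z = mpoly_eval p z / mpoly_eval q z)"
  shows "has_trop V b f e"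
  using assms unfolding has_trop_def by blast

lemma has_trop_cong:
  assumes "has_trop V b f e" "generically V (\<lambda>z. f z = h z)"
  shows "has_trop V b h e"
proof -
  obtain p q where pq: "positive_mpoly V p" "positive_mpoly V q"
     "e = trop_mpoly p b - trop_mpoly q b"
     "generically V (\<lambda>z. mpoly_eval p z \<noteq> 0 \<and> mpoly_eval q z \<noteq> 0 \<and> f z = mpoly_eval p z / mpoly_eval q z)"
    using has_tropE[OF assms(1)] .
  have "generically V (\<lambda>z. mpoly_eval p z \<noteq> 0 \<and> mpoly_eval q z \<noteq> 0 \<and> h z = mpoly_eval p z / mpoly_eval q z)"
    by (rule generically_mono[OF generically_conj[OF pq(4) assms(2)]]) auto
  with pq show ?thesis unfolding has_trop_def by blast
qed

lemma has_trop_pairE: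
  assumes "has_trop V b f e" "has_trop V b h e'"
  obtains p q p' q' where "positive_mpoly V p" "positive_mpoly V q" "e = trop_mpoly p b - trop_mpoly q b"
    and "positive_mpoly V p'" "positive_mpoly V q'" "e' = trop_mpoly p' b - trop_mpoly q' b"
    and "generically V (\<lambda>z.
      (mpoly_eval p z \<noteq> 0 \<and> mpoly_eval q z \<noteq> 0 \<and> f z = mpoly_eval p z / mpoly_eval q z) \<and>
      (mpoly_eval p' z \<noteq> 0 \<and> mpoly_eval q' z \<noteq> 0 \<and> h z = mpoly_eval p' z / mpoly_eval q' z))"
proof -
  obtain p q where pq: "positive_mpoly V p" "positive_mpoly V q"
     "e = trop_mpoly p b - trop_mpoly q b"
     "generically V (\<lambda>z. mpoly_eval p z \<noteq> 0 \<and> mpoly_eval q z \<noteq> 0 \<and> f z = mpoly_eval p z / mpoly_eval q z)"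
    using has_tropE[OF assms(1)] .
  obtain p' q' where pq': "positive_mpoly V p'" "positive_mpoly V q'"
     "e' = trop_mpoly p' b - trop_mpoly q' b"
     "generically V (\<lambda>z. mpoly_eval p' z \<noteq> 0 \<and> mpoly_eval q' z \<noteq> 0 \<and> h z = mpoly_eval p' z / mpoly_eval q' z)"
    using has_tropE[OF assms(2)] .
  show ?thesis by (rule that[OF pq(1-3) pq'(1-3) generically_conj[OF pq(4) pq'(4)]])
qed

lemma has_trop_mult:
  assumes "has_trop V b f e" "has_trop V b h e'"
  shows "has_trop V b (\<lambda>z. f z * h z) (e + e')"
proof -
  obtain p q p' q' where pq: "positive_mpoly V p" "positive_mpoly V q" "e = trop_mpoly p b - trop_mpoly q b"
    and pq': "positive_mpoly V p'" "positive_mpoly V q'" "e' = trop_mpoly p' b - trop_mpoly q' b"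
    and gen: "generically V (\<lambda>z.
      (mpoly_eval p z \<noteq> 0 \<and> mpoly_eval q z \<noteq> 0 \<and> f z = mpoly_eval p z / mpoly_eval q z) \<and>
      (mpoly_eval p' z \<noteq> 0 \<and> mpoly_eval q' z \<noteq> 0 \<and> h z = mpoly_eval p' z / mpoly_eval q' z))"
    using has_trop_pairE[OF assms] .
  show ?thesis unfolding has_trop_def
  proof (intro exI conjI)
    show "positive_mpoly V (p * p')" "positive_mpoly V (q * q')"
      by (intro positive_mpoly_mult pq pq')+
    show "e + e' = trop_mpoly (p * p') b - trop_mpoly (q * q') b"
      using pq(1,2) pq'(1,2) by (simp add: pq(3) pq'(3) trop_mpoly_mult[of V])
  qed (rule generically_mono[OF gen], simp add: mpoly_eval_mult)
qed

lemma has_trop_divide: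
  assumes "has_trop V b f e" "has_trop V b h e'"
  shows "has_trop V b (\<lambda>z. f z / h z) (e - e')"
proof -
  obtain p q p' q' where pq: "positive_mpoly V p" "positive_mpoly V q" "e = trop_mpoly p b - trop_mpoly q b"
    and pq': "positive_mpoly V p'" "positive_mpoly V q'" "e' = trop_mpoly p' b - trop_mpoly q' b"
    and gen: "generically V (\<lambda>z.
      (mpoly_eval p z \<noteq> 0 \<and> mpoly_eval q z \<noteq> 0 \<and> f z = mpoly_eval p z / mpoly_eval q z) \<and>
      (mpoly_eval p' z \<noteq> 0 \<and> mpoly_eval q' z \<noteq> 0 \<and> h z = mpoly_eval p' z / mpoly_eval q' z))"
    using has_trop_pairE[OF assms] .
  show ?thesis unfolding has_trop_def
  proof (intro exI conjI)
    show "positive_mpoly V (p * q')" "positive_mpoly V (q * p')"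
      by (intro positive_mpoly_mult pq pq')+
    show "e - e' = trop_mpoly (p * q') b - trop_mpoly (q * p') b"
      using pq(1,2) pq'(1,2) by (simp add: pq(3) pq'(3) trop_mpoly_mult[of V])
  qed (rule generically_mono[OF gen], simp add: mpoly_eval_mult)
qed

lemma has_trop_add:
  assumes "has_trop V b f e" "has_trop V b h e'"
  shows "has_trop V b (\<lambda>z. f z + h z) (min e e')"
proof -
  obtain p q p' q' where pq: "positive_mpoly V p" "positive_mpoly V q" "e = trop_mpoly p b - trop_mpoly q b"
    and pq': "positive_mpoly V p'" "positive_mpoly V q'" "e' = trop_mpoly p' b - trop_mpoly q' b"
    and gen: "generically V (\<lambda>z.
      (mpoly_eval p z \<noteq> 0 \<and> mpoly_eval q z \<noteq> 0 \<and> f z = mpoly_eval p z / mpoly_eval q z) \<and>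
      (mpoly_eval p' z \<noteq> 0 \<and> mpoly_eval q' z \<noteq> 0 \<and> h z = mpoly_eval p' z / mpoly_eval q' z))"
    using has_trop_pairE[OF assms] .
  define s where "s = p * q' + p' * q"
  have s: "positive_mpoly V s"
    unfolding s_def by (intro positive_mpoly_add positive_mpoly_mult pq pq')
  have "trop_mpoly s b = min (trop_mpoly p b + trop_mpoly q' b) (trop_mpoly p' b + trop_mpoly q b)"
    unfolding s_def trop_mpoly_add[OF positive_mpoly_mult[OF pq(1) pq'(2)] positive_mpoly_mult[OF pq'(1) pq(2)]]
      trop_mpoly_mult[OF pq(1) pq'(2)] trop_mpoly_mult[OF pq'(1) pq(2)] ..
  then have "min e e' = trop_mpoly s b - trop_mpoly (q * q') b"
    unfolding pq(3) pq'(3) trop_mpoly_mult[OF pq(2) pq'(2)] by linarith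
  moreover have "generically V (\<lambda>z. mpoly_eval s z \<noteq> 0 \<and> mpoly_eval (q * q') z \<noteq> 0 \<and>
      f z + h z = mpoly_eval s z / mpoly_eval (q * q') z)"
  proof (rule generically_mono[OF generically_conj[OF generically_positive[OF s] gen]])
    fix z assume "mpoly_eval s z \<noteq> 0 \<and>
       (mpoly_eval p z \<noteq> 0 \<and> mpoly_eval q z \<noteq> 0 \<and> f z = mpoly_eval p z / mpoly_eval q z) \<and>
       (mpoly_eval p' z \<noteq> 0 \<and> mpoly_eval q' z \<noteq> 0 \<and> h z = mpoly_eval p' z / mpoly_eval q' z)"
    then have z: "mpoly_eval s z \<noteq> 0" "mpoly_eval q z \<noteq> 0" "mpoly_eval q' z \<noteq> 0"
      "f z = mpoly_eval p z / mpoly_eval q z" "h z = mpoly_eval p' z / mpoly_eval q' z" by blast+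
    have "f z + h z = mpoly_eval s z / mpoly_eval (q * q') z"
      unfolding z(4,5) add_frac_eq[OF z(2,3)] by (simp add: s_def mpoly_eval_mult mpoly_eval_add)
    with z(1-3) show "mpoly_eval s z \<noteq> 0 \<and> mpoly_eval (q * q') z \<noteq> 0 \<and>
       f z + h z = mpoly_eval s z / mpoly_eval (q * q') z" by (simp add: mpoly_eval_mult)
  qed
  ultimately show ?thesis
    using s positive_mpoly_mult[OF pq(2) pq'(2)]
    unfolding has_trop_def by fast
qed

lemma has_trop_one: "has_trop V b (\<lambda>z. 1) 0"
  by (rule has_tropI[OF positive_mpoly_one positive_mpoly_one])
     (simp_all add: mpoly_eval_one generically_all)

lemma has_trop_var:
  assumes "v \<in> V"
  shows "has_trop V b (\<lambda>z. z v) (b v)"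
proof -
  define p :: "'a mpoly" where "p = Poly_Mapping.single (Poly_Mapping.single v 1) 1"
  have keys: "supp p = {Poly_Mapping.single v 1}"
    by (simp add: p_def)
  have eval: "mpoly_eval p z = z v" for z
    by (simp add: p_def mpoly_eval_single monom_eval_def)
  have p: "positive_mpoly V p"
  proof (rule positive_mpolyI)
    show "mpoly_in V p" unfolding mpoly_in_def keys using assms by simp
    show "coef p m \<in> \<nat>" for m by (simp add: p_def lookup_single when_def)
  qed (simp add: keys)
  show ?thesis
  proof (rule has_tropI[OF p positive_mpoly_one])
    show "b v = trop_mpoly p b - trop_mpoly 1 b"
      by (simp add: trop_mpoly_one trop_mpoly_alt keys monom_wt_def)
    show "generically V (\<lambda>z. mpoly_eval p z \<noteq> 0 \<and> mpoly_eval 1 z \<noteq> 0 \<and> z v = mpoly_eval p z / mpoly_eval 1 z)"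
      by (rule generically_all) (use assms in \<open>auto simp: eval mpoly_eval_one torus_def\<close>)
  qed
qed

lemma has_trop_prod:
  assumes "finite A" "\<And>i. i \<in> A \<Longrightarrow> has_trop V b (f i) (e i)"
  shows "has_trop V b (\<lambda>z. \<Prod>i\<in>A. f i z) (\<Sum>i\<in>A. e i)"
  using assms
proof (induction A rule: finite_induct)
  case empty
  show ?case by (simp add: has_trop_one)
next
  case (insert i A)
  then show ?case by (simp add: has_trop_mult)
qed

text \<open>Mixed radix expansion: the weight of a new variable exceeds all weights obtained so far.\<close>
lemma separating_weights:
  assumes "finite V" "finite (F :: ('v \<Rightarrow> nat) set)"
  shows "\<exists>w. (\<forall>v. 0 \<le> w v) \<and> (\<forall>f\<in>F. \<forall>g\<in>F. (\<Sum>v\<in>V. int (f v) * w v) = (\<Sum>v\<in>V. int (g v) * w v) \<longrightarrow>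
            (\<forall>v\<in>V. f v = g v))"
  using assms(1)
proof (induction V rule: finite_induct)
  case empty
  then show ?case by (intro exI[of _ "\<lambda>_. 0"]) auto
next
  case (insert x V)
  then obtain w where w: "\<And>v. 0 \<le> (w v :: int)"
    "\<And>f g. f \<in> F \<Longrightarrow> g \<in> F \<Longrightarrow> (\<Sum>v\<in>V. int (f v) * w v) = (\<Sum>v\<in>V. int (g v) * w v) \<Longrightarrow> (\<forall>v\<in>V. f v = g v)"
    by blast
  define S where "S f = (\<Sum>v\<in>V. int (f v) * w v)" for f
  define B where "B = 1 + (\<Sum>f\<in>F. S f)"
  have S0: "0 \<le> S f" for f unfolding S_def using w(1) by (intro sum_nonneg) auto
  have SB: "S f < B" if "f \<in> F" for f
    using member_le_sum[of f F S] S0 assms(2) that by (simp add: B_def)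
  have B: "B > 0" using S0 sum_nonneg[of F S] by (simp add: B_def)
  define w' where "w' = w(x := B)"
  have S': "(\<Sum>v\<in>insert x V. int (f v) * w' v) = int (f x) * B + S f" for f
  proof -
    have "(\<Sum>v\<in>V. int (f v) * w' v) = S f"
      unfolding S_def by (rule sum.cong) (use insert.hyps in \<open>auto simp: w'_def\<close>)
    then show ?thesis using insert.hyps by (simp add: w'_def)
  qed
  show ?case
  proof (intro exI[of _ w'] conjI ballI allI impI)
    show "0 \<le> w' v" for v using w(1) B by (simp add: w'_def)
    fix f g v assume fg: "f \<in> F" "g \<in> F" and v: "v \<in> insert x V"
    assume "(\<Sum>v\<in>insert x V. int (f v) * w' v) = (\<Sum>v\<in>insert x V. int (g v) * w' v)"
    then have eq: "int (f x) * B + S f = int (g x) * B + S g" by (simp only: S')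
    have "(int (f x) * B + S f) div B = int (f x)" "(int (g x) * B + S g) div B = int (g x)"
      using SB fg S0 B by simp_all
    with eq have "int (f x) = int (g x)" by metis
    then have fx: "f x = g x" by simp
    from eq have "S f = S g" unfolding fx by linarith
    then have "\<forall>v\<in>V. f v = g v" using w(2)[OF fg] unfolding S_def by blast
    with fx v show "f v = g v" by blast
  qed
qed

lemma separating_monom_wt:
  assumes "finite (K :: ('v \<Rightarrow>\<^sub>0 nat) set)"
  obtains w :: "'v \<Rightarrow> int" where "\<And>v. 0 \<le> w v" "inj_on (monom_wt w) K"
proof -
  define A where "A = (\<Union>m\<in>K. supp m)"
  have A: "finite A" using assms by (simp add: A_def)
  obtain w where w: "\<And>v. 0 \<le> (w v :: int)"
    "\<And>f g. f \<in> coef ` K \<Longrightarrow> g \<in> coef ` K \<Longrightarrow>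
      (\<Sum>v\<in>A. int (f v) * w v) = (\<Sum>v\<in>A. int (g v) * w v) \<Longrightarrow> (\<forall>v\<in>A. f v = g v)"
    using separating_weights[OF A finite_imageI[OF assms, of coef]] by blast
  have "inj_on (monom_wt w) K"
  proof (rule inj_onI)
    fix m m' assume m: "m \<in> K" "m' \<in> K" and eq: "monom_wt w m = monom_wt w m'"
    have sub: "supp m \<subseteq> A" "supp m' \<subseteq> A" using m by (auto simp: A_def)
    then have "\<forall>v\<in>A. coef m v = coef m' v"
      using eq m by (intro w(2)) (auto simp: monom_wt_superset[OF A])
    then show "m = m'"
      using sub by (intro poly_mapping_eqI) (metis in_keys_iff subsetD)
  qed
  with w(1) that show ?thesis by blast
qed

definition power_curve :: "'v set \<Rightarrow> ('v \<Rightarrow> int) \<Rightarrow> real \<Rightarrow> 'v \<Rightarrow> complex" where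
  "power_curve V b s = (\<lambda>v\<in>V. of_real s powi b v)"

lemma power_curve_torus: "s > 0 \<Longrightarrow> power_curve V b s \<in> torus V"
  by (auto simp: power_curve_def torus_def)

lemma powi_sum: "x \<noteq> (0::complex) \<Longrightarrow> (\<Prod>i\<in>A. x powi f i) = x powi (\<Sum>i\<in>A. f i)"
  by (induction A rule: infinite_finite_induct) (auto simp: power_int_add)

lemma monom_eval_power_curve:
  assumes "supp m \<subseteq> V" "s > 0"
  shows "monom_eval (power_curve V b s) m = of_real s powi monom_wt b m"
proof -
  have "monom_eval (power_curve V b s) m =
     (\<Prod>v \<in> supp m. complex_of_real s powi (int (coef m v) * b v))"
    unfolding monom_eval_def
  proof (rule prod.cong)
    fix v assume "v \<in> supp m"
    then show "power_curve V b s v ^ coef m v =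
      complex_of_real s powi (int (coef m v) * b v)"
      using assms by (auto simp: power_curve_def mult.commute power_int_mult)
  qed auto
  then show ?thesis using assms by (simp add: powi_sum monom_wt_def)
qed

lemma mpoly_eval_power_curve:
  assumes "mpoly_in V p" "s > 0"
  shows "mpoly_eval p (power_curve V b s) =
    (\<Sum>m \<in> supp p. coef p m * of_real s powi monom_wt b m)"
  unfolding mpoly_eval_alt
  by (rule sum.cong) (use assms in \<open>auto simp: mpoly_in_def monom_eval_power_curve\<close>)

text \<open>
  If the monomials have distinct weights, \<open>d\<close> restricts to a nonzero Laurent polynomial in \<open>s\<close>.
\<close>
lemma finite_zeros_power_curve:
  assumes "d \<noteq> 0" "mpoly_in V d" "inj_on (monom_wt b) (supp d)"
  shows "finite {s. s > 0 \<and> mpoly_eval d (power_curve V b s) = 0}"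
proof -
  define C where "C = (\<Sum>m\<in>supp d. \<bar>monom_wt b m\<bar>)"
  have C: "0 \<le> monom_wt b m + C" if "m \<in> supp d" for m
    using member_le_sum[of m "supp d" "\<lambda>m. \<bar>monom_wt b m\<bar>"] that by (simp add: C_def)
  define Q where "Q = (\<Sum>m\<in>supp d. Polynomial.monom (coef d m) (nat (monom_wt b m + C)))"
  obtain m0 where m0: "m0 \<in> supp d" using assms(1) by (metis all_not_in_conv keys_eq_empty)
  have "coeff Q (nat (monom_wt b m0 + C)) =
      (\<Sum>m\<in>supp d. if m = m0 then coef d m else 0)"
    unfolding Q_def coeff_sum coeff_monom
  proof (rule sum.cong)
    fix m assume m: "m \<in> supp d"
    have "nat (monom_wt b m + C) = nat (monom_wt b m0 + C) \<longleftrightarrow> m = m0"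
      using C[OF m] C[OF m0] inj_onD[OF assms(3) _ m m0] by auto
    then show "(if nat (monom_wt b m + C) = nat (monom_wt b m0 + C) then coef d m else 0) =
       (if m = m0 then coef d m else 0)" by simp
  qed auto
  also have "\<dots> = coef d m0" using m0 by simp
  finally have "Q \<noteq> 0" using m0 by (auto simp: in_keys_iff)
  then have fin: "finite {x. poly Q x = 0}" by (rule poly_roots_finite)
  have "poly Q (of_real s) = of_real s powi C * mpoly_eval d (power_curve V b s)" if "s > 0" for s
  proof -
    have "poly Q (of_real s) = (\<Sum>m\<in>supp d. coef d m * of_real s ^ nat (monom_wt b m + C))"
      by (simp add: Q_def poly_sum poly_monom)
    also have "\<dots> = (\<Sum>m\<in>supp d. of_real s powi C * (coef d m * of_real s powi monom_wt b m))"
    proof (rule sum.cong)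
      fix m assume m: "m \<in> supp d"
      have "complex_of_real s ^ nat (monom_wt b m + C) = of_real s powi (monom_wt b m + C)"
        using C[OF m] by (simp add: power_int_def)
      also have "\<dots> = of_real s powi monom_wt b m * of_real s powi C"
        using that by (simp add: power_int_add)
      finally show "coef d m * complex_of_real s ^ nat (monom_wt b m + C) =
        of_real s powi C * (coef d m * of_real s powi monom_wt b m)" by simp
    qed auto
    finally show ?thesis by (simp add: mpoly_eval_power_curve[OF assms(2) that] sum_distrib_left)
  qed
  then have "of_real ` {s. s > 0 \<and> mpoly_eval d (power_curve V b s) = 0} \<subseteq> {x. poly Q x = 0}"
    by auto
  then have "finite (complex_of_real ` {s. s > 0 \<and> mpoly_eval d (power_curve V b s) = 0})"
    using fin by (rule finite_subset)
  then show ?thesis by (rule finite_imageD) (auto simp: inj_on_def)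
qed

text \<open>
  The terms are positive on the curve, and for small \<open>s\<close> those of least weight dominate.
\<close>
lemma positive_mpoly_power_curve_bounds:
  assumes "positive_mpoly V p"
  obtains P C where "\<And>s. s > 0 \<Longrightarrow> mpoly_eval p (power_curve V b s) = of_real (P s)"
    "C > 0" "\<And>s. 0 < s \<Longrightarrow> s \<le> 1 \<Longrightarrow> s powi trop_mpoly p b \<le> P s \<and> P s \<le> C * s powi trop_mpoly p b"
proof -
  obtain c where c: "\<And>m. m \<in> supp p \<Longrightarrow> c m > (0::nat) \<and> coef p m = of_nat (c m)"
    using assms unfolding positive_mpoly_def by metis
  define P where "P s = (\<Sum>m\<in>supp p. real (c m) * s powi monom_wt b m)" for s
  obtain m0 where m0: "m0 \<in> supp p" "trop_mpoly p b = monom_wt b m0"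
    using trop_mpoly_attained[OF assms] .
  show ?thesis
  proof (rule that[of P "\<Sum>m\<in>supp p. real (c m)"])
    show "mpoly_eval p (power_curve V b s) = of_real (P s)" if "s > 0" for s
    proof -
      have "mpoly_in V p" using assms by (simp add: positive_mpoly_def)
      then show ?thesis using c that unfolding mpoly_eval_power_curve[OF \<open>mpoly_in V p\<close> that] P_def of_real_sum
        by (intro sum.cong) auto
    qed
    show "(\<Sum>m\<in>supp p. real (c m)) > 0"
      using c m0(1) by (intro sum_pos2[of _ m0]) auto
    fix s :: real assume s: "0 < s" "s \<le> 1"
    have "s powi trop_mpoly p b \<le> real (c m0) * s powi monom_wt b m0"
      using c[OF m0(1)] s m0(2) by simp
    also have "\<dots> \<le> P s" unfolding P_def
      by (rule member_le_sum[of m0]) (use m0 s in auto)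
    finally have 1: "s powi trop_mpoly p b \<le> P s" .
    have "P s \<le> (\<Sum>m\<in>supp p. real (c m) * s powi trop_mpoly p b)"
      unfolding P_def using s by (intro sum_mono mult_left_mono power_int_decreasing) (auto intro: trop_mpoly_le)
    with 1 show "s powi trop_mpoly p b \<le> P s \<and> P s \<le> (\<Sum>m\<in>supp p. real (c m)) * s powi trop_mpoly p b"
      by (simp add: sum_distrib_right)
  qed
qed

lemma trop_mpoly_le_of_eq_on_curve:
  assumes "positive_mpoly V p" "positive_mpoly V q"
    and eq: "\<And>\<epsilon>. \<epsilon> > 0 \<Longrightarrow> \<exists>s. 0 < s \<and> s < \<epsilon> \<and>
      mpoly_eval p (power_curve V b s) = mpoly_eval q (power_curve V b s)"
  shows "trop_mpoly q b \<le> trop_mpoly p b"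
proof (rule ccontr)
  assume less: "\<not> trop_mpoly q b \<le> trop_mpoly p b"
  obtain P C where P: "\<And>s. s > 0 \<Longrightarrow> mpoly_eval p (power_curve V b s) = of_real (P s)"
    "\<And>s. 0 < s \<Longrightarrow> s \<le> 1 \<Longrightarrow> s powi trop_mpoly p b \<le> P s \<and> P s \<le> C * s powi trop_mpoly p b"
    using positive_mpoly_power_curve_bounds[OF assms(1)] by metis
  obtain Q D where Q: "\<And>s. s > 0 \<Longrightarrow> mpoly_eval q (power_curve V b s) = of_real (Q s)" "D > 0"
    "\<And>s. 0 < s \<Longrightarrow> s \<le> 1 \<Longrightarrow> s powi trop_mpoly q b \<le> Q s \<and> Q s \<le> D * s powi trop_mpoly q b"
    using positive_mpoly_power_curve_bounds[OF assms(2)] by metis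
  obtain s where s: "0 < s" "s < min 1 (1 / D)"
    "mpoly_eval p (power_curve V b s) = mpoly_eval q (power_curve V b s)"
    using eq[of "min 1 (1 / D)"] Q(2) by auto
  have "s powi trop_mpoly p b \<le> D * s powi trop_mpoly q b"
  proof -
    have "P s = Q s" using P(1)[OF s(1)] Q(1)[OF s(1)] s(3) by simp
    then show ?thesis using Q(3)[of s] P(2)[of s] s by auto
  qed
  also have "\<dots> \<le> D * s powi (trop_mpoly p b + 1)"
    using less s Q(2) by (intro mult_left_mono power_int_decreasing) auto
  also have "\<dots> = (D * s) * s powi trop_mpoly p b" using s by (simp add: power_int_add)
  also have "\<dots> < 1 * s powi trop_mpoly p b"
    using s Q(2) by (intro mult_strict_right_mono) (auto simp: field_simps)
  finally show False by simp
qed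

lemma trop_mpoly_perturb:
  assumes "positive_mpoly V p" "\<And>v. 0 \<le> w v" "N \<ge> 0"
  shows "N * trop_mpoly p b \<le> trop_mpoly p (\<lambda>v. N * b v + w v)"
    "trop_mpoly p (\<lambda>v. N * b v + w v) \<le> N * trop_mpoly p b + (\<Sum>m\<in>supp p. monom_wt w m)"
proof -
  have wt: "monom_wt (\<lambda>v. N * b v + w v) m = N * monom_wt b m + monom_wt w m" for m
    by (simp add: monom_wt_def algebra_simps sum.distrib sum_distrib_left)
  have w0: "0 \<le> monom_wt w m" for m unfolding monom_wt_def using assms(2) by (intro sum_nonneg) auto
  obtain m0 where m0: "m0 \<in> supp p" "trop_mpoly p b = monom_wt b m0"
    using trop_mpoly_attained[OF assms(1)] .
  obtain m1 where m1: "m1 \<in> supp p"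
    "trop_mpoly p (\<lambda>v. N * b v + w v) = monom_wt (\<lambda>v. N * b v + w v) m1"
    using trop_mpoly_attained[OF assms(1)] .
  have "N * trop_mpoly p b \<le> N * monom_wt b m1"
    by (intro mult_left_mono trop_mpoly_le m1 assms)
  then show "N * trop_mpoly p b \<le> trop_mpoly p (\<lambda>v. N * b v + w v)"
    using w0[of m1] by (simp add: m1 wt)
  have "trop_mpoly p (\<lambda>v. N * b v + w v) \<le> N * monom_wt b m0 + monom_wt w m0"
    using trop_mpoly_le[OF m0(1), of "\<lambda>v. N * b v + w v"] by (simp add: wt)
  moreover have "monom_wt w m0 \<le> (\<Sum>m\<in>supp p. monom_wt w m)"
    by (rule member_le_sum) (use m0 w0 in auto)
  ultimately show "trop_mpoly p (\<lambda>v. N * b v + w v) \<le> N * trop_mpoly p b + (\<Sum>m\<in>supp p. monom_wt w m)"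
    by (simp add: m0)
qed

text \<open>
  The equality is known only where \<open>d\<close> and \<open>d'\<close> do not vanish, and these may vanish identically on
  the curve with exponents \<open>b\<close>. The exponents \<open>N b + w\<close>, with weights \<open>w\<close> that separate the monomials
  of \<open>d\<close> and \<open>d'\<close> and with \<open>N\<close> large, avoid this. They change the tropical values from \<open>N e\<close> by
  a bounded amount, so that division by \<open>N\<close> recovers \<open>e\<close>.
\<close>
lemma trop_mpoly_eq_of_generic_eq:
  assumes p: "positive_mpoly V p" and q: "positive_mpoly V q"
    and d: "d \<noteq> 0" "mpoly_in V d" and d': "d' \<noteq> 0" "mpoly_in V d'"
    and eq: "\<And>z. z \<in> torus V \<Longrightarrow> mpoly_eval d z \<noteq> 0 \<Longrightarrow> mpoly_eval d' z \<noteq> 0 \<Longrightarrow> mpoly_eval p z = mpoly_eval q z"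
  shows "trop_mpoly p b = trop_mpoly q b"
proof -
  define K where "K = supp d \<union> supp d'"
  have K: "finite K" by (simp add: K_def)
  obtain w where w: "\<And>v. 0 \<le> (w v :: int)" "inj_on (monom_wt w) K"
    using separating_monom_wt[OF K] by metis
  have w0: "0 \<le> monom_wt w m" for m unfolding monom_wt_def using w(1) by (intro sum_nonneg) auto
  define D where "D = (\<Sum>m\<in>supp p \<union> supp q \<union> K. monom_wt w m)"
  define N where "N = D + 1"
  have D: "(\<Sum>m\<in>A. monom_wt w m) \<le> D" if "A \<subseteq> supp p \<union> supp q \<union> K" for A
    unfolding D_def using that K w0 by (intro sum_mono2) auto
  have D0: "D \<ge> 0" unfolding D_def using w0 by (intro sum_nonneg) auto
  \<comment> \<open>\<open>N\<close> exceeds all differences of weights of \<open>w\<close>, so \<open>b'\<close> separates monomials as well as \<open>w\<close> does.\<close>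
  define b' where "b' v = N * b v + w v" for v
  have wt: "monom_wt b' m = N * monom_wt b m + monom_wt w m" for m
    by (simp add: b'_def monom_wt_def algebra_simps sum.distrib sum_distrib_left)
  have inj: "inj_on (monom_wt b') K"
  proof (rule inj_onI)
    fix m m' assume m: "m \<in> K" "m' \<in> K" "monom_wt b' m = monom_wt b' m'"
    have lt: "monom_wt w m < N" "monom_wt w m' < N"
      using D[of "{m}"] D[of "{m'}"] m by (auto simp: N_def)
    have "(N * monom_wt b m + monom_wt w m) mod N = (N * monom_wt b m' + monom_wt w m') mod N"
      using m(3) by (simp add: wt)
    then have "monom_wt w m = monom_wt w m'" using lt w0 by simp
    then show "m = m'" using w(2) m by (auto dest: inj_onD)
  qed
  have fin: "finite ({s. s > 0 \<and> mpoly_eval d (power_curve V b' s) = 0} \<union>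
             {s. s > 0 \<and> mpoly_eval d' (power_curve V b' s) = 0})"
    using finite_zeros_power_curve[OF d, of b'] finite_zeros_power_curve[OF d', of b'] inj
    by (simp add: K_def inj_on_Un)
  have curve: "\<exists>s. 0 < s \<and> s < \<epsilon> \<and> mpoly_eval p (power_curve V b' s) = mpoly_eval q (power_curve V b' s)"
    if "\<epsilon> > 0" for \<epsilon>
  proof -
    have "infinite {0<..<\<epsilon>}" using that by simp
    then obtain s where "s \<in> {0<..<\<epsilon>}" "s \<notin> {s. s > 0 \<and> mpoly_eval d (power_curve V b' s) = 0} \<union>
             {s. s > 0 \<and> mpoly_eval d' (power_curve V b' s) = 0}"
      using fin by (meson finite_subset subsetI)
    then show ?thesis by (intro exI[of _ s]) (auto intro!: eq power_curve_torus)
  qed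
  have "trop_mpoly p b' = trop_mpoly q b'"
  proof (rule antisym)
    show "trop_mpoly q b' \<le> trop_mpoly p b'"
      by (rule trop_mpoly_le_of_eq_on_curve[OF p q curve])
    show "trop_mpoly p b' \<le> trop_mpoly q b'"
      by (rule trop_mpoly_le_of_eq_on_curve[OF q p]) (metis curve)
  qed
  then have "N * trop_mpoly p b \<le> N * trop_mpoly q b + D" "N * trop_mpoly q b \<le> N * trop_mpoly p b + D"
    using trop_mpoly_perturb[OF p, of w N b, OF w(1)] trop_mpoly_perturb[OF q, of w N b, OF w(1)]
       D[of "supp p"] D[of "supp q"] D0
    unfolding b'_def[abs_def] N_def by fastforce+
  then have "N * (trop_mpoly p b - trop_mpoly q b) < N * 1" "N * (trop_mpoly q b - trop_mpoly p b) < N * 1"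
    using N_def unfolding right_diff_distrib by linarith+
  moreover have "N > 0" using D0 by (simp add: N_def)
  ultimately have "trop_mpoly p b - trop_mpoly q b < 1" "trop_mpoly q b - trop_mpoly p b < 1"
    by (simp_all only: mult_less_cancel_left_pos)
  then show ?thesis by linarith
qed

lemma trop_eqI:
  assumes f: "has_trop V b f e" and b: "b \<in> trop_torus V"
  shows "trop V f b = e"
proof -
  obtain p q where pq: "positive_mpoly V p" "positive_mpoly V q" "e = trop_mpoly p b - trop_mpoly q b"
    "generically V (\<lambda>z. mpoly_eval p z \<noteq> 0 \<and> mpoly_eval q z \<noteq> 0 \<and> f z = mpoly_eval p z / mpoly_eval q z)"
    using has_tropE[OF f] .
  have rep: "equals_ratio V f p q"
    using pq(4) unfolding generically_def equals_ratio_def positive_mpoly_def by blast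
  have "trop V f b = (THE e. \<exists>p q. positive_mpoly V p \<and> positive_mpoly V q \<and> equals_ratio V f p q \<and>
     e = trop_mpoly p b - trop_mpoly q b)"
    using b by (simp add: trop_def)
  also have "\<dots> = e"
  proof (rule the_equality)
    show "\<exists>p q. positive_mpoly V p \<and> positive_mpoly V q \<and> equals_ratio V f p q \<and>
       e = trop_mpoly p b - trop_mpoly q b" using pq rep by blast
    fix e' assume "\<exists>p q. positive_mpoly V p \<and> positive_mpoly V q \<and> equals_ratio V f p q \<and>
       e' = trop_mpoly p b - trop_mpoly q b"
    then obtain p' q' where pq': "positive_mpoly V p'" "positive_mpoly V q'" "equals_ratio V f p' q'"
       "e' = trop_mpoly p' b - trop_mpoly q' b" by blast
    obtain d where d: "d \<noteq> 0" "mpoly_in V d"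
      "\<And>z. z \<in> torus V \<Longrightarrow> mpoly_eval d z \<noteq> 0 \<Longrightarrow> mpoly_eval q z \<noteq> 0 \<and> f z = mpoly_eval p z / mpoly_eval q z"
      using rep unfolding equals_ratio_def by blast
    obtain d' where d': "d' \<noteq> 0" "mpoly_in V d'"
      "\<And>z. z \<in> torus V \<Longrightarrow> mpoly_eval d' z \<noteq> 0 \<Longrightarrow> mpoly_eval q' z \<noteq> 0 \<and> f z = mpoly_eval p' z / mpoly_eval q' z"
      using pq'(3) unfolding equals_ratio_def by blast
    have "trop_mpoly (p * q') b = trop_mpoly (p' * q) b"
    proof (rule trop_mpoly_eq_of_generic_eq[OF _ _ d(1,2) d'(1,2)])
      fix z assume z: "z \<in> torus V" "mpoly_eval d z \<noteq> 0" "mpoly_eval d' z \<noteq> 0"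
      then show "mpoly_eval (p * q') z = mpoly_eval (p' * q) z"
        using d(3)[OF z(1,2)] d'(3)[OF z(1,3)]
          frac_eq_eq[of "mpoly_eval q z" "mpoly_eval q' z" "mpoly_eval p z" "mpoly_eval p' z"]
        by (simp add: mpoly_eval_mult)
    qed (intro positive_mpoly_mult pq pq')+
    then show "e' = e"
      using pq(1,2) pq'(1,2) by (simp add: trop_mpoly_mult[of V] pq(3) pq'(4))
  qed
  finally show ?thesis .
qed

section \<open>Bidiagonal matrices and their refactorization\<close>

text \<open>
  A lower bidiagonal matrix. The entry in row \<open>p\<close> below the diagonal is 0 or 1 according to the
  pattern \<open>c\<close>; in the matrices \<open>M_mat\<close> it is 1 on an interval.
\<close>
definition row_mat :: "nat \<Rightarrow> (nat \<Rightarrow> bool) \<Rightarrow> (nat \<Rightarrow> 'a::comm_ring_1) \<Rightarrow> 'a mat" where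
  "row_mat n c x = mat n n (\<lambda>(i, j). if i = j then x (i + 1) else if i = j + 1 \<and> c (i + 1) then 1 else 0)"

lemma row_mat_carrier [simp]: "row_mat n c x \<in> carrier_mat n n"
  and dim_row_mat [simp]: "dim_row (row_mat n c x) = n" "dim_col (row_mat n c x) = n"
  by (simp_all add: row_mat_def)

lemma row_mat_cong:
  assumes "\<And>p. 1 \<le> p \<Longrightarrow> p \<le> n \<Longrightarrow> x p = x' p" "\<And>p. 2 \<le> p \<Longrightarrow> p \<le> n \<Longrightarrow> c p = c' p"
  shows "row_mat n c x = row_mat n c' x'"
  by (rule eq_matI) (use assms in \<open>auto simp: row_mat_def\<close>)

lemma row_mat_mult_index:
  assumes B: "B \<in> carrier_mat n l" and ij: "i < n" "j < l"
  shows "(row_mat n c x * B) $$ (i, j) =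
    x (i + 1) * B $$ (i, j) + (if 0 < i \<and> c (i + 1) then B $$ (i - 1, j) else 0)"
proof -
  have "(row_mat n c x * B) $$ (i, j) = (\<Sum>q = 0..<n. row_mat n c x $$ (i, q) * B $$ (q, j))"
    using B ij by (simp add: scalar_prod_def)
  also have "\<dots> = (\<Sum>q = 0..<n. (if q = i then x (i + 1) * B $$ (i, j) else 0) +
      (if q = i - 1 then (if 0 < i \<and> c (i + 1) then B $$ (i - 1, j) else 0) else 0))"
    by (rule sum.cong) (use ij in \<open>auto simp: row_mat_def\<close>)
  also have "\<dots> = x (i + 1) * B $$ (i, j) + (if 0 < i \<and> c (i + 1) then B $$ (i - 1, j) else 0)"
    using ij by (auto simp: sum.distrib)
  finally show ?thesis .
qed

lemma row_mat_mult_row_mat_index: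
  assumes ij: "i < n" "j < n"
  shows "(row_mat n c x * row_mat n d w) $$ (i, j) =
    (if i = j then x (i + 1) * w (i + 1)
     else if i = j + 1 then x (i + 1) * (if d (i + 1) then 1 else 0) + (if c (i + 1) then w i else 0)
     else if i = j + 2 \<and> c (i + 1) \<and> d i then 1 else 0)"
proof (cases i)
  case 0
  then show ?thesis using ij unfolding row_mat_mult_index[OF row_mat_carrier ij]
    by (auto simp: row_mat_def)
next
  case (Suc i')
  then show ?thesis using ij unfolding row_mat_mult_index[OF row_mat_carrier ij]
    by (auto simp: row_mat_def)
qed

text \<open>
  The product of the matrices of the rows \<open>i - 1, \<dots>, 0\<close> of a tableau, in this order from left to
  right, as in \<open>Phi\<close>. Rows are numbered from 0, letters (which index matrix entries) from 1.
\<close>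
fun row_tower :: "nat \<Rightarrow> (nat \<Rightarrow> nat \<Rightarrow> bool) \<Rightarrow> (nat \<Rightarrow> nat \<Rightarrow> 'a::comm_ring_1) \<Rightarrow> nat \<Rightarrow> 'a mat" where
  "row_tower n c x 0 = 1\<^sub>m n"
| "row_tower n c x (Suc i) = row_mat n (c i) (x i) * row_tower n c x i"

lemma row_tower_carrier [simp]: "row_tower n c x i \<in> carrier_mat n n"
  by (induction i) auto

lemma row_tower_Suc_index:
  assumes "i < n" "j < n"
  shows "row_tower n c x (Suc r) $$ (i, j) = x r (i + 1) * row_tower n c x r $$ (i, j) +
    (if 0 < i \<and> c r (i + 1) then row_tower n c x r $$ (i - 1, j) else 0)"
  unfolding row_tower.simps row_mat_mult_index[OF row_tower_carrier assms] ..

lemma row_tower_above: "i < j \<Longrightarrow> j < n \<Longrightarrow> row_tower n c x r $$ (i, j) = 0"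
proof (induction r arbitrary: i)
  case (Suc r)
  then show ?case using Suc.IH[of i] Suc.IH[of "i - 1"] row_tower_Suc_index[of i n j c x r] by simp
qed simp

lemma row_tower_below: "i < n \<Longrightarrow> j + r < i \<Longrightarrow> row_tower n c x r $$ (i, j) = 0"
proof (induction r arbitrary: i)
  case (Suc r)
  then show ?case using Suc.IH[of i] Suc.IH[of "i - 1"] row_tower_Suc_index[of i n j c x r] by simp
qed simp

text \<open>The only way to descend \<open>r\<close> steps in \<open>r\<close> factors is to descend in every factor.\<close>
lemma row_tower_corner:
  "j + r < n \<Longrightarrow> (\<And>s. s < r \<Longrightarrow> c s (j + s + 2)) \<Longrightarrow> row_tower n c x r $$ (j + r, j) = 1"
proof (induction r)
  case (Suc r)
  then show ?case
    using Suc.prems(2)[of r] row_tower_below[of "j + Suc r" n j r c x] row_tower_Suc_index[of "j + Suc r" n j c x r]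
    by simp
qed simp

lemma row_tower_diag: "j < n \<Longrightarrow> row_tower n c x r $$ (j, j) = (\<Prod>s<r. x s (j + 1))"
proof (induction r)
  case (Suc r)
  then show ?case
    using row_tower_above[of "j - 1" j n c x r] row_tower_Suc_index[of j n j c x r] by (simp add: mult.commute)
qed simp

text \<open>
  The equation \<open>M(x) M(w) = M(z) M(y)\<close> is solved from the top row downwards. The value
  \<open>carry i = w i - d i * y i\<close> is what row \<open>i\<close> hands on to row \<open>i + 1\<close>; the recursion below computes
  it without subtraction (\<open>carry_eq\<close>). The predicate \<open>live\<close> marks the rows in which it does not
  vanish identically.
\<close>
fun live :: "(nat \<Rightarrow> bool) \<Rightarrow> (nat \<Rightarrow> bool) \<Rightarrow> nat \<Rightarrow> bool" where
  "live c d 0 = False"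
| "live c d (Suc i) = (\<not> d (Suc i) \<or> c (Suc i) \<and> live c d i)"

fun carry :: "(nat \<Rightarrow> bool) \<Rightarrow> (nat \<Rightarrow> bool) \<Rightarrow> (nat \<Rightarrow> 'a::field) \<Rightarrow> (nat \<Rightarrow> 'a) \<Rightarrow> nat \<Rightarrow> 'a" where
  "carry c d x w 0 = 0"
| "carry c d x w (Suc i) =
     (if d (Suc i)
      then if c (Suc i) then w (Suc i) * carry c d x w i / (x (Suc i) + carry c d x w i) else 0
      else w (Suc i))"

text \<open>The subdiagonal patterns of \<open>M(y)\<close> and \<open>M(z)\<close>.\<close>
definition stay_pat :: "(nat \<Rightarrow> bool) \<Rightarrow> (nat \<Rightarrow> bool) \<Rightarrow> nat \<Rightarrow> bool" where
  "stay_pat c d i \<longleftrightarrow> d i \<or> c i \<and> live c d (i - 1)"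

definition bump_pat :: "(nat \<Rightarrow> bool) \<Rightarrow> (nat \<Rightarrow> bool) \<Rightarrow> nat \<Rightarrow> bool" where
  "bump_pat c d i \<longleftrightarrow> c i \<and> d (i - 1)"

text \<open>
  The diagonal entries \<open>z\<close>. The subdiagonal equation for row \<open>i\<close> determines \<open>z i\<close> if \<open>stay_pat\<close>
  holds at \<open>i\<close>; otherwise it reads \<open>0 = 0\<close>, and \<open>z i = 1\<close> is chosen.
\<close>
definition bump_val :: "(nat \<Rightarrow> bool) \<Rightarrow> (nat \<Rightarrow> bool) \<Rightarrow> (nat \<Rightarrow> 'a::field) \<Rightarrow> (nat \<Rightarrow> 'a) \<Rightarrow> nat \<Rightarrow> 'a" where
  "bump_val c d x w i =
     (if stay_pat c d i then (if d i then x i else 0) + (if c i then carry c d x w (i - 1) else 0) else 1)"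

definition stay_val :: "(nat \<Rightarrow> bool) \<Rightarrow> (nat \<Rightarrow> bool) \<Rightarrow> (nat \<Rightarrow> 'a::field) \<Rightarrow> (nat \<Rightarrow> 'a) \<Rightarrow> nat \<Rightarrow> 'a" where
  "stay_val c d x w i = x i * w i / bump_val c d x w i"

lemma carry_not_live: "\<not> live c d i \<Longrightarrow> carry c d x w i = 0"
  by (induction i) auto

lemma carry_eq:
  assumes "i \<ge> 1" "bump_val c d x w i \<noteq> 0"
  shows "carry c d x w i = w i - (if d i then stay_val c d x w i else 0)"
proof -
  obtain i' where i: "i = Suc i'" using assms(1) by (cases i) auto
  show ?thesis
  proof (cases "d i")
    case True
    let ?r = "if c i then carry c d x w i' else 0"
    have z: "bump_val c d x w i = x i + ?r"
      using True by (simp add: i bump_val_def stay_pat_def)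
    have "carry c d x w i = w i * ?r / (x i + ?r)"
      using True by (simp add: i)
    also have "\<dots> = w i - x i * w i / (x i + ?r)"
      using assms(2) unfolding z by (simp add: field_simps)
    finally show ?thesis using True by (simp add: stay_val_def z)
  qed (simp add: i)
qed

text \<open>
  Both products are lower triangular with two subdiagonals. The three nontrivial diagonals give
  \<open>z\<^sub>p y\<^sub>p = x\<^sub>p w\<^sub>p\<close>, the equation defining \<open>z\<close>, and the compatibility of the patterns.
\<close>
lemma row_mat_refactor:
  fixes x w :: "nat \<Rightarrow> 'a::field"
  assumes nz: "\<And>i. 1 \<le> i \<Longrightarrow> i \<le> n \<Longrightarrow> bump_val c d x w i \<noteq> 0"
  shows "row_mat n c x * row_mat n d w =
         row_mat n (bump_pat c d) (bump_val c d x w) * row_mat n (stay_pat c d) (stay_val c d x w)"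
proof (rule eq_matI)
  fix i j assume "i < dim_row (row_mat n (bump_pat c d) (bump_val c d x w) * row_mat n (stay_pat c d) (stay_val c d x w))"
    and "j < dim_col (row_mat n (bump_pat c d) (bump_val c d x w) * row_mat n (stay_pat c d) (stay_val c d x w))"
  then have ij: "i < n" "j < n" by auto
  let ?z = "bump_val c d x w" and ?y = "stay_val c d x w"
  have diag: "?z p * ?y p = x p * w p" if "1 \<le> p" "p \<le> n" for p
    using nz[OF that] by (simp add: stay_val_def)
  have sub: "?z p * (if stay_pat c d p then 1 else 0) + (if bump_pat c d p then ?y (p - 1) else 0) =
      x p * (if d p then 1 else 0) + (if c p then w (p - 1) else 0)" if "2 \<le> p" "p \<le> n" for p
  proof -
    have "?z p * (if stay_pat c d p then 1 else 0) =
        (if d p then x p else 0) + (if c p then carry c d x w (p - 1) else 0)"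
      using carry_not_live[of c d "p - 1" x w] by (auto simp: bump_val_def stay_pat_def)
    moreover have "carry c d x w (p - 1) = w (p - 1) - (if d (p - 1) then ?y (p - 1) else 0)"
      using that by (intro carry_eq nz) auto
    ultimately show ?thesis by (auto simp: bump_pat_def)
  qed
  have subsub: "bump_pat c d p \<and> stay_pat c d (p - 1) \<longleftrightarrow> c p \<and> d (p - 1)" for p
    by (auto simp: bump_pat_def stay_pat_def)
  show "(row_mat n c x * row_mat n d w) $$ (i, j) =
     (row_mat n (bump_pat c d) ?z * row_mat n (stay_pat c d) ?y) $$ (i, j)"
    unfolding row_mat_mult_row_mat_index[OF ij]
    using diag[of "i + 1"] sub[of "i + 1"] subsub[of "i + 1"] ij by auto
qed simp_all

lemma liveI:
  assumes "q \<ge> 1" "\<not> d 1" "\<And>p. 2 \<le> p \<Longrightarrow> p \<le> q \<Longrightarrow> d p \<Longrightarrow> c p"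
  shows "live c d q"
  using assms
proof (induction q rule: nat_induct_at_least)
  case base
  then show ?case by simp
next
  case (Suc q)
  then show ?case by auto
qed

section \<open>Letter counts of row insertion\<close>

text \<open>
  A weakly increasing word with \<open>w p\<close> letters \<open>p\<close> is inserted into a row with \<open>x p\<close> letters \<open>p\<close>. Each
  letter of the word bumps the least larger letter that is still available. So \<open>queue x w p\<close> letters
  of the word are at most \<open>p\<close> and have not bumped a letter up to \<open>p\<close>, and of the letters \<open>p\<close> as many
  are bumped as there are waiting letters below \<open>p\<close>.
\<close>
fun queue :: "(nat \<Rightarrow> nat) \<Rightarrow> (nat \<Rightarrow> nat) \<Rightarrow> nat \<Rightarrow> nat" where
  "queue x w 0 = 0"
| "queue x w (Suc i) = w (Suc i) + (queue x w i - x (Suc i))"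

definition bump_cnt :: "(nat \<Rightarrow> nat) \<Rightarrow> (nat \<Rightarrow> nat) \<Rightarrow> nat \<Rightarrow> nat" where
  "bump_cnt x w i = min (x i) (queue x w (i - 1))"

definition stay_cnt :: "(nat \<Rightarrow> nat) \<Rightarrow> (nat \<Rightarrow> nat) \<Rightarrow> nat \<Rightarrow> nat" where
  "stay_cnt x w i = x i - bump_cnt x w i + w i"

text \<open>
  For rows of equal length, or a shorter row below a longer one, being strictly increasing down the
  columns means \<open>cum x2 p \<le> cum x (p - 1)\<close> for all \<open>p\<close>, where \<open>x2\<close> is the lower row.
\<close>
definition cum :: "(nat \<Rightarrow> nat) \<Rightarrow> nat \<Rightarrow> nat" where
  "cum x p = (\<Sum>q = 1..p. x q)"

lemma cum_0 [simp]: "cum x 0 = 0" and cum_Suc [simp]: "cum x (Suc p) = cum x p + x (Suc p)"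
  by (simp_all add: cum_def)

lemma cum_mono: "p \<le> q \<Longrightarrow> cum x p \<le> cum x q"
  by (induction q rule: dec_induct) auto

lemma queue_conservation: "queue x w p + cum (bump_cnt x w) p = cum w p"
  by (induction p) (auto simp: bump_cnt_def)

lemma cum_stay: "cum (stay_cnt x w) p + cum (bump_cnt x w) p = cum x p + cum w p"
  by (induction p) (auto simp: stay_cnt_def bump_cnt_def)

text \<open>lemma A\<close>
text \<open>
  The letters that wait in the lower row up to \<open>p\<close> were bumped out of the upper row, where they were
  letters of \<open>x\<close>; column-strictness therefore bounds their number.
\<close>
lemma queue_below:
  assumes "\<And>p. p \<le> n \<Longrightarrow> cum x2 p \<le> cum x (p - 1)" "p \<le> n"
  shows "queue x2 (bump_cnt x w) p + cum x2 p \<le> cum x (p - 1) + bump_cnt x w p"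
  using assms(2)
proof (induction p)
  case 0
  then show ?case by simp
next
  case (Suc p)
  have "cum x2 (Suc p) \<le> cum x p" using assms(1)[of "Suc p"] Suc.prems by simp
  moreover have "bump_cnt x w p + cum x (p - 1) \<le> cum x p"
    by (cases p) (auto simp: bump_cnt_def)
  ultimately show ?case using Suc by auto
qed

text \<open>The rows that a word has passed satisfy the assumption of \<open>queue_below\<close> again.\<close>
lemma stay_columns_strict:
  assumes "\<And>p. p \<le> n \<Longrightarrow> cum x2 p \<le> cum x (p - 1)" "p \<le> n"
  shows "cum (stay_cnt x2 (bump_cnt x w)) p \<le> cum (stay_cnt x w) (p - 1)"
proof -
  have "cum (stay_cnt x2 (bump_cnt x w)) p = cum x2 p + queue x2 (bump_cnt x w) p"
    using cum_stay[of x2 "bump_cnt x w" p] queue_conservation[of x2 "bump_cnt x w" p] by simp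
  also have "\<dots> \<le> cum x (p - 1) + bump_cnt x w p"
    using queue_below[OF assms, of w] by simp
  also have "\<dots> \<le> cum x (p - 1) + queue x w (p - 1)"
    by (simp add: bump_cnt_def)
  also have "\<dots> = cum (stay_cnt x w) (p - 1)"
    using cum_stay[of x w "p - 1"] queue_conservation[of x w "p - 1"] by simp
  finally show ?thesis .
qed

text \<open>lemma B\<close>
text \<open>
  If \<open>w'\<close> is inserted first and lies columnwise strictly below \<open>w\<close>, the same holds for the bumped
  words: the letters of \<open>w'\<close> are then part of the row, and \<open>w\<close> bumps at least as many letters up to
  \<open>q\<close> as there are letters of \<open>w'\<close> up to \<open>q\<close>.
\<close>
lemma bump_columns_strict:
  assumes strict: "\<And>p. p \<le> n \<Longrightarrow> cum w' p \<le> cum w (p - 1)" "p \<le> n"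
  shows "cum (bump_cnt x w') p \<le> cum (bump_cnt (stay_cnt x w') w) (p - 1)"
proof (cases p)
  case (Suc q)
  have "q \<le> n \<Longrightarrow> cum w' q \<le> cum (bump_cnt (stay_cnt x w') w) q" for q
  proof (induction q)
    case (Suc q)
    let ?y = "stay_cnt x w'"
    have step: "cum (bump_cnt ?y w) (Suc q) = cum (bump_cnt ?y w) q + min (?y (Suc q)) (queue ?y w q)"
      by (simp add: bump_cnt_def)
    have "cum w' (Suc q) \<le> cum w q" using strict(1)[of "Suc q"] Suc.prems by simp
    moreover have "w' (Suc q) \<le> ?y (Suc q)" by (simp add: stay_cnt_def)
    ultimately show ?case using step Suc queue_conservation[of ?y w q] by (auto simp: min_def)
  qed simp
  then have "cum w' q \<le> cum (bump_cnt (stay_cnt x w') w) q" using assms(2) Suc by simp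
  moreover have "cum (bump_cnt x w') (Suc q) \<le> cum w' q"
  proof -
    have "cum (bump_cnt x w') (Suc q) \<le> cum (bump_cnt x w') q + queue x w' q" by (simp add: bump_cnt_def)
    then show ?thesis using queue_conservation[of x w' q] by simp
  qed
  ultimately show ?thesis using Suc by simp
qed simp

lemma queue_zero: "(\<And>p. 1 \<le> p \<Longrightarrow> p \<le> q \<Longrightarrow> w p = 0) \<Longrightarrow> queue x w q = 0"
  by (induction q) auto

lemma queue_zero_from: 
  assumes "queue x w q = 0" "q \<le> r" "\<And>p. q < p \<Longrightarrow> p \<le> r \<Longrightarrow> w p = 0"
  shows "queue x w r = 0"
  using assms(2,3,1) by (induction r rule: dec_induct) auto

lemma cum_eq_beyond: "p \<le> q \<Longrightarrow> (\<And>r. p < r \<Longrightarrow> r \<le> q \<Longrightarrow> x r = 0) \<Longrightarrow> cum x q = cum x p"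
  by (induction q rule: dec_induct) auto

section \<open>Row insertion as the tropicalization of the refactorization\<close>

text \<open>
  Row insertion bumps \<open>min (x p) (queue x w (p - 1))\<close> letters \<open>p\<close>, and this is the tropical value of
  \<open>x p + carry (p - 1)\<close>. If a vanishing subdiagonal entry removes one of the two summands from
  \<open>bump_val\<close>, the minimum has to be attained by the other one; if both are removed, it has to be 0.
\<close>
definition agree_conditions :: "nat \<Rightarrow> (nat \<Rightarrow> bool) \<Rightarrow> (nat \<Rightarrow> bool) \<Rightarrow> (nat \<Rightarrow> nat) \<Rightarrow> (nat \<Rightarrow> nat) \<Rightarrow> bool" where
  "agree_conditions n c d x w \<longleftrightarrow> (\<forall>p. 1 \<le> p \<and> p \<le> n \<longrightarrow>
     (\<not> d p \<longrightarrow> queue x w (p - 1) \<le> x p) \<and>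
     (d p \<longrightarrow> \<not> (c p \<and> live c d (p - 1)) \<longrightarrow> x p \<le> queue x w (p - 1)) \<and>
     (\<not> d p \<longrightarrow> \<not> (c p \<and> live c d (p - 1)) \<longrightarrow> queue x w (p - 1) = 0))"

context
  fixes n :: nat and V :: "'v set" and b :: "'v \<Rightarrow> int" and X W :: "('v \<Rightarrow> complex) \<Rightarrow> nat \<Rightarrow> complex"
    and x w :: "nat \<Rightarrow> nat" and c d :: "nat \<Rightarrow> bool"
  assumes X: "\<And>p. 1 \<le> p \<Longrightarrow> p \<le> n \<Longrightarrow> has_trop V b (\<lambda>z. X z p) (int (x p))"
    and W: "\<And>p. 1 \<le> p \<Longrightarrow> p \<le> n \<Longrightarrow> has_trop V b (\<lambda>z. W z p) (int (w p))"
    and agree: "agree_conditions n c d x w"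
begin

lemma carry_trop:
  assumes "p \<le> n" "live c d p"
  shows "has_trop V b (\<lambda>z. carry c d (X z) (W z) p) (int (queue x w p))"
  using assms
proof (induction p)
  case 0
  then show ?case by simp
next
  case (Suc p)
  note W' = W[of "Suc p"] and X' = X[of "Suc p"]
  show ?case
  proof (cases "d (Suc p)")
    case False
    then have "queue x w p \<le> x (Suc p)"
      using agree Suc.prems unfolding agree_conditions_def by (auto dest!: spec[of _ "Suc p"])
    then show ?thesis using W' Suc.prems False by simp
  next
    case True
    with Suc have c: "c (Suc p)" and IH: "has_trop V b (\<lambda>z. carry c d (X z) (W z) p) (int (queue x w p))"
      by auto
    have "has_trop V b
      (\<lambda>z. W z (Suc p) * carry c d (X z) (W z) p / (X z (Suc p) + carry c d (X z) (W z) p))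
      (int (w (Suc p)) + int (queue x w p) - min (int (x (Suc p))) (int (queue x w p)))"
      using Suc.prems by (intro has_trop_divide has_trop_mult has_trop_add W' X' IH) auto
    also have "int (w (Suc p)) + int (queue x w p) - min (int (x (Suc p))) (int (queue x w p)) =
       int (queue x w (Suc p))" by (simp add: min_def of_nat_diff)
    finally show ?thesis using True c by simp
  qed
qed

lemma bump_val_trop:
  assumes p: "1 \<le> p" "p \<le> n"
  shows "has_trop V b (\<lambda>z. bump_val c d (X z) (W z) p) (int (bump_cnt x w p))"
proof -
  have IH: "has_trop V b (\<lambda>z. carry c d (X z) (W z) (p - 1)) (int (queue x w (p - 1)))"
    if "live c d (p - 1)"
    using carry_trop[OF _ that] p by simp
  have agree': "\<not> d p \<Longrightarrow> queue x w (p - 1) \<le> x p"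
     "d p \<Longrightarrow> \<not> (c p \<and> live c d (p - 1)) \<Longrightarrow> x p \<le> queue x w (p - 1)"
     "\<not> d p \<Longrightarrow> \<not> (c p \<and> live c d (p - 1)) \<Longrightarrow> queue x w (p - 1) = 0"
    using agree p unfolding agree_conditions_def by blast+
  consider "d p" "c p \<and> live c d (p - 1)" | "d p" "\<not> (c p \<and> live c d (p - 1))"
    | "\<not> d p" "c p \<and> live c d (p - 1)" | "\<not> d p" "\<not> (c p \<and> live c d (p - 1))" by blast
  then show ?thesis
  proof cases
    case 1
    have "has_trop V b (\<lambda>z. X z p + carry c d (X z) (W z) (p - 1))
       (min (int (x p)) (int (queue x w (p - 1))))"
      using 1 by (intro has_trop_add X p IH) auto
    then show ?thesis using 1 by (simp add: bump_val_def bump_cnt_def stay_pat_def of_nat_min)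
  next
    case 2
    then have "bump_val c d (X z) (W z) p = X z p" for z
      using carry_not_live[of c d "p - 1"] by (auto simp: bump_val_def stay_pat_def)
    then show ?thesis using X[OF p] agree'(2)[OF 2] by (simp add: bump_cnt_def min_absorb1)
  next
    case 3
    then show ?thesis using IH agree'(1) by (simp add: bump_val_def bump_cnt_def stay_pat_def min_absorb2)
  next
    case 4
    then have "bump_val c d (X z) (W z) p = 1" for z by (auto simp: bump_val_def stay_pat_def)
    then show ?thesis using agree'(3)[OF 4] has_trop_one[of V b] by (simp add: bump_cnt_def)
  qed
qed

lemma stay_val_trop:
  assumes p: "1 \<le> p" "p \<le> n"
  shows "has_trop V b (\<lambda>z. stay_val c d (X z) (W z) p) (int (stay_cnt x w p))"
proof -
  have "has_trop V b (\<lambda>z. stay_val c d (X z) (W z) p) (int (x p) + int (w p) - int (bump_cnt x w p))"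
    unfolding stay_val_def
    by (intro has_trop_divide has_trop_mult X W p bump_val_trop)
  also have "int (x p) + int (w p) - int (bump_cnt x w p) = int (stay_cnt x w p)"
    by (simp add: stay_cnt_def bump_cnt_def of_nat_diff)
  finally show ?thesis .
qed

end

section \<open>Inserting one rectangle into another\<close>

text \<open>
  Each of the words \<open>W0 0, W0 1, \<dots>\<close> passes through the rows \<open>X0 0, X0 1, \<dots>\<close>. When word \<open>j\<close> with
  current content \<open>incoming j i\<close> meets row \<open>i\<close> with content \<open>resident j i\<close>, the function \<open>f j i\<close>
  returns the new content of the row and of the word. The scheme is used for letter counts, for the
  diagonal entries of bidiagonal matrices, and for lists.
\<close>
fun resident :: "(nat \<Rightarrow> nat \<Rightarrow> 'r \<Rightarrow> 'r \<Rightarrow> 'r \<times> 'r) \<Rightarrow> (nat \<Rightarrow> 'r) \<Rightarrow> (nat \<Rightarrow> 'r) \<Rightarrow> nat \<Rightarrow> nat \<Rightarrow> 'r"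
  and incoming :: "(nat \<Rightarrow> nat \<Rightarrow> 'r \<Rightarrow> 'r \<Rightarrow> 'r \<times> 'r) \<Rightarrow> (nat \<Rightarrow> 'r) \<Rightarrow> (nat \<Rightarrow> 'r) \<Rightarrow> nat \<Rightarrow> nat \<Rightarrow> 'r" where
  "resident f X0 W0 0 i = X0 i"
| "resident f X0 W0 (Suc j) i = fst (f j i (resident f X0 W0 j i) (incoming f X0 W0 j i))"
| "incoming f X0 W0 j 0 = W0 j"
| "incoming f X0 W0 j (Suc i) = snd (f j i (resident f X0 W0 j i) (incoming f X0 W0 j i))"

lemma grid_induct:
  assumes "\<And>i. A 0 i" "\<And>j i. A j i \<Longrightarrow> B j i \<Longrightarrow> A (Suc j) i"
    and "\<And>j. B j 0" "\<And>j i. A j i \<Longrightarrow> B j i \<Longrightarrow> B j (Suc i)"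
  shows "A j i \<and> B j i"
proof (induction "j + i" arbitrary: j i rule: less_induct)
  case less
  show ?case
  proof
    show "A j i" using assms(1,2) less by (cases j) auto
    show "B j i" using assms(3,4) less by (cases i) auto
  qed
qed

text \<open>
  \<open>X0 i\<close> counts the letters in row \<open>i\<close> of \<open>T\<close>, and \<open>W0 j\<close> those in row \<open>j\<close> of \<open>U\<close>, counted from the
  bottom, which is the order of insertion.
\<close>
locale rect_pair =
  fixes n m1 m2 L :: nat and X0 W0 :: "nat \<Rightarrow> nat \<Rightarrow> nat"
  assumes m1: "1 \<le> m1" "m1 < n" and m2: "1 \<le> m2" "m2 < n"
    and X0_support: "i < m1 \<Longrightarrow> X0 i p \<noteq> 0 \<Longrightarrow> i + 1 \<le> p \<and> p \<le> i + 1 + (n - m1)"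
    and X0_empty: "m1 \<le> i \<Longrightarrow> X0 i p = 0"
    and X0_total: "i < m1 \<Longrightarrow> cum (X0 i) n = L"
    and X0_strict: "i + 1 < m1 \<Longrightarrow> p \<le> n \<Longrightarrow> cum (X0 (i + 1)) p \<le> cum (X0 i) (p - 1)"
    and W0_support: "j < m2 \<Longrightarrow> W0 j p \<noteq> 0 \<Longrightarrow> m2 - j \<le> p \<and> p \<le> n"
    and W0_strict: "j + 1 < m2 \<Longrightarrow> p \<le> n \<Longrightarrow> cum (W0 j) p \<le> cum (W0 (j + 1)) (p - 1)"
begin

definition m :: nat where "m = max m1 m2"

text \<open>
  The patterns of subdiagonal entries while the words pass through the rows. Row \<open>i\<close> starts with the
  band \<open>{i + 2..base i}\<close>; it is empty for the rows \<open>i \<ge> m1\<close> added to \<open>T\<close>. From the moment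
  marked by \<open>ext\<close> on, the row has in addition the band of the last word that met it. The band of word
  \<open>j\<close> starts at \<open>m2 - j + i + 1\<close> when the word meets row \<open>i\<close>, and it ends at \<open>upper i j\<close>. The rows
  of \<open>U\<close> themselves are given bands that extend to \<open>n\<close>.
\<close>
definition base :: "nat \<Rightarrow> nat" where
  "base i = (if i < m1 then i + 1 + (n - m1) else i + 1)"

definition ext :: "nat \<Rightarrow> nat \<Rightarrow> bool" where
  "ext i j \<longleftrightarrow> (if i < m1 then i < j else i < m1 + j)"

definition upper :: "nat \<Rightarrow> nat \<Rightarrow> nat" where
  "upper i j = (if ext i (j + 1) then n else base i - 1)"

definition res_pat :: "nat \<Rightarrow> nat \<Rightarrow> nat \<Rightarrow> bool" where
  "res_pat j i p \<longleftrightarrow> (i + 1 < p \<and> p \<le> base i) \<or> (ext i j \<and> m2 - j + i + 1 < p \<and> p \<le> n)"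

definition inc_pat :: "nat \<Rightarrow> nat \<Rightarrow> nat \<Rightarrow> bool" where
  "inc_pat j i p \<longleftrightarrow> m2 - j + i < p \<and> p \<le> upper i j"

lemma ext_mono: "ext i j \<Longrightarrow> ext i (j + 1)"
  by (auto simp: ext_def split: if_splits)

lemma base_le: "i < m \<Longrightarrow> base i \<le> n"
  using m1 m2 by (auto simp: base_def m_def)

lemma upper_Suc: "i < m \<Longrightarrow> upper (i + 1) j = (if ext i j then n else base i)"
  using m1 m2 by (auto simp: upper_def base_def ext_def m_def)

lemma bump_pat_eq:
  assumes "i < m" "j < m2" "2 \<le> p" "p \<le> n"
  shows "bump_pat (res_pat j i) (inc_pat j i) p \<longleftrightarrow> inc_pat j (i + 1) p"
proof -
  have "inc_pat j (i + 1) p \<longleftrightarrow> m2 - j + i + 1 < p \<and> p \<le> (if ext i j then n else base i)"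
    unfolding inc_pat_def upper_Suc[OF assms(1)] by simp
  moreover have "bump_pat (res_pat j i) (inc_pat j i) p \<longleftrightarrow>
     ((i + 1 < p \<and> p \<le> base i) \<or> (ext i j \<and> m2 - j + i + 1 < p \<and> p \<le> n)) \<and>
     m2 - j + i < p - 1 \<and> p - 1 \<le> (if ext i (j + 1) then n else base i - 1)"
    by (simp add: bump_pat_def res_pat_def inc_pat_def upper_def)
  moreover have "base i \<le> n" "ext i j \<Longrightarrow> ext i (j + 1)" using base_le[OF assms(1)] ext_mono by auto
  ultimately show ?thesis using assms by auto
qed

text \<open>The carry does not vanish as long as the band of the row covers that of the incoming word.\<close>
lemma live_below:
  assumes "i < m" "j < m2" "1 \<le> q" "\<And>p. m2 - j + i < p \<Longrightarrow> p \<le> q \<Longrightarrow> p \<le> upper i j \<Longrightarrow> res_pat j i p"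
  shows "live (res_pat j i) (inc_pat j i) q"
  using assms by (intro liveI) (auto simp: inc_pat_def)

lemma stay_pat_eq:
  assumes "i < m" "j < m2" "2 \<le> p" "p \<le> n"
  shows "stay_pat (res_pat j i) (inc_pat j i) p \<longleftrightarrow> res_pat (j + 1) i p"
proof -
  have b: "base i \<le> n" using base_le assms by simp
  have u: "m2 - j \<ge> 1" "m2 - (j + 1) + 1 = m2 - j" using assms by auto
  have base_live: "live (res_pat j i) (inc_pat j i) (p - 1)" if "i + 1 < p" "p \<le> base i"
    using that assms u by (intro live_below) (auto simp: res_pat_def)
  show ?thesis
  proof (cases "ext i (j + 1)")
    case True
    then show ?thesis using assms b u base_live
      by (auto simp: stay_pat_def res_pat_def inc_pat_def upper_def)
  next
    case False
    then have "\<not> ext i j" using ext_mono by blast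
    with False show ?thesis using assms b u base_live
      by (auto simp: stay_pat_def res_pat_def inc_pat_def upper_def)
  qed
qed

definition xc :: "nat \<Rightarrow> nat \<Rightarrow> nat \<Rightarrow> nat" where
  "xc = resident (\<lambda>_ _ x w. (stay_cnt x w, bump_cnt x w)) X0 W0"

definition wc :: "nat \<Rightarrow> nat \<Rightarrow> nat \<Rightarrow> nat" where
  "wc = incoming (\<lambda>_ _ x w. (stay_cnt x w, bump_cnt x w)) X0 W0"

lemma xc_simps: "xc 0 i = X0 i" "xc (Suc j) i = stay_cnt (xc j i) (wc j i)"
  and wc_simps: "wc j 0 = W0 j" "wc j (Suc i) = bump_cnt (xc j i) (wc j i)"
  by (simp_all add: xc_def wc_def)

text \<open>
  Apart from the ends of the bands, either both summands are present or there are no letters. Two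
  cases remain. \<open>E1\<close>: the band of the row ends one position after that of the word, so that there
  all waiting letters must find a partner. \<open>E3\<close>: the two bands of the row are separated by a gap,
  which interrupts the carry, so that beyond the gap all letters of the row must be bumped.
\<close>
lemma cell_agree:
  assumes i: "i < m" and j: "j < m2"
    and w: "\<And>p. 1 \<le> p \<Longrightarrow> w p \<noteq> 0 \<Longrightarrow> m2 - j + i \<le> p \<and> p \<le> upper i j"
    and x: "\<And>p. p \<le> n \<Longrightarrow> x p \<noteq> 0 \<Longrightarrow> p \<le> base i \<or> (ext i j \<and> m2 - j + i < p)"
    and E1: "\<not> ext i (j + 1) \<Longrightarrow> m2 - j + i < base i \<Longrightarrow> queue x w (base i - 1) \<le> x (base i)"
    and E3: "\<And>p. ext i j \<Longrightarrow> base i \<le> m2 - j + i \<Longrightarrow> m2 - j + i < p \<Longrightarrow> p \<le> n \<Longrightarrow> x p \<le> queue x w (p - 1)"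
  shows "agree_conditions n (res_pat j i) (inc_pat j i) x w"
  unfolding agree_conditions_def
proof (intro allI impI, elim conjE)
  fix p assume p: "1 \<le> p" "p \<le> n"
  let ?a = "m2 - j + i"
  let ?live = "res_pat j i p \<and> live (res_pat j i) (inc_pat j i) (p - 1)"
  have b: "base i \<le> n" "i < base i" using base_le i by (auto simp: base_def)
  have a1: "?a \<ge> 1" using j by simp
  have low: "queue x w (p - 1) = 0" if "p \<le> ?a"
    using that w by (intro queue_zero) force
  have base_live: ?live if "i + 1 < p" "p \<le> base i"
    using that assms j by (auto simp: res_pat_def intro!: live_below)
  show "(\<not> inc_pat j i p \<longrightarrow> queue x w (p - 1) \<le> x p) \<and>
     (inc_pat j i p \<longrightarrow> \<not> ?live \<longrightarrow> x p \<le> queue x w (p - 1)) \<and>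
     (\<not> inc_pat j i p \<longrightarrow> \<not> ?live \<longrightarrow> queue x w (p - 1) = 0)"
  proof (cases "inc_pat j i p")
    case True
    then have pa: "?a < p" "p \<le> upper i j" by (auto simp: inc_pat_def)
    have "x p \<le> queue x w (p - 1)" if nl: "\<not> ?live"
    proof -
      have pb: "base i < p" using base_live nl pa j by fastforce
      then have e1: "ext i (j + 1)" using pa by (auto simp: upper_def split: if_splits)
      show ?thesis
      proof (cases "ext i j")
        case False
        then have "x p = 0" using x[of p] pb p by force
        then show ?thesis by simp
      next
        case True
        have "base i \<le> ?a"
        proof (rule ccontr)
          assume "\<not> base i \<le> ?a"
          then have ?live using pa p True j i
            by (auto simp: res_pat_def intro!: live_below)
          with nl show False by blast
        qed
        then show ?thesis using E3 True pa p by blast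
      qed
    qed
    with True show ?thesis by blast
  next
    case False
    show ?thesis
    proof (cases "p \<le> ?a")
      case True
      then show ?thesis using low False by simp
    next
      case pa: False
      then have ne: "\<not> ext i (j + 1)" and pb: "base i \<le> p"
        using False p b by (auto simp: inc_pat_def upper_def split: if_splits)
      then have up: "upper i j = base i - 1" by (simp add: upper_def)
      show ?thesis
      proof (cases "p = base i")
        case True
        then have ?live using pa j by (intro base_live) auto
        then show ?thesis using E1 ne pa True False by auto
      next
        case neq: False
        have q0: "queue x w (base i) = 0"
        proof (cases "?a < base i")
          case True
          have "queue x w (base i - 1) \<le> x (base i)" using E1 ne True by blast
          moreover have "w (base i) = 0" using w[of "base i"] up b by fastforce
          moreover have "base i = Suc (base i - 1)" using b by simp
          ultimately show ?thesis using queue.simps(2)[of x w "base i - 1"] by simp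
        next
          case False
          then show ?thesis using w up b by (intro queue_zero) force
        qed
        have "w q = 0" if "base i < q" for q
          using w[of q] up that by force
        moreover have "base i \<le> p - 1" using neq pb by linarith
        ultimately have "queue x w (p - 1) = 0"
          by (intro queue_zero_from[OF q0]) simp_all
        then show ?thesis using False by simp
      qed
    qed
  qed
qed

definition support_ok :: "nat \<Rightarrow> nat \<Rightarrow> bool" where
  "support_ok j i \<longleftrightarrow> (\<forall>p. 1 \<le> p \<longrightarrow> xc j i p \<noteq> 0 \<longrightarrow> p \<le> base i \<or> (ext i j \<and> m2 - j + i < p \<and> p \<le> n))"

definition inc_support_ok :: "nat \<Rightarrow> nat \<Rightarrow> bool" where
  "inc_support_ok j i \<longleftrightarrow> (\<forall>p. 1 \<le> p \<longrightarrow> wc j i p \<noteq> 0 \<longrightarrow> m2 - j + i \<le> p \<and> p \<le> upper i j)"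

lemma supports: "(i < m \<longrightarrow> j \<le> m2 \<longrightarrow> support_ok j i) \<and> (i \<le> m \<longrightarrow> j < m2 \<longrightarrow> inc_support_ok j i)"
proof (rule grid_induct[where A = "\<lambda>j i. i < m \<longrightarrow> j \<le> m2 \<longrightarrow> support_ok j i"
      and B = "\<lambda>j i. i \<le> m \<longrightarrow> j < m2 \<longrightarrow> inc_support_ok j i"])
  show "i < m \<longrightarrow> 0 \<le> m2 \<longrightarrow> support_ok 0 i" for i
    using X0_support[of i] X0_empty[of i] by (force simp: support_ok_def xc_simps base_def)
  show "0 \<le> m \<longrightarrow> j < m2 \<longrightarrow> inc_support_ok j 0" for j
    using W0_support[of j] m1 by (auto simp: inc_support_ok_def wc_simps upper_def ext_def)
  show "Suc i \<le> m \<longrightarrow> j < m2 \<longrightarrow> inc_support_ok j (Suc i)"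
    if A: "i < m \<longrightarrow> j \<le> m2 \<longrightarrow> support_ok j i" and B: "i \<le> m \<longrightarrow> j < m2 \<longrightarrow> inc_support_ok j i" for i j
  proof (intro impI)
    assume i: "Suc i \<le> m" and j: "j < m2"
    have A': "support_ok j i" and B': "inc_support_ok j i" using A B i j by auto
    show "inc_support_ok j (Suc i)" unfolding inc_support_ok_def
    proof (intro allI impI)
      fix p :: nat assume p: "1 \<le> p" and "wc j (Suc i) p \<noteq> 0"
      then have x: "xc j i p \<noteq> 0" and q: "queue (xc j i) (wc j i) (p - 1) \<noteq> 0"
        by (auto simp: wc_simps bump_cnt_def)
      have "m2 - j + i < p"
      proof (rule ccontr)
        assume "\<not> m2 - j + i < p"
        then have "queue (xc j i) (wc j i) (p - 1) = 0"
          using B' by (intro queue_zero) (force simp: inc_support_ok_def)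
        with q show False by simp
      qed
      moreover have "p \<le> (if ext i j then n else base i)"
        using A' x p base_le[of i] i unfolding support_ok_def by (auto dest!: spec[of _ p])
      ultimately show "m2 - j + Suc i \<le> p \<and> p \<le> upper (Suc i) j"
        using upper_Suc[of i j] i by simp
    qed
  qed
  show "i < m \<longrightarrow> Suc j \<le> m2 \<longrightarrow> support_ok (Suc j) i"
    if A: "i < m \<longrightarrow> j \<le> m2 \<longrightarrow> support_ok j i" and B: "i \<le> m \<longrightarrow> j < m2 \<longrightarrow> inc_support_ok j i" for i j
  proof (intro impI)
    assume i: "i < m" and j: "Suc j \<le> m2"
    have A': "support_ok j i" and B': "inc_support_ok j i" using A B i j by auto
    show "support_ok (Suc j) i" unfolding support_ok_def
    proof (intro allI impI)
      fix p :: nat assume p: "1 \<le> p" and "xc (Suc j) i p \<noteq> 0"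
      then consider "xc j i p \<noteq> 0" | "wc j i p \<noteq> 0" by (auto simp: xc_simps stay_cnt_def)
      then show "p \<le> base i \<or> (ext i (Suc j) \<and> m2 - Suc j + i < p \<and> p \<le> n)"
      proof cases
        case 1
        then show ?thesis using A' p ext_mono[of i j] unfolding support_ok_def by force
      next
        case 2
        then have "m2 - j + i \<le> p" "p \<le> upper i j" using B' p unfolding inc_support_ok_def by blast+
        then show ?thesis using j by (auto simp: upper_def split: if_splits)
      qed
    qed
  qed
qed

lemma xc_support: "i < m \<Longrightarrow> j \<le> m2 \<Longrightarrow> 1 \<le> p \<Longrightarrow> xc j i p \<noteq> 0 \<Longrightarrow>
    p \<le> base i \<or> (ext i j \<and> m2 - j + i < p \<and> p \<le> n)"
  using supports[of i j] unfolding support_ok_def by blast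

lemma wc_support: "i \<le> m \<Longrightarrow> j < m2 \<Longrightarrow> 1 \<le> p \<Longrightarrow> wc j i p \<noteq> 0 \<Longrightarrow> m2 - j + i \<le> p \<and> p \<le> upper i j"
  using supports[of i j] unfolding inc_support_ok_def by blast

lemma incoming_columns_strict:
  assumes "Suc j < m2" "p \<le> n"
  shows "cum (wc j i) p \<le> cum (wc (Suc j) i) (p - 1)"
  using assms(2)
proof (induction i arbitrary: p)
  case 0
  then show ?case using W0_strict[of j p] assms(1) by (simp add: wc_simps)
next
  case (Suc i)
  then show ?case unfolding wc_simps xc_simps by (intro bump_columns_strict)
qed

definition rows_ok :: "nat \<Rightarrow> bool" where
  "rows_ok j \<longleftrightarrow> (\<forall>i. j \<le> i \<and> i < m1 \<longrightarrow> cum (xc j i) n = L) \<and>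
     (\<forall>i p. j \<le> i \<and> i + 1 < m1 \<and> p \<le> n \<longrightarrow> cum (xc j (i + 1)) p \<le> cum (xc j i) (p - 1))"

text \<open>
  The rows \<open>i\<close> and \<open>i + 1\<close> still have equal length and are columnwise strict, so every letter bumped
  out of row \<open>i\<close> finds a larger letter in row \<open>i + 1\<close>.
\<close>
lemma all_bumped:
  assumes "rows_ok j" "j \<le> i" "i + 1 < m1" "j < m2"
  shows "queue (xc j (i + 1)) (wc j (i + 1)) (base (i + 1) - 1) \<le> xc j (i + 1) (base (i + 1))"
proof -
  define D where "D = base i"
  have D: "base (i + 1) = Suc D" "Suc D \<le> n" "i + 1 < m" "1 \<le> D"
    using assms(3) m1 by (auto simp: D_def base_def m_def)
  have ne: "\<not> ext (i + 1) j" using assms(2,3) by (simp add: ext_def)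
  have "queue (xc j (i + 1)) (wc j (i + 1)) D + cum (xc j (i + 1)) D \<le>
        cum (xc j i) (D - 1) + bump_cnt (xc j i) (wc j i) D"
    using queue_below[of D "xc j (i + 1)" "xc j i" D "wc j i"] assms(1-3) D
    by (simp add: wc_simps rows_ok_def)
  also have "\<dots> \<le> cum (xc j i) D" using D(4) by (cases D) (auto simp: bump_cnt_def)
  also have "\<dots> \<le> cum (xc j i) n" using D by (intro cum_mono) auto
  also have "\<dots> = cum (xc j (i + 1)) n" using assms(1-3) by (simp add: rows_ok_def)
  also have "\<dots> = cum (xc j (i + 1)) (Suc D)"
  proof (rule cum_eq_beyond[OF D(2)])
    fix r assume "Suc D < r" "r \<le> n"
    then show "xc j (i + 1) r = 0" using xc_support[of "i + 1" j r] D ne assms(4) by fastforce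
  qed
  finally show ?thesis using D(1) by simp
qed

lemma rows_ok: "j \<le> m2 \<Longrightarrow> rows_ok j"
proof (induction j)
  case 0
  then show ?case using X0_total X0_strict by (auto simp: rows_ok_def xc_simps)
next
  case (Suc j)
  then have IH: "rows_ok j" and j: "j < m2" by auto
  show ?case unfolding rows_ok_def
  proof (intro conjI allI impI)
    fix i assume "Suc j \<le> i \<and> i < m1"
    then obtain i' where i: "i = Suc i'" "j \<le> i'" "i' + 1 < m1" by (cases i) auto
    have im: "i < m" using i by (simp add: m_def)
    have b: "base i = Suc (base i - 1)" "base i \<le> n" using base_le[OF im] by (auto simp: base_def)
    have ne: "\<not> ext i (j + 1)" using i by (simp add: ext_def)
    have w0: "wc j i p = 0" if "base i \<le> p" for p
      using wc_support[of i j p] im j ne that b by (force simp: upper_def)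
    obtain D where D: "base i = Suc D" using b(1) by blast
    have "queue (xc j i) (wc j i) (base i) = 0"
      using all_bumped[OF IH i(2,3) j] w0[of "base i"] unfolding D i(1) Suc_eq_plus1[symmetric]
      using D i(1) by simp
    then have "queue (xc j i) (wc j i) n = 0"
      by (rule queue_zero_from) (use b w0 in auto)
    then have "cum (xc (Suc j) i) n = cum (xc j i) n"
      using cum_stay[of "xc j i" "wc j i" n] queue_conservation[of "xc j i" "wc j i" n] by (simp add: xc_simps)
    then show "cum (xc (Suc j) i) n = L" using IH i by (simp add: rows_ok_def)
  next
    fix i p assume "Suc j \<le> i \<and> i + 1 < m1 \<and> p \<le> n"
    then show "cum (xc (Suc j) (i + 1)) p \<le> cum (xc (Suc j) i) (p - 1)"
      using stay_columns_strict[of n "xc j (i + 1)" "xc j i" p "wc j i"] IH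
      by (simp add: rows_ok_def xc_simps wc_simps)
  qed
qed

text \<open>
  Beyond the gap the row contains only letters of the preceding word, and that word lies columnwise
  strictly below the present one.
\<close>
lemma all_old_bumped:
  assumes "j < m2" "i < m" "ext i j" "base i \<le> m2 - j + i" "m2 - j + i < p" "p \<le> n"
  shows "xc j i p \<le> queue (xc j i) (wc j i) (p - 1)"
  using assms
proof (induction j arbitrary: p)
  case 0
  then show ?case by (simp add: ext_def split: if_splits)
next
  case (Suc j)
  define a where "a = m2 - Suc j + i"
  have a: "m2 - j + i = Suc a" using Suc.prems(1) by (simp add: a_def)
  have old: "xc (Suc j) i q \<le> wc j i q" if q: "a < q" "q \<le> n" for q
  proof -
    have "xc j i q \<le> bump_cnt (xc j i) (wc j i) q"
    proof (cases "xc j i q = 0")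
      case False
      then have "ext i j" "Suc a < q"
        using xc_support[of i j q] Suc.prems q a by (auto simp: a_def)
      then show ?thesis using Suc.IH[of q] Suc.prems q a by (simp add: bump_cnt_def a_def)
    qed simp
    then show ?thesis by (simp add: xc_simps stay_cnt_def)
  qed
  let ?x = "xc (Suc j) i" and ?w = "wc (Suc j) i"
  have p: "a < p" "p \<le> n" using Suc.prems by (auto simp: a_def)
  have "r \<le> n \<Longrightarrow> cum (bump_cnt ?x ?w) r \<le> cum (wc j i) r" for r
  proof (induction r)
    case (Suc r)
    have "bump_cnt ?x ?w (Suc r) \<le> wc j i (Suc r)"
    proof (cases "Suc r \<le> a")
      case True
      have "queue ?x ?w r = 0"
        by (rule queue_zero) (use wc_support[of i "Suc j"] \<open>Suc j < m2\<close> \<open>i < m\<close> True in \<open>force simp: a_def\<close>)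
      then show ?thesis by (simp add: bump_cnt_def)
    next
      case False
      then show ?thesis using old[of "Suc r"] Suc.prems by (simp add: bump_cnt_def)
    qed
    then show ?case using Suc by simp
  qed simp
  from this[of "p - 1"] have "cum (bump_cnt ?x ?w) (p - 1) \<le> cum (wc j i) (p - 1)" using p by simp
  moreover have "cum (wc j i) p = cum (wc j i) (p - 1) + wc j i p" using p by (cases p) auto
  moreover have "cum (wc j i) p \<le> cum ?w (p - 1)"
    using Suc.prems(1) p by (intro incoming_columns_strict) auto
  ultimately show ?case using queue_conservation[of ?x ?w "p - 1"] old[OF p] by linarith
qed

lemma agree:
  assumes "i < m" "j < m2"
  shows "agree_conditions n (res_pat j i) (inc_pat j i) (xc j i) (wc j i)"
proof (rule cell_agree[OF assms])
  show "m2 - j + i \<le> p \<and> p \<le> upper i j" if "1 \<le> p" "wc j i p \<noteq> 0" for p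
    using wc_support[of i j p] assms that by simp
  show "p \<le> base i \<or> (ext i j \<and> m2 - j + i < p)" if "p \<le> n" "xc j i p \<noteq> 0" for p
    using xc_support[of i j p] assms that by (cases "p = 0") auto
  show "queue (xc j i) (wc j i) (base i - 1) \<le> xc j i (base i)" if "\<not> ext i (j + 1)" "m2 - j + i < base i"
  proof -
    have "i < m1" using that assms by (auto simp: base_def split: if_splits)
    moreover from this have "j + 1 \<le> i" using that by (simp add: ext_def)
    ultimately show ?thesis using all_bumped[OF rows_ok, of j "i - 1"] assms by simp
  qed
qed (use all_old_bumped assms in blast)

context
  fixes X W :: "nat \<Rightarrow> nat \<Rightarrow> complex"
begin

definition xv :: "nat \<Rightarrow> nat \<Rightarrow> nat \<Rightarrow> complex" where
  "xv = resident (\<lambda>j i x w. (stay_val (res_pat j i) (inc_pat j i) x w, bump_val (res_pat j i) (inc_pat j i) x w)) X W"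

definition wv :: "nat \<Rightarrow> nat \<Rightarrow> nat \<Rightarrow> complex" where
  "wv = incoming (\<lambda>j i x w. (stay_val (res_pat j i) (inc_pat j i) x w, bump_val (res_pat j i) (inc_pat j i) x w)) X W"

lemma xv_simps: "xv 0 i = X i" "xv (Suc j) i = stay_val (res_pat j i) (inc_pat j i) (xv j i) (wv j i)"
  and wv_simps: "wv j 0 = W j" "wv j (Suc i) = bump_val (res_pat j i) (inc_pat j i) (xv j i) (wv j i)"
  by (simp_all add: xv_def wv_def)

abbreviation tower :: "nat \<Rightarrow> nat \<Rightarrow> complex mat" where
  "tower j \<equiv> row_tower n (res_pat j) (xv j)"

fun in_prod :: "nat \<Rightarrow> complex mat" where
  "in_prod 0 = 1\<^sub>m n"
| "in_prod (Suc j) = in_prod j * row_mat n (inc_pat j 0) (wv j 0)"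

fun out_prod :: "nat \<Rightarrow> complex mat" where
  "out_prod 0 = 1\<^sub>m n"
| "out_prod (Suc j) = out_prod j * row_mat n (inc_pat j m) (wv j m)"

lemma in_prod_carrier [simp]: "in_prod j \<in> carrier_mat n n" by (induction j) auto
lemma out_prod_carrier [simp]: "out_prod j \<in> carrier_mat n n" by (induction j) auto

text \<open>One application of \<open>row_mat_refactor\<close> for every row that the word passes.\<close>
lemma tower_pass:
  assumes j: "j < m2" and nz: "\<And>i p. i < m \<Longrightarrow> 1 \<le> p \<Longrightarrow> p \<le> n \<Longrightarrow> wv j (Suc i) p \<noteq> 0"
  shows "i \<le> m \<Longrightarrow> tower j i * row_mat n (inc_pat j 0) (wv j 0) =
    row_mat n (inc_pat j i) (wv j i) * tower (Suc j) i"
proof (induction i)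
  case 0
  then show ?case by simp
next
  case (Suc i)
  let ?R = "row_mat n (res_pat j i) (xv j i)" and ?W = "\<lambda>i. row_mat n (inc_pat j i) (wv j i)"
  have swap: "?R * ?W i = ?W (Suc i) * row_mat n (res_pat (Suc j) i) (xv (Suc j) i)"
  proof -
    have "?R * ?W i = row_mat n (bump_pat (res_pat j i) (inc_pat j i)) (wv j (Suc i)) *
       row_mat n (stay_pat (res_pat j i) (inc_pat j i)) (xv (Suc j) i)"
      unfolding wv_simps xv_simps by (rule row_mat_refactor) (use nz Suc.prems in \<open>simp add: wv_simps\<close>)
    also have "row_mat n (bump_pat (res_pat j i) (inc_pat j i)) (wv j (Suc i)) = ?W (Suc i)"
      by (rule row_mat_cong) (use bump_pat_eq Suc.prems j in auto)
    also have "row_mat n (stay_pat (res_pat j i) (inc_pat j i)) (xv (Suc j) i) =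
        row_mat n (res_pat (Suc j) i) (xv (Suc j) i)"
      by (rule row_mat_cong) (use stay_pat_eq Suc.prems j in auto)
    finally show ?thesis .
  qed
  have "tower j (Suc i) * ?W 0 = ?R * (tower j i * ?W 0)"
    by (simp add: assoc_mult_mat[of _ n n _ n _ n])
  also have "\<dots> = ?R * (?W i * tower (Suc j) i)" using Suc by simp
  also have "\<dots> = (?R * ?W i) * tower (Suc j) i"
    by (simp add: assoc_mult_mat[of _ n n _ n _ n])
  also have "\<dots> = ?W (Suc i) * tower (Suc j) (Suc i)"
    unfolding swap by (simp add: assoc_mult_mat[of _ n n _ n _ n])
  finally show ?case .
qed

lemma tower_in_prod:
  assumes nz: "\<And>j i p. j < m2 \<Longrightarrow> i < m \<Longrightarrow> 1 \<le> p \<Longrightarrow> p \<le> n \<Longrightarrow> wv j (Suc i) p \<noteq> 0"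
  shows "j \<le> m2 \<Longrightarrow> tower 0 m * in_prod j = out_prod j * tower j m"
proof (induction j)
  case 0
  then show ?case
    using left_mult_one_mat[OF row_tower_carrier, of n "res_pat 0" "xv 0" m]
      right_mult_one_mat[OF row_tower_carrier, of n "res_pat 0" "xv 0" m] by simp
next
  case (Suc j)
  let ?W = "\<lambda>i. row_mat n (inc_pat j i) (wv j i)"
  have "tower 0 m * in_prod (Suc j) = (tower 0 m * in_prod j) * ?W 0"
    by (simp add: assoc_mult_mat[of _ n n _ n _ n])
  also have "\<dots> = (out_prod j * tower j m) * ?W 0" using Suc by simp
  also have "\<dots> = out_prod j * (tower j m * ?W 0)"
    by (simp add: assoc_mult_mat[of _ n n _ n _ n])
  also have "\<dots> = out_prod j * (?W m * tower (Suc j) m)"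
    using tower_pass[of j m] nz Suc.prems by simp
  also have "\<dots> = out_prod (Suc j) * tower (Suc j) m"
    by (simp add: assoc_mult_mat[of _ n n _ n _ n])
  finally show ?case .
qed

end

lemma grid_trop:
  assumes X: "\<And>i p. i < m \<Longrightarrow> 1 \<le> p \<Longrightarrow> p \<le> n \<Longrightarrow> has_trop V b (\<lambda>z. X z i p) (int (X0 i p))"
    and W: "\<And>j p. j < m2 \<Longrightarrow> 1 \<le> p \<Longrightarrow> p \<le> n \<Longrightarrow> has_trop V b (\<lambda>z. W z j p) (int (W0 j p))"
  shows xv_trop: "i < m \<Longrightarrow> j \<le> m2 \<Longrightarrow> 1 \<le> p \<Longrightarrow> p \<le> n \<Longrightarrow>
      has_trop V b (\<lambda>z. xv (X z) (W z) j i p) (int (xc j i p))"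
    and wv_trop: "i \<le> m \<Longrightarrow> j < m2 \<Longrightarrow> 1 \<le> p \<Longrightarrow> p \<le> n \<Longrightarrow>
      has_trop V b (\<lambda>z. wv (X z) (W z) j i p) (int (wc j i p))"
proof -
  define A where "A j i \<longleftrightarrow> (i < m \<longrightarrow> j \<le> m2 \<longrightarrow> (\<forall>p. 1 \<le> p \<longrightarrow> p \<le> n \<longrightarrow>
      has_trop V b (\<lambda>z. xv (X z) (W z) j i p) (int (xc j i p))))" for j i
  define B where "B j i \<longleftrightarrow> (i \<le> m \<longrightarrow> j < m2 \<longrightarrow> (\<forall>p. 1 \<le> p \<longrightarrow> p \<le> n \<longrightarrow>
      has_trop V b (\<lambda>z. wv (X z) (W z) j i p) (int (wc j i p))))" for j i
  have AB: "A j i \<and> B j i" for j i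
  proof (rule grid_induct[where A = A and B = B])
    show "A 0 i" for i using X by (simp add: A_def xv_simps xc_simps)
    show "B j 0" for j using W by (simp add: B_def wv_simps wc_simps)
    show "A (Suc j) i" if "A j i" "B j i" for j i
      unfolding A_def xv_simps xc_simps
    proof (intro impI allI)
      fix p assume h: "i < m" "Suc j \<le> m2" "1 \<le> p" "p \<le> n"
      show "has_trop V b (\<lambda>z. stay_val (res_pat j i) (inc_pat j i) (xv (X z) (W z) j i) (wv (X z) (W z) j i) p)
          (int (stay_cnt (xc j i) (wc j i) p))"
        by (rule stay_val_trop[where n = n and X = "\<lambda>z. xv (X z) (W z) j i" and W = "\<lambda>z. wv (X z) (W z) j i"])
          (use h that agree[of i j] in \<open>simp_all add: A_def B_def\<close>)
    qed
    show "B j (Suc i)" if "A j i" "B j i" for j i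
      unfolding B_def wv_simps wc_simps
    proof (intro impI allI)
      fix p assume h: "Suc i \<le> m" "j < m2" "1 \<le> p" "p \<le> n"
      show "has_trop V b (\<lambda>z. bump_val (res_pat j i) (inc_pat j i) (xv (X z) (W z) j i) (wv (X z) (W z) j i) p)
          (int (bump_cnt (xc j i) (wc j i) p))"
        by (rule bump_val_trop[where n = n and X = "\<lambda>z. xv (X z) (W z) j i" and W = "\<lambda>z. wv (X z) (W z) j i"])
          (use h that agree[of i j] in \<open>simp_all add: A_def B_def\<close>)
    qed
  qed
  show "i < m \<Longrightarrow> j \<le> m2 \<Longrightarrow> 1 \<le> p \<Longrightarrow> p \<le> n \<Longrightarrow>
      has_trop V b (\<lambda>z. xv (X z) (W z) j i p) (int (xc j i p))"
    using AB[of j i] by (simp add: A_def)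
  show "i \<le> m \<Longrightarrow> j < m2 \<Longrightarrow> 1 \<le> p \<Longrightarrow> p \<le> n \<Longrightarrow>
      has_trop V b (\<lambda>z. wv (X z) (W z) j i p) (int (wc j i p))"
    using AB[of j i] by (simp add: B_def)
qed

end

section \<open>The corner minor of the sorted product\<close>

lemma pick_enum:
  assumes "S = f ` {..<k}" "strict_mono_on {..<k} f" "a < k"
  shows "pick S a = f a"
proof -
  have lt: "f x < f y \<longleftrightarrow> x < y" if "x < k" "y < k" for x y :: nat
    using that strict_mono_onD[OF assms(2), of x y] strict_mono_onD[OF assms(2), of y x]
    by (cases x y rule: linorder_cases) auto
  have "{x \<in> S. x < f a} = f ` {..<a}"
    using assms(1,3) lt by auto
  moreover have "inj_on f {..<a}"
    using strict_mono_on_imp_inj_on[OF assms(2)] assms(3) by (rule_tac inj_on_subset) auto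
  ultimately have "card {x \<in> S. x < f a} = a" by (simp add: card_image)
  then show ?thesis using pick_card_in_set[of "f a" S] assms by auto
qed

lemma shifted_interval: "(\<lambda>i. i - 1) ` {a + 1..b} = {a..<b :: nat}"
proof -
  have "x \<in> (\<lambda>i. i - 1) ` {a + 1..b}" if "x \<in> {a..<b}" for x
    using that by (intro image_eqI[of _ _ "x + 1"]) auto
  then show ?thesis by auto
qed

lemma minor_bottom_left:
  fixes A :: "'a::comm_ring_1 mat"
  assumes "A \<in> carrier_mat n n" "k \<le> n"
  shows "minor {n - k + 1..n} {1..k} A = det (mat k k (\<lambda>(a, b). A $$ (n - k + a, b)))"
proof -
  have sets: "(\<lambda>i. i - 1) ` {n - k + 1..n} = {n - k..<n}" "(\<lambda>i. i - 1) ` {1..k} = {0..<k}"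
    using shifted_interval[of "n - k" n] shifted_interval[of 0 k] by simp_all
  have pick1: "pick {n - k..<n} a = n - k + a" if "a < k" for a
  proof (rule pick_enum[OF _ _ that])
    show "{n - k..<n} = (+) (n - k) ` {..<k}"
      using image_add_atLeastLessThan[of "n - k" 0 k] assms(2) by (simp only: lessThan_atLeast0) simp
  qed (auto simp: strict_mono_on_def)
  have pick2: "pick {0..<k} a = a" if "a < k" for a
    by (rule pick_enum[OF _ _ that]) (auto simp: strict_mono_on_def)
  have c1: "{i. i < n \<and> i \<in> {n - k..<n}} = {n - k..<n}" "{i. i < n \<and> i \<in> {0..<k}} = {0..<k}"
    using assms(2) by auto
  have dims: "dim_row A = n" "dim_col A = n" using assms(1) by auto
  show ?thesis
    unfolding minor_def sets
    unfolding submatrix_def dims c1 card_atLeastLessThan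
    by (rule arg_cong[where f = det], rule eq_matI) (use assms(2) pick1 pick2 in auto)
qed

definition block_lower :: "nat \<Rightarrow> nat \<Rightarrow> 'a::comm_ring_1 mat \<Rightarrow> bool" where
  "block_lower n r A \<longleftrightarrow> A \<in> carrier_mat n n \<and>
     (\<forall>a<n. \<forall>b<n. a < b \<or> (r \<le> a \<and> b < r) \<longrightarrow> A $$ (a, b) = 0)"

lemma block_lower_mult:
  assumes "block_lower n r A" "block_lower n r B"
  shows "block_lower n r (A * B)" "a < n \<Longrightarrow> (A * B) $$ (a, a) = A $$ (a, a) * B $$ (a, a)"
proof -
  have AB: "(A * B) $$ (a, b) = (\<Sum>q = 0..<n. A $$ (a, q) * B $$ (q, b))" if "a < n" "b < n" for a b
  proof -
    have "A \<in> carrier_mat n n" "B \<in> carrier_mat n n" using assms by (auto simp: block_lower_def)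
    then show ?thesis using that by (simp add: scalar_prod_def)
  qed
  show "block_lower n r (A * B)"
    unfolding block_lower_def
  proof (intro conjI allI impI)
    show "A * B \<in> carrier_mat n n" using assms by (auto simp: block_lower_def)
    fix a b assume ab: "a < n" "b < n" "a < b \<or> (r \<le> a \<and> b < r)"
    have "A $$ (a, q) * B $$ (q, b) = 0" if "q < n" for q
    proof -
      have "(a < q \<or> (r \<le> a \<and> q < r)) \<or> (q < b \<or> (r \<le> q \<and> b < r))" using ab(3) by linarith
      then have "A $$ (a, q) = 0 \<or> B $$ (q, b) = 0"
        using assms ab that unfolding block_lower_def by blast
      then show ?thesis by auto
    qed
    then show "(A * B) $$ (a, b) = 0" using AB ab by (simp add: sum.neutral)
  qed
  assume a: "a < n"
  have "A $$ (a, q) * B $$ (q, a) = (if q = a then A $$ (a, a) * B $$ (a, a) else 0)" if "q < n" for q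
  proof (cases q a rule: linorder_cases)
    case less
    then have "B $$ (q, a) = 0" using assms(2) a that unfolding block_lower_def by blast
    then show ?thesis using less by simp
  next
    case greater
    then have "A $$ (a, q) = 0" using assms(1) a that unfolding block_lower_def by blast
    then show ?thesis using greater by simp
  qed simp
  then have "(A * B) $$ (a, a) = (\<Sum>q = 0..<n. if q = a then A $$ (a, a) * B $$ (a, a) else 0)"
    using AB[OF a a] by simp
  then show "(A * B) $$ (a, a) = A $$ (a, a) * B $$ (a, a)" using a by simp
qed

text \<open>
  In the last \<open>n - r\<close> rows of the product only the lower right block of \<open>Q\<close> contributes, and it
  multiplies the lower left block of \<open>A\<close>. The first is lower, the second upper unitriangular.
\<close>
lemma minor_block_lower_mult:
  fixes Q A :: "'a::idom mat"
  assumes Q: "block_lower n r Q" and A: "A \<in> carrier_mat n n" and r: "r \<le> n"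
    and zero: "\<And>a b. a < n \<Longrightarrow> b < n \<Longrightarrow> b + r < a \<Longrightarrow> A $$ (a, b) = 0"
    and one: "\<And>b. b + r < n \<Longrightarrow> A $$ (b + r, b) = 1"
  shows "minor {r + 1..n} {1..n - r} (Q * A) = (\<Prod>a\<in>{r..<n}. Q $$ (a, a))"
proof -
  let ?k = "n - r"
  define Qb where "Qb = mat ?k ?k (\<lambda>(a, b). Q $$ (r + a, r + b))"
  define Ab where "Ab = mat ?k ?k (\<lambda>(a, b). A $$ (r + a, b))"
  have Qc: "Q \<in> carrier_mat n n" using Q by (simp add: block_lower_def)
  have prod: "mat ?k ?k (\<lambda>(a, b). (Q * A) $$ (r + a, b)) = Qb * Ab"
  proof (rule eq_matI)
    fix a b assume "a < dim_row (Qb * Ab)" "b < dim_col (Qb * Ab)"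
    then have ab: "a < ?k" "b < ?k" by (auto simp: Qb_def Ab_def)
    have "(Q * A) $$ (r + a, b) = (\<Sum>q = 0..<n. Q $$ (r + a, q) * A $$ (q, b))"
      using ab Qc A by (simp add: scalar_prod_def)
    also have "\<dots> = (\<Sum>q = r..<n. Q $$ (r + a, q) * A $$ (q, b))"
      by (rule sum.mono_neutral_right) (use Q ab r in \<open>auto simp: block_lower_def\<close>)
    also have "\<dots> = (\<Sum>q = 0..<?k. Q $$ (r + a, r + q) * A $$ (r + q, b))"
      using sum.shift_bounds_nat_ivl[of "\<lambda>q. Q $$ (r + a, q) * A $$ (q, b)" 0 r ?k] r
      by (simp add: add.commute)
    also have "\<dots> = (Qb * Ab) $$ (a, b)"
      using ab by (simp add: Qb_def Ab_def scalar_prod_def)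
    finally show "mat ?k ?k (\<lambda>(a, b). (Q * A) $$ (r + a, b)) $$ (a, b) = (Qb * Ab) $$ (a, b)"
      using ab by simp
  qed (auto simp: Qb_def Ab_def)
  have "n - ?k = r" using r by simp
  then have "minor {r + 1..n} {1..?k} (Q * A) = det (Qb * Ab)"
    using minor_bottom_left[of "Q * A" n ?k] Qc A prod by simp
  also have "\<dots> = det Qb * det Ab"
    by (rule det_mult[of _ ?k]) (auto simp: Qb_def Ab_def)
  also have "det Ab = 1"
  proof -
    have "det Ab = prod_list (diag_mat Ab)"
      by (rule det_upper_triangular) (use zero in \<open>auto simp: Ab_def\<close>)
    also have "diag_mat Ab = map (\<lambda>_. 1) [0..<?k]"
      unfolding diag_mat_def by (rule map_cong) (use one in \<open>auto simp: Ab_def add.commute\<close>)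
    finally show ?thesis by (simp add: map_replicate_const)
  qed
  also have "det Qb = (\<Prod>a\<in>{r..<n}. Q $$ (a, a))"
  proof -
    have "det Qb = prod_list (diag_mat Qb)"
      by (rule det_lower_triangular[of ?k]) (use Q in \<open>auto simp: Qb_def block_lower_def\<close>)
    also have "\<dots> = (\<Prod>a\<in>{0..<?k}. Q $$ (a + r, a + r))"
      unfolding prod_list_diag_prod by (rule prod.cong) (auto simp: Qb_def add.commute)
    also have "\<dots> = (\<Prod>a\<in>{r..<n}. Q $$ (a, a))"
      using prod.shift_bounds_nat_ivl[of "\<lambda>a. Q $$ (a, a)" 0 r ?k] r by simp
    finally show ?thesis .
  qed
  finally show ?thesis by simp
qed

lemma block_lower_row_mat:
  assumes "\<And>p. c p \<Longrightarrow> r + 1 < p"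
  shows "block_lower n r (row_mat n c x)"
  using assms by (fastforce simp: block_lower_def row_mat_def)

context rect_pair
begin

lemma m_less: "m < n" using m1 m2 by (simp add: m_def)

lemma block_lower_out_prod:
  "j \<le> m2 \<Longrightarrow> block_lower n m (out_prod X W j) \<and>
     (\<forall>a<n. out_prod X W j $$ (a, a) = (\<Prod>j'<j. wv X W j' m (a + 1)))"
proof (induction j)
  case 0
  then show ?case by (auto simp: block_lower_def)
next
  case (Suc j)
  have R: "block_lower n m (row_mat n (inc_pat j m) (wv X W j m))"
    by (rule block_lower_row_mat) (use Suc.prems in \<open>auto simp: inc_pat_def\<close>)
  have IH: "block_lower n m (out_prod X W j)"
     "\<And>a. a < n \<Longrightarrow> out_prod X W j $$ (a, a) = (\<Prod>j'<j. wv X W j' m (a + 1))" using Suc by auto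
  have "row_mat n (inc_pat j m) (wv X W j m) $$ (a, a) = wv X W j m (a + 1)" if "a < n" for a
    using that by (simp add: row_mat_def)
  then show ?case using block_lower_mult[OF IH(1) R] IH(2) by simp
qed

text \<open>
  After all words have passed, row \<open>i\<close> still has the subdiagonal entries at \<open>i + 2, \<dots>, i + 1 + n - m\<close>;
  these make the diagonal of the lower left block of the tower equal to 1.
\<close>
lemma minor_eq_prod_out:
  assumes nz: "\<And>j i p. j < m2 \<Longrightarrow> i < m \<Longrightarrow> 1 \<le> p \<Longrightarrow> p \<le> n \<Longrightarrow> wv X W j (Suc i) p \<noteq> 0"
  shows "minor {m + 1..n} {1..n - m} (tower X W 0 m * in_prod X W m2) =
    (\<Prod>a\<in>{m..<n}. \<Prod>j<m2. wv X W j m (a + 1))"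
proof -
  have "tower X W 0 m * in_prod X W m2 = out_prod X W m2 * tower X W m2 m"
    by (rule tower_in_prod[OF nz]) auto
  moreover have "tower X W m2 m $$ (b + m, b) = 1" if "b + m < n" for b
    by (rule row_tower_corner[OF that])
      (use that m_less in \<open>auto simp: res_pat_def base_def ext_def m_def\<close>)
  ultimately show ?thesis
    using minor_block_lower_mult[of n m "out_prod X W m2" "tower X W m2 m"]
      block_lower_out_prod[of m2 X W] row_tower_below[where n = n and r = m and c = "res_pat m2" and x = "xv X W m2"]
      m_less by simp
qed

end

section \<open>Schensted insertion of words\<close>

fun insert_word :: "nat list \<Rightarrow> nat list \<Rightarrow> nat list \<times> nat list" where
  "insert_word r [] = (r, [])"
| "insert_word r (a # w) =
     (case row_insert a r of (r', y) \<Rightarrow>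
      case insert_word r' w of (r'', ys) \<Rightarrow> (r'', (case y of None \<Rightarrow> ys | Some b \<Rightarrow> b # ys)))"

lemma tab_insert_word_Cons:
  "fold tab_insert w (r # rs) =
     fst (insert_word r w) # fold tab_insert (snd (insert_word r w)) rs"
  by (induction w arbitrary: r rs) (auto split: prod.splits option.splits)

lemma row_insert_count:
  assumes "sorted r" "row_insert a r = (r', y)"
  shows "sorted r' \<and>
    (case y of None \<Rightarrow> (\<forall>x\<in>set r. x \<le> a) \<and> count_list r' = (count_list r)(a := count_list r a + 1)
     | Some q \<Rightarrow> a < q \<and> q \<in> set r \<and> (\<forall>x\<in>set r. x \<le> a \<or> q \<le> x) \<and>
         count_list r' = (count_list r)(a := count_list r a + 1, q := count_list r q - 1))"
  using assms
proof (induction a r arbitrary: r' y rule: row_insert.induct)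
  case (1 x)
  then show ?case by auto
next
  case (2 x y' ys)
  show ?case
  proof (cases "x < y'")
    case True
    with 2 have r: "r' = x # ys" "y = Some y'" "sorted ys" "\<forall>z\<in>set ys. y' \<le> z" by auto
    with True have "\<forall>z\<in>set ys. x \<le> z" by force
    with True r show ?thesis by (auto simp: fun_eq_iff)
  next
    case False
    then obtain s b where s: "row_insert x ys = (s, b)" "r' = y' # s" "y = b"
      using 2(3) by (auto split: prod.splits)
    have IH: "sorted s \<and>
    (case b of None \<Rightarrow> (\<forall>z\<in>set ys. z \<le> x) \<and> count_list s = (count_list ys)(x := count_list ys x + 1)
     | Some q \<Rightarrow> x < q \<and> q \<in> set ys \<and> (\<forall>z\<in>set ys. z \<le> x \<or> q \<le> z) \<and>
         count_list s = (count_list ys)(x := count_list ys x + 1, q := count_list ys q - 1))"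
      using 2(1)[OF False _ s(1)] 2(2) by simp
    have "set s \<subseteq> insert x (set ys)"
    proof
      fix z assume "z \<in> set s"
      then have "count_list s z \<noteq> 0" by (simp add: count_list_0_iff)
      then have "z = x \<or> count_list ys z \<noteq> 0"
        using IH by (auto split: option.splits if_splits)
      then show "z \<in> insert x (set ys)" by (auto simp: count_list_0_iff)
    qed
    then have "sorted r'" using IH s(2) 2(2) False by auto
    moreover have "count_list ys q \<noteq> 0" if "q \<in> set ys" for q using that by (simp add: count_list_0_iff)
    ultimately show ?thesis using IH s False 2(2)
      by (auto split: option.splits simp: fun_eq_iff)
  qed
qed

lemma insert_word_snoc:
  "insert_word r (w @ [a]) =
     (case insert_word r w of (r', z) \<Rightarrow> case row_insert a r' of (r'', y) \<Rightarrow>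
        (r'', z @ (case y of None \<Rightarrow> [] | Some b \<Rightarrow> [b])))"
  by (induction w arbitrary: r) (auto split: prod.splits option.splits)

context
  fixes x w w' :: "nat \<Rightarrow> nat" and a :: nat
  assumes a: "1 \<le> a" and w': "w' a = Suc (w a)" "\<And>p. p \<noteq> a \<Longrightarrow> w' p = w p"
begin

lemma queue_add_letter_below: "p < a \<Longrightarrow> queue x w' p = queue x w p"
  by (induction p) (auto simp: w')

lemma queue_add_letter:
  assumes "a \<le> p" "\<And>p'. a < p' \<Longrightarrow> p' \<le> p \<Longrightarrow> x p' \<le> queue x w (p' - 1)"
  shows "queue x w' p = Suc (queue x w p)"
  using assms
proof (induction p rule: dec_induct)
  case base
  obtain a' where "a = Suc a'" using a by (cases a) auto
  then show ?case using queue_add_letter_below[of a'] w' by simp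
next
  case (step p)
  then have "x (Suc p) \<le> queue x w p" using step.prems[of "Suc p"] by simp
  moreover have "w' (Suc p) = w (Suc p)" using step.hyps by (intro w') simp
  ultimately show ?case using step by simp
qed

text \<open>The new letter \<open>a\<close> finds no larger letter, and it is appended to the row.\<close>
lemma bump_cnt_append:
  assumes full: "\<And>p. a < p \<Longrightarrow> x p \<le> queue x w (p - 1)"
  shows "bump_cnt x w' = bump_cnt x w"
proof
  fix p
  show "bump_cnt x w' p = bump_cnt x w p"
  proof (cases "p \<le> a")
    case True
    then show ?thesis using queue_add_letter_below[of "p - 1"] a
      by (cases "p = 0") (auto simp: bump_cnt_def)
  next
    case False
    then have "queue x w' (p - 1) = Suc (queue x w (p - 1))" "x p \<le> queue x w (p - 1)"
      using full by (auto intro: queue_add_letter)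
    then show ?thesis by (simp add: bump_cnt_def)
  qed
qed

text \<open>The new letter \<open>a\<close> bumps a letter \<open>q\<close>, the least one that is still available.\<close>
lemma bump_cnt_replace:
  assumes w: "\<And>p. a < p \<Longrightarrow> w p = 0" and q: "a < q"
    and full: "\<And>p. a < p \<Longrightarrow> p < q \<Longrightarrow> x p \<le> queue x w (p - 1)" and avail: "queue x w (q - 1) < x q"
  shows "bump_cnt x w' = (bump_cnt x w)(q := Suc (bump_cnt x w q))"
    and "q \<le> p \<Longrightarrow> queue x w p = 0"
proof -
  obtain q' where q': "q = Suc q'" "a \<le> q'" using q by (cases q) auto
  have w'0: "w' p = 0" if "a < p" for p using w[OF that] w'(2)[of p] that by simp
  have zero: "queue x w' q = 0 \<and> queue x w q = 0"
    using queue_add_letter[of q'] full avail w[of q] w'0[of q] q' by auto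
  have zero': "queue x w' p = 0 \<and> queue x w p = 0" if "q \<le> p" for p
    using that by (induction p rule: dec_induct) (use zero w w'0 q in auto)
  show "q \<le> p \<Longrightarrow> queue x w p = 0" using zero' by blast
  show "bump_cnt x w' = (bump_cnt x w)(q := Suc (bump_cnt x w q))"
  proof
    fix p
    consider "p \<le> a" | "a < p" "p < q" | "p = q" | "q < p" by linarith
    then show "bump_cnt x w' p = ((bump_cnt x w)(q := Suc (bump_cnt x w q))) p"
    proof cases
      case 1
      then show ?thesis using queue_add_letter_below[of "p - 1"] a q
        by (cases "p = 0") (auto simp: bump_cnt_def)
    next
      case 2
      then have "queue x w' (p - 1) = Suc (queue x w (p - 1))" "x p \<le> queue x w (p - 1)"
        using full by (auto intro: queue_add_letter)
      then show ?thesis using 2 by (simp add: bump_cnt_def)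
    next
      case 3
      have "queue x w' (q - 1) = Suc (queue x w (q - 1))"
        using full q q' by (intro queue_add_letter) auto
      then show ?thesis using 3 avail by (simp add: bump_cnt_def)
    next
      case 4
      then show ?thesis using zero'[of "p - 1"] q by (simp add: bump_cnt_def)
    qed
  qed
qed

end

text \<open>
  By induction on the word: its last letter is inserted into a row known from the induction
  hypothesis, and no letter bumped before exceeds the one bumped now.
\<close>
lemma insert_word_count:
  assumes "sorted r" "sorted w" "0 \<notin> set r" "0 \<notin> set w"
  shows "sorted (fst (insert_word r w)) \<and> sorted (snd (insert_word r w)) \<and>
    count_list (fst (insert_word r w)) = stay_cnt (count_list r) (count_list w) \<and>
    count_list (snd (insert_word r w)) = bump_cnt (count_list r) (count_list w)"
  using assms(2,4)
proof (induction w rule: rev_induct)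
  case Nil
  have "queue (count_list r) (\<lambda>_. 0) p = 0" for p by (induction p) auto
  then show ?case using assms(1) by (simp add: stay_cnt_def bump_cnt_def fun_eq_iff)
next
  case (snoc a w)
  let ?x = "count_list r" and ?w = "count_list w"
  obtain r' z where rz: "insert_word r w = (r', z)" by fastforce
  obtain r'' y where ry: "row_insert a r' = (r'', y)" by fastforce
  have w: "sorted w" "0 \<notin> set w" "1 \<le> a" "\<And>b. b \<in> set w \<Longrightarrow> b \<le> a"
    using snoc.prems by (auto simp: sorted_append)
  have IH: "sorted r'" "sorted z" "count_list r' = stay_cnt ?x ?w" "count_list z = bump_cnt ?x ?w"
    using snoc.IH w rz by auto
  define w' where "w' = count_list (w @ [a])"
  have w': "w' a = Suc (?w a)" "\<And>p. p \<noteq> a \<Longrightarrow> w' p = ?w p" by (auto simp: w'_def)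
  have w0: "?w p = 0" if "a < p" for p using w(4) that by (force simp: count_list_0_iff)
  have full: "?x p \<le> queue ?x ?w (p - 1)" if "p \<notin> set r'" for p
  proof -
    have "stay_cnt ?x ?w p = 0" using that IH(3) by (simp add: count_list_0_iff flip: IH(3))
    then show ?thesis by (simp add: stay_cnt_def bump_cnt_def)
  qed
  note ri = row_insert_count[OF IH(1) ry]
  show ?case
  proof (cases y)
    case None
    then have r'': "sorted r''" "\<And>x. x \<in> set r' \<Longrightarrow> x \<le> a"
      "count_list r'' = (stay_cnt ?x ?w)(a := Suc (stay_cnt ?x ?w a))" using ri IH(3) by auto
    have b: "bump_cnt ?x w' = bump_cnt ?x ?w"
    proof (rule bump_cnt_append[where a = a and x = ?x and w = ?w and w' = w', OF w(3) w'])
      fix p assume "a < p"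
      then have "p \<notin> set r'" using r''(2) by force
      then show "?x p \<le> queue ?x ?w (p - 1)" by (rule full)
    qed
    have "stay_cnt ?x w' = count_list r''"
      unfolding r''(3) by (simp add: fun_eq_iff stay_cnt_def b w')
    then show ?thesis using r''(1) IH(2,4) b unfolding insert_word_snoc rz w'_def[symmetric]
      by (simp add: ry None)
  next
    case (Some q)
    then have q: "a < q" "q \<in> set r'" "\<And>x. x \<in> set r' \<Longrightarrow> x \<le> a \<or> q \<le> x" and r'': "sorted r''"
      "count_list r'' = (stay_cnt ?x ?w)(a := Suc (stay_cnt ?x ?w a), q := stay_cnt ?x ?w q - 1)"
      using ri IH(3) by auto
    have avail: "queue ?x ?w (q - 1) < ?x q"
    proof -
      have "stay_cnt ?x ?w q \<noteq> 0" using q(2) unfolding IH(3)[symmetric] count_list_0_iff by simp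
      then show ?thesis using w0[OF q(1)] by (simp add: stay_cnt_def bump_cnt_def)
    qed
    have full': "?x p \<le> queue ?x ?w (p - 1)" if "a < p" "p < q" for p
      using q(3)[of p] that by (intro full) auto
    note b = bump_cnt_replace[where a = a and q = q and x = ?x and w = ?w and w' = w', OF w(3) w' w0 q(1) full' avail]
    have "stay_cnt ?x w' = count_list r''"
      unfolding r''(2) using q(1) w0[OF q(1)] by (auto simp: fun_eq_iff stay_cnt_def b(1) w')
    moreover have "count_list (z @ [q]) = bump_cnt ?x w'"
      by (auto simp: fun_eq_iff IH(4) b(1))
    moreover have "p \<le> q" if "p \<in> set z" for p
    proof (rule ccontr)
      assume "\<not> p \<le> q"
      then have "queue ?x ?w (p - 1) = 0" by (intro b(2)) auto
      then have "count_list z p = 0" by (simp add: IH(4) bump_cnt_def)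
      with that show False by (simp add: count_list_0_iff)
    qed
    ultimately show ?thesis using r''(1) IH(2) unfolding insert_word_snoc rz w'_def[symmetric]
      by (simp add: ry Some sorted_append)
  qed
qed

lemma row_insert_length:
  "length (fst (row_insert a r)) + length (case snd (row_insert a r) of None \<Rightarrow> [] | Some b \<Rightarrow> [b]) = Suc (length r)"
  by (induction a r rule: row_insert.induct) (auto split: prod.splits option.splits)

lemma tab_insert_size: "sum_list (map length (tab_insert a rs)) = Suc (sum_list (map length rs))"
proof (induction a rs rule: tab_insert.induct)
  case (2 x r rs)
  then show ?case using row_insert_length[of x r] by (auto split: prod.splits option.splits)
qed simp

lemma fold_tab_insert_size:
  "sum_list (map length (fold tab_insert w rs)) = sum_list (map length rs) + length w"
  by (induction w arbitrary: rs) (auto simp: tab_insert_size)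

lemma tab_insert_pad: "\<exists>k'. tab_insert a (rs @ replicate k []) = tab_insert a rs @ replicate k' []"
proof (induction a rs rule: tab_insert.induct)
  case (1 x)
  then show ?case by (cases k) auto
next
  case (2 x r rs)
  then show ?case by (auto split: prod.splits option.splits)
qed

text \<open>This allows \<open>T\<close> to be extended to \<open>m\<close> rows.\<close>
lemma fold_tab_insert_pad:
  "\<exists>k'. fold tab_insert w (rs @ replicate k []) = fold tab_insert w rs @ replicate k' []"
proof (induction w arbitrary: rs k)
  case (Cons a w)
  then show ?case using tab_insert_pad[of a rs k] by fastforce
qed auto

context rect_pair
begin

context
  fixes T U :: "nat list list"
  assumes T: "length T = m1" "\<And>i. i < m1 \<Longrightarrow> sorted (T ! i) \<and> 0 \<notin> set (T ! i) \<and> count_list (T ! i) = X0 i"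
    and U: "length U = m2" "\<And>j. j < m2 \<Longrightarrow> sorted (rev U ! j) \<and> 0 \<notin> set (rev U ! j) \<and> count_list (rev U ! j) = W0 j"
begin

definition lx :: "nat \<Rightarrow> nat \<Rightarrow> nat list" where
  "lx = resident (\<lambda>_ _. insert_word) (\<lambda>i. if i < m1 then T ! i else []) (\<lambda>j. rev U ! j)"

definition lw :: "nat \<Rightarrow> nat \<Rightarrow> nat list" where
  "lw = incoming (\<lambda>_ _. insert_word) (\<lambda>i. if i < m1 then T ! i else []) (\<lambda>j. rev U ! j)"

lemma lx_simps: "lx 0 i = (if i < m1 then T ! i else [])" "lx (Suc j) i = fst (insert_word (lx j i) (lw j i))"
  and lw_simps: "lw j 0 = rev U ! j" "lw j (Suc i) = snd (insert_word (lx j i) (lw j i))"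
  by (simp_all add: lx_def lw_def)

lemma list_grid_count:
  "j < m2 \<Longrightarrow> sorted (lw j i) \<and> 0 \<notin> set (lw j i) \<and> count_list (lw j i) = wc j i"
proof -
  define A where "A j i \<longleftrightarrow> (j \<le> m2 \<longrightarrow> sorted (lx j i) \<and> 0 \<notin> set (lx j i) \<and> count_list (lx j i) = xc j i)" for j i
  define B where "B j i \<longleftrightarrow> (j < m2 \<longrightarrow> sorted (lw j i) \<and> 0 \<notin> set (lw j i) \<and> count_list (lw j i) = wc j i)" for j i
  have zero: "0 \<notin> set xs \<longleftrightarrow> count_list xs 0 = 0" for xs :: "nat list" by (simp add: count_list_0_iff)
  have "A j i \<and> B j i" for j i
  proof (rule grid_induct[where A = A and B = B])
    show "A 0 i" for i using T X0_empty by (auto simp: A_def lx_simps xc_simps fun_eq_iff)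
    show "B j 0" for j using U by (auto simp: B_def lw_simps wc_simps)
    show "A (Suc j) i" if "A j i" "B j i" for j i
      using that insert_word_count[of "lx j i" "lw j i"] unfolding A_def B_def lx_simps xc_simps zero
      by (auto simp: stay_cnt_def)
    show "B j (Suc i)" if "A j i" "B j i" for j i
      using that insert_word_count[of "lx j i" "lw j i"] unfolding A_def B_def lw_simps wc_simps zero
      by (auto simp: bump_cnt_def)
  qed
  then show "j < m2 \<Longrightarrow> sorted (lw j i) \<and> 0 \<notin> set (lw j i) \<and> count_list (lw j i) = wc j i"
    by (auto simp: B_def)
qed

lemma fold_tab_insert_rows:
  "i \<le> m \<Longrightarrow> fold tab_insert (lw j i) (map (lx j) [i..<m] @ ex) =
     map (lx (Suc j)) [i..<m] @ fold tab_insert (lw j m) ex"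
proof (induction i rule: inc_induct)
  case base
  then show ?case by simp
next
  case (step i)
  then have "[i..<m] = i # [Suc i..<m]" by (simp add: upt_conv_Cons)
  then show ?case using step by (simp add: tab_insert_word_Cons lx_simps lw_simps)
qed

lemma fold_tab_insert_all:
  "j \<le> m2 \<Longrightarrow> \<exists>ex. fold tab_insert (concat (map (\<lambda>j. rev U ! j) [0..<j])) (map (lx 0) [0..<m]) =
     map (lx j) [0..<m] @ ex \<and> sum_list (map length ex) = (\<Sum>j'<j. length (lw j' m))"
proof (induction j)
  case 0
  then show ?case by simp
next
  case (Suc j)
  then obtain ex where ex: "fold tab_insert (concat (map (\<lambda>j. rev U ! j) [0..<j])) (map (lx 0) [0..<m]) =
     map (lx j) [0..<m] @ ex" "sum_list (map length ex) = (\<Sum>j'<j. length (lw j' m))" by auto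
  then show ?case using fold_tab_insert_rows[of 0 j ex]
    by (intro exI[of _ "fold tab_insert (lw j m) ex"]) (simp add: lw_simps fold_tab_insert_size)
qed

text \<open>
  Each letter pushed out of row \<open>m\<close> adds one box to the rows below, whatever happens there.
\<close>
lemma coenergy_eq_sum_out:
  assumes "m1 = n - k1" "m2 = n - k2"
  shows "coenergy n k1 k2 T U = (\<Sum>j<m2. \<Sum>p = m + 1..n. wc j m p)"
proof -
  have "map (lx 0) [0..<m] = T @ replicate (m - m1) []"
  proof (rule nth_equalityI)
    fix i assume "i < length (map (lx 0) [0..<m])"
    then show "map (lx 0) [0..<m] ! i = (T @ replicate (m - m1) []) ! i"
      using T(1) by (auto simp: lx_simps nth_append)
  qed (use T(1) in \<open>auto simp: m_def\<close>)
  moreover have "map (\<lambda>j. rev U ! j) [0..<m2] = rev U"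
    using U(1) map_nth[of "rev U"] by simp
  ultimately obtain ex where ex: "fold tab_insert (concat (rev U)) (T @ replicate (m - m1) []) =
     map (lx m2) [0..<m] @ ex" "sum_list (map length ex) = (\<Sum>j<m2. length (lw j m))"
    using fold_tab_insert_all[of m2] by auto
  obtain k' where "fold tab_insert (concat (rev U)) (T @ replicate (m - m1) []) =
     tab_prod T U @ replicate k' []"
    using fold_tab_insert_pad[of "concat (rev U)" T "m - m1"] by (auto simp: tab_prod_def)
  with ex(1) have "drop m (map (lx m2) [0..<m] @ ex) = drop m (tab_prod T U @ replicate k' [])" by simp
  then have "ex = drop m (tab_prod T U) @ replicate (k' - (m - length (tab_prod T U))) []" by simp
  then have "sum_list (map length ex) = sum_list (map length (drop m (tab_prod T U)))"
    by (simp add: sum_list_replicate)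
  then have "coenergy n k1 k2 T U = (\<Sum>j<m2. length (lw j m))"
    using ex(2) unfolding coenergy_def assms[symmetric] m_def[symmetric] by simp
  also have "\<dots> = (\<Sum>j<m2. \<Sum>p = m + 1..n. wc j m p)"
  proof (rule sum.cong)
    fix j assume "j \<in> {..<m2}"
    then have j: "j < m2" by simp
    note lw = list_grid_count[OF j, of m]
    have "set (lw j m) \<subseteq> {m + 1..n}"
    proof
      fix p assume p: "p \<in> set (lw j m)"
      then have "wc j m p \<noteq> 0" using lw count_list_0_iff[of "lw j m" p] by auto
      moreover have "1 \<le> p" using lw p by (cases p) auto
      ultimately have "m2 - j + m \<le> p" "p \<le> upper m j" using wc_support[of m j p] j by auto
      moreover have "upper m j \<le> n" using m_less by (auto simp: upper_def base_def m_def)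
      ultimately show "p \<in> {m + 1..n}" using j by auto
    qed
    then have "length (lw j m) = (\<Sum>p = m + 1..n. count_list (lw j m) p)"
      using sum_count_set[of "lw j m" "{m + 1..n}"] by simp
    then show "length (lw j m) = (\<Sum>p = m + 1..n. wc j m p)" using lw by simp
  qed simp
  finally show ?thesis .
qed

end

end

section \<open>Cramer's rule and banded products\<close>

definition rows_mat :: "nat \<Rightarrow> 'a mat \<Rightarrow> (nat \<Rightarrow> nat) \<Rightarrow> 'a mat" where
  "rows_mat k A f = mat k k (\<lambda>(a, b). A $$ (f a, b))"

lemma rows_mat_carrier [simp]: "rows_mat k A f \<in> carrier_mat k k"
  and rows_mat_index [simp]: "a < k \<Longrightarrow> b < k \<Longrightarrow> rows_mat k A f $$ (a, b) = A $$ (f a, b)"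
  and rows_mat_dim [simp]: "dim_row (rows_mat k A f) = k" "dim_col (rows_mat k A f) = k"
  by (simp_all add: rows_mat_def)

lemma rows_mat_cong: "(\<And>a. a < k \<Longrightarrow> f a = g a) \<Longrightarrow> rows_mat k A f = rows_mat k A g"
  by (rule eq_matI) auto

text \<open>The increasing enumeration of the numbers different from \<open>p\<close>.\<close>
definition skip :: "nat \<Rightarrow> nat \<Rightarrow> nat" where
  "skip p a = (if a < p then a else Suc a)"

text \<open>
  If \<open>x\<close> solves a linear system whose right hand side has a single nonzero entry \<open>s\<close>, Cramer's rule
  expresses \<open>x c\<close> by a minor without the row of \<open>s\<close>.
\<close>
lemma cramer_single_entry:
  fixes A :: "'a::comm_ring_1 mat"
  assumes p: "p < k" and c: "c < k"
    and v: "\<And>a. a < k \<Longrightarrow> (\<Sum>b<k. A $$ (f a, b) * x b) = (if a = p then s else 0)"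
  shows "det (rows_mat k A f) * x c =
    s * (-1) ^ (p + c) * det (mat (k - 1) (k - 1) (\<lambda>(a, b). A $$ (f (skip p a), skip c b)))"
proof -
  let ?B = "rows_mat k A f"
  have adj: "adj_mat ?B * ?B = det ?B \<cdot>\<^sub>m 1\<^sub>m k" and carr: "adj_mat ?B \<in> carrier_mat k k"
    using adj_mat[OF rows_mat_carrier, of k A f] by auto
  have ab: "(\<Sum>a<k. adj_mat ?B $$ (c, a) * ?B $$ (a, b)) = (if c = b then det ?B else 0)" if "b < k" for b
  proof -
    have "(adj_mat ?B * ?B) $$ (c, b) = (\<Sum>a<k. adj_mat ?B $$ (c, a) * ?B $$ (a, b))"
      using carr c that by (auto simp: scalar_prod_def lessThan_atLeast0 intro!: sum.cong)
    moreover have "(adj_mat ?B * ?B) $$ (c, b) = (if c = b then det ?B else 0)"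
      unfolding adj using c that by simp
    ultimately show ?thesis by simp
  qed
  have "det ?B * x c = (\<Sum>b<k. (if c = b then det ?B else 0) * x b)"
    using c by (simp add: if_distrib[of "\<lambda>t. t * _"] cong: if_cong)
  also have "\<dots> = (\<Sum>b<k. \<Sum>a<k. adj_mat ?B $$ (c, a) * (?B $$ (a, b) * x b))"
    by (rule sum.cong) (auto simp: ab[symmetric] sum_distrib_right mult.assoc)
  also have "\<dots> = (\<Sum>a<k. adj_mat ?B $$ (c, a) * (\<Sum>b<k. ?B $$ (a, b) * x b))"
    by (subst sum.swap) (simp add: sum_distrib_left)
  also have "\<dots> = (\<Sum>a<k. adj_mat ?B $$ (c, a) * (if a = p then s else 0))"
    using v by (intro sum.cong) auto
  also have "\<dots> = adj_mat ?B $$ (c, p) * s"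
    using p by (simp add: if_distrib[of "\<lambda>t. _ * t"] cong: if_cong)
  also have "adj_mat ?B $$ (c, p) = cofactor ?B p c"
    using p c by (simp add: adj_mat_def)
  also have "\<dots> = (-1) ^ (p + c) * det (mat (k - 1) (k - 1) (\<lambda>(a, b). A $$ (f (skip p a), skip c b)))"
  proof -
    have "mat_delete ?B p c = mat (k - 1) (k - 1) (\<lambda>(a, b). A $$ (f (skip p a), skip c b))"
      by (rule eq_matI) (use p c in \<open>auto simp: mat_delete_def skip_def\<close>)
    then show ?thesis by (simp add: cofactor_def)
  qed
  finally show ?thesis by (simp add: algebra_simps)
qed

text \<open>
  The row sets \<open>f\<close> and \<open>g\<close> agree except for one row each, and \<open>A x\<close> vanishes on the common rows. Both
  maximal minors are then multiples of the same smaller minor.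
\<close>
lemma cramer_exchange:
  fixes A :: "'a::field mat"
  assumes p: "p < k" and q: "q < k" and skip: "\<And>a. a < k - 1 \<Longrightarrow> f (skip p a) = g (skip q a)"
    and f: "\<And>a. a < k \<Longrightarrow> (\<Sum>b<k. A $$ (f a, b) * x b) = (if a = p then s else 0)"
    and g: "\<And>a. a < k \<Longrightarrow> (\<Sum>b<k. A $$ (g a, b) * x b) = (if a = q then t else 0)"
  shows "det (rows_mat k A f) * t * (-1) ^ q = det (rows_mat k A g) * s * (-1) ^ p"
proof (cases "\<exists>c<k. x c \<noteq> 0")
  case False
  then have "s = 0" "t = 0" using f[OF p] g[OF q] by auto
  then show ?thesis by simp
next
  case True
  then obtain c where c: "c < k" "x c \<noteq> 0" by blast
  define M where "M = det (mat (k - 1) (k - 1) (\<lambda>(a, b). A $$ (f (skip p a), skip c b)))"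
  have "mat (k - 1) (k - 1) (\<lambda>(a, b). A $$ (f (skip p a), skip c b)) =
        mat (k - 1) (k - 1) (\<lambda>(a, b). A $$ (g (skip q a), skip c b))"
    by (rule eq_matI) (auto simp: skip)
  then have M: "M = det (mat (k - 1) (k - 1) (\<lambda>(a, b). A $$ (g (skip q a), skip c b)))"
    by (simp add: M_def)
  have F: "det (rows_mat k A f) * x c = s * (-1) ^ (p + c) * M"
    unfolding M_def by (rule cramer_single_entry[where s = s, OF p c(1) f])
  have G: "det (rows_mat k A g) * x c = t * (-1) ^ (q + c) * M"
    unfolding M by (rule cramer_single_entry[where s = t, OF q c(1) g])
  have "(det (rows_mat k A f) * t * (-1) ^ q) * x c = (det (rows_mat k A f) * x c) * (t * (-1) ^ q)"
    by (simp add: ac_simps)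
  also have "\<dots> = (det (rows_mat k A g) * x c) * (s * (-1) ^ p)"
    unfolding F G by (simp add: power_add ac_simps)
  also have "\<dots> = (det (rows_mat k A g) * s * (-1) ^ p) * x c" by (simp add: ac_simps)
  finally show ?thesis using c(2) by simp
qed

lemma solve_unitriangular:
  fixes B :: "nat \<Rightarrow> nat \<Rightarrow> 'a::field"
  assumes "\<And>a b. a < k \<Longrightarrow> b < a \<Longrightarrow> B a b = 0" "\<And>a. a < k \<Longrightarrow> B a a = 1"
  shows "\<exists>x. \<forall>a<k. (\<Sum>b<k. B a b * x b) = y a"
proof -
  let ?B = "mat k k (\<lambda>(a, b). B a b)"
  have carr: "?B \<in> carrier_mat k k" by simp
  have "det ?B = prod_list (diag_mat ?B)"
    by (rule det_upper_triangular) (use assms in auto)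
  also have "\<dots> = 1" unfolding prod_list_diag_prod by (rule prod.neutral) (use assms in auto)
  finally have det: "det ?B = 1" .
  have adj: "?B * adj_mat ?B = 1\<^sub>m k" "adj_mat ?B \<in> carrier_mat k k"
    using adj_mat[OF carr] det by auto
  define x where "x b = (\<Sum>c<k. adj_mat ?B $$ (b, c) * y c)" for b
  have "(\<Sum>b<k. B a b * x b) = y a" if a: "a < k" for a
  proof -
    have ac: "(\<Sum>b<k. B a b * adj_mat ?B $$ (b, c)) = (if a = c then 1 else 0)" if "c < k" for c
    proof -
      have "(?B * adj_mat ?B) $$ (a, c) = (\<Sum>b<k. B a b * adj_mat ?B $$ (b, c))"
        using adj(2) a that by (auto simp: scalar_prod_def lessThan_atLeast0 intro!: sum.cong)
      moreover have "(?B * adj_mat ?B) $$ (a, c) = (if a = c then 1 else 0)"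
        unfolding adj(1) using a that by simp
      ultimately show ?thesis by simp
    qed
    have "(\<Sum>b<k. B a b * x b) = (\<Sum>b<k. \<Sum>c<k. B a b * adj_mat ?B $$ (b, c) * y c)"
      by (simp add: x_def sum_distrib_left mult.assoc)
    also have "\<dots> = (\<Sum>c<k. (\<Sum>b<k. B a b * adj_mat ?B $$ (b, c)) * y c)"
      by (subst sum.swap) (simp add: sum_distrib_right)
    also have "\<dots> = (\<Sum>c<k. (if a = c then 1 else 0) * y c)" by (rule sum.cong) (auto simp: ac)
    also have "\<dots> = y a" using a by (simp add: if_distrib[of "\<lambda>t. t * _"] cong: if_cong)
    finally show ?thesis .
  qed
  then show ?thesis by blast
qed

text \<open>
  The product \<open>Phi\<close> in the form of a tower: the subdiagonal band of each row has \<open>k\<close> entries, and the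
  diagonal entries of each row have the product \<open>t\<close>.
\<close>
locale banded =
  fixes n m k :: nat and t :: "'a::field" and c :: "nat \<Rightarrow> nat \<Rightarrow> bool" and x :: "nat \<Rightarrow> nat \<Rightarrow> 'a"
  assumes n: "n = m + k" and k: "1 \<le> k"
    and c: "\<And>r p. r < m \<Longrightarrow> c r p \<longleftrightarrow> r + 1 < p \<and> p \<le> r + 1 + k"
    and x1: "\<And>r p. r < m \<Longrightarrow> p < r + 1 \<or> r + 1 + k < p \<Longrightarrow> x r p = 1"
    and xt: "\<And>r. r < m \<Longrightarrow> (\<Prod>p = r + 1..r + 1 + k. x r p) = t"
    and t0: "t \<noteq> 0"
begin

abbreviation tw :: "nat \<Rightarrow> 'a mat" where "tw \<equiv> row_tower n c x"

lemma x_nonzero: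
  assumes "r < m"
  shows "x r p \<noteq> 0"
proof (cases "p < r + 1 \<or> r + 1 + k < p")
  case True
  then show ?thesis using x1[OF assms] by simp
next
  case False
  then have p: "p \<in> {r + 1..r + 1 + k}" by simp
  show ?thesis
  proof
    assume "x r p = 0"
    then have "(\<Prod>p = r + 1..r + 1 + k. x r p) = 0"
      using p by (intro prod_zero) auto
    then show False using xt[OF assms] t0 by metis
  qed
qed

lemma tw_Suc_index:
  assumes "r < m" "i < n" "j < n"
  shows "tw (Suc r) $$ (i, j) = x r (i + 1) * tw r $$ (i, j) +
     (if r < i \<and> i \<le> r + k then tw r $$ (i - 1, j) else 0)"
proof -
  have "0 < i \<and> c r (i + 1) \<longleftrightarrow> r < i \<and> i \<le> r + k" unfolding c[OF assms(1)] by auto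
  then show ?thesis unfolding row_tower_Suc_index[OF assms(2,3)] by (simp only:)
qed

lemma tw_outside:
  "r \<le> m \<Longrightarrow> i < n \<Longrightarrow> j < n \<Longrightarrow> r + k \<le> i \<or> r + k \<le> j \<Longrightarrow> tw r $$ (i, j) = (if i = j then 1 else 0)"
proof (induction r arbitrary: i)
  case (Suc r)
  then have r: "r < m" by simp
  have "tw r $$ (i, j) = (if i = j then 1 else 0)" using Suc by auto
  moreover have "tw r $$ (i - 1, j) = 0" if "r < i" "i \<le> r + k" using Suc.IH[of "i - 1"] Suc.prems that by auto
  ultimately show ?case
    using x1[OF r, of "i + 1"] Suc.prems unfolding tw_Suc_index[OF r Suc.prems(2,3)] by auto
qed simp

lemma tw_shape:
  assumes "r \<le> m" "i < n" "j < n"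
  shows "i < j \<Longrightarrow> tw r $$ (i, j) = 0" "j + r < i \<Longrightarrow> tw r $$ (i, j) = 0"
    "i = j + r \<Longrightarrow> j < k \<Longrightarrow> tw r $$ (i, j) = 1" "tw r $$ (j, j) \<noteq> 0"
    "r + k \<le> j \<Longrightarrow> tw r $$ (i, j) = (if i = j then 1 else 0)"
    "r + k \<le> i \<Longrightarrow> tw r $$ (i, j) = (if i = j then 1 else 0)"
proof -
  show "i = j + r \<Longrightarrow> j < k \<Longrightarrow> tw r $$ (i, j) = 1"
    using assms row_tower_corner[of j r n c x] by (simp add: c)
  show "tw r $$ (j, j) \<noteq> 0" using assms x_nonzero by (simp add: row_tower_diag)
qed (use assms in \<open>simp_all add: row_tower_above row_tower_below tw_outside\<close>)

text \<open>A vector in the span of the first \<open>k\<close> columns.\<close>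
definition span_vec :: "nat \<Rightarrow> (nat \<Rightarrow> 'a) \<Rightarrow> nat \<Rightarrow> 'a" where
  "span_vec r y i = (\<Sum>b<k. tw r $$ (i, b) * y b)"

lemma span_vec_Suc:
  assumes "r < m" "i < n"
  shows "span_vec (Suc r) y i = x r (i + 1) * span_vec r y i +
     (if r < i \<and> i \<le> r + k then span_vec r y (i - 1) else 0)"
proof -
  have "span_vec (Suc r) y i = (\<Sum>b<k. x r (i + 1) * (tw r $$ (i, b) * y b) +
     (if r < i \<and> i \<le> r + k then tw r $$ (i - 1, b) * y b else 0))"
    unfolding span_vec_def
  proof (rule sum.cong)
    fix b assume "b \<in> {..<k}"
    then have "b < n" using n by simp
    then show "tw (Suc r) $$ (i, b) * y b = x r (i + 1) * (tw r $$ (i, b) * y b) +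
       (if r < i \<and> i \<le> r + k then tw r $$ (i - 1, b) * y b else 0)"
      unfolding tw_Suc_index[OF assms \<open>b < n\<close>] by (simp add: algebra_simps)
  qed simp
  then show ?thesis
    by (cases "r < i \<and> i \<le> r + k") (auto simp: span_vec_def sum.distrib sum_distrib_left)
qed

text \<open>
  From row \<open>j\<close> on, column \<open>j \<ge> k\<close> of the tower agrees with a vector in the span of the first \<open>k\<close>
  columns that vanishes at \<open>j - k + 1, \<dots>, j - 1\<close>. By induction on the number of factors. A new factor
  maps the vectors for the old columns to such vectors. For the new column \<open>j = r + k\<close>, the tower
  without the new factor has unitriangular rows \<open>r, \<dots>, r + k - 1\<close>, so a vector in the span can be
  prescribed there; it is chosen such that the new factor annihilates the coordinates between
  \<open>r\<close> and \<open>r + k\<close>, and alternating signs with the product \<open>t\<close> of all diagonal entries result.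
\<close>
lemma exists_span_vec:
  assumes "r \<le> m" "k \<le> j" "j < k + r"
  shows "\<exists>y. (\<forall>i<n. j \<le> i \<longrightarrow> span_vec r y i = tw r $$ (i, j)) \<and>
     (\<forall>i. j - k < i \<and> i < j \<longrightarrow> span_vec r y i = 0) \<and> span_vec r y (j - k) = (-1) ^ (k - 1) * t"
  using assms
proof (induction r arbitrary: j)
  case 0
  then show ?case by simp
next
  case (Suc r)
  then have r: "r < m" by simp
  have jn: "j < n" using Suc.prems n by simp
  show ?case
  proof (cases "j < k + r")
    case True
    then obtain y where y: "\<And>i. i < n \<Longrightarrow> j \<le> i \<Longrightarrow> span_vec r y i = tw r $$ (i, j)"
      "\<And>i. j - k < i \<Longrightarrow> i < j \<Longrightarrow> span_vec r y i = 0" "span_vec r y (j - k) = (-1) ^ (k - 1) * t"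
      using Suc.IH[of j] Suc.prems by auto
    show ?thesis
    proof (intro exI[of _ y] conjI allI impI)
      fix i assume i: "i < n" "j \<le> i"
      show "span_vec (Suc r) y i = tw (Suc r) $$ (i, j)"
      proof (cases "i = j")
        case False
        then show ?thesis unfolding span_vec_Suc[OF r i(1)] tw_Suc_index[OF r i(1) jn] using y(1) i by auto
      next
        case eq: True
        have "span_vec r y (j - 1) = 0" if "r < j"
          using that True Suc.prems k by (intro y(2)) auto
        moreover have "tw r $$ (j - 1, j) = 0" if "r < j" using tw_shape(1)[of r "j - 1" j] that r jn by simp
        ultimately show ?thesis
          unfolding eq span_vec_Suc[OF r jn] tw_Suc_index[OF r jn jn] using y(1) jn by auto
      qed
    next
      fix i assume i: "j - k < i \<and> i < j"
      then have "i < n" using jn by simp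
      then show "span_vec (Suc r) y i = 0"
        unfolding span_vec_Suc[OF r \<open>i < n\<close>] using y(2)[of i] y(2)[of "i - 1"] i True Suc.prems by auto
    next
      have "j - k < n" using jn by simp
      then show "span_vec (Suc r) y (j - k) = (-1) ^ (k - 1) * t"
        unfolding span_vec_Suc[OF r \<open>j - k < n\<close>] using y(3) True Suc.prems x1[OF r, of "j - k + 1"] by auto
    qed
  next
    case False
    then have j: "j = r + k" using Suc.prems by simp
    \<comment> \<open>The solution of \<open>x r (i + 1) * u (i - r) + u (i - 1 - r) = 0\<close> for \<open>r < i < r + k\<close>.\<close>
    define u where "u a = (-1) ^ (k - 1 - a) * (\<Prod>p = r + a + 2..r + 1 + k. x r p)" for a
    obtain y where y: "\<And>a. a < k \<Longrightarrow> span_vec r y (r + a) = u a"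
      using solve_unitriangular[of k "\<lambda>a b. tw r $$ (r + a, b)" u] tw_shape(2,3)[of r] r n
      unfolding span_vec_def by (auto simp: add.commute)
    have y0: "span_vec r y i = 0" if "r + k \<le> i" "i < n" for i
      unfolding span_vec_def by (rule sum.neutral) (use tw_shape(6)[of r i] that r n in auto)
    show ?thesis
    proof (intro exI[of _ y] conjI allI impI)
      fix i assume i: "i < n" "j \<le> i"
      show "span_vec (Suc r) y i = tw (Suc r) $$ (i, j)"
      proof (cases "i = j")
        case True
        have "span_vec r y (r + (k - 1)) = u (k - 1)" using k by (intro y) auto
        moreover have "u (k - 1) = x r (r + k + 1)" using k by (simp add: u_def)
        moreover have "tw r $$ (r + k - 1, r + k) = 0" using tw_shape(1)[of r "r + k - 1" "r + k"] r jn j k by simp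
        ultimately show ?thesis
          unfolding True span_vec_Suc[OF r jn] tw_Suc_index[OF r jn jn]
          using y0[of j] tw_shape(5)[of r j j] r jn j k by simp
      next
        case False
        then show ?thesis
          unfolding span_vec_Suc[OF r i(1)] tw_Suc_index[OF r i(1) jn]
          using y0[of i] tw_shape(5)[of r i j] r jn j i by simp
      qed
    next
      fix i assume i: "j - k < i \<and> i < j"
      then obtain a where a: "i = r + Suc a" "Suc a < k" using j by (metis add_diff_cancel_right' less_imp_Suc_add nat_add_left_cancel_less add_Suc_right)
      have "i < n" using i jn by simp
      have "u a = - (x r (i + 1) * u (Suc a))"
      proof -
        have "(\<Prod>p = r + a + 2..r + 1 + k. x r p) = x r (r + a + 2) * (\<Prod>p = r + Suc a + 2..r + 1 + k. x r p)"
          using a by (subst prod.atLeast_Suc_atMost) (auto simp: numeral_2_eq_2)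
        moreover have "k - 1 - a = Suc (k - 1 - Suc a)" using a by simp
        ultimately show ?thesis by (simp add: u_def a(1))
      qed
      then show "span_vec (Suc r) y i = 0"
        unfolding span_vec_Suc[OF r \<open>i < n\<close>] using y[of a] y[of "Suc a"] a by auto
    next
      have jk: "j - k = r" "r < n" using j jn by auto
      have "span_vec r y r = u 0" using y[of 0] k by simp
      moreover have "x r (r + 1) * (\<Prod>p = r + 2..r + 1 + k. x r p) = t"
        using xt[OF r] by (subst (asm) prod.atLeast_Suc_atMost) (auto simp: numeral_2_eq_2)
      ultimately show "span_vec (Suc r) y (j - k) = (-1) ^ (k - 1) * t"
        unfolding jk(1) span_vec_Suc[OF r jk(2)] by (simp add: u_def mult.left_commute)
    qed
  qed
qed

end

section \<open>The matrix of a subspace\<close>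

lemma minor_eq_det_rows_mat:
  assumes A: "A \<in> carrier_mat n k" and S: "S \<subseteq> {..<n}" "card S = k"
  shows "minor (Suc ` S) {1..k} A = det (rows_mat k A (pick S))"
proof -
  have sets: "(\<lambda>i. i - 1) ` Suc ` S = S" "(\<lambda>i. i - 1) ` {1..k} = {0..<k}"
    using shifted_interval[of 0 k] by (simp_all add: image_image)
  have pick2: "pick {0..<k} a = a" if "a < k" for a
    by (rule pick_enum[OF _ _ that]) (auto simp: strict_mono_on_def)
  have c1: "{i. i < n \<and> i \<in> S} = S" "{i. i < k \<and> i \<in> {0..<k}} = {0..<k}"
    using S by auto
  have dims: "dim_row A = n" "dim_col A = k" using A by auto
  show ?thesis
    unfolding minor_def sets submatrix_def dims c1 card_atLeastLessThan S(2)
    by (rule arg_cong[where f = det], rule eq_matI) (use pick2 in auto)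
qed

lemma rows_mat_mult:
  assumes "A \<in> carrier_mat n k" "X \<in> carrier_mat k k" "\<And>a. a < k \<Longrightarrow> f a < n"
  shows "rows_mat k (A * X) f = rows_mat k A f * X"
  by (rule eq_matI) (use assms in \<open>auto simp: scalar_prod_def intro!: sum.cong\<close>)

lemma pick_less:
  assumes "S \<subseteq> {..<n}" "a < card S"
  shows "pick S a < n"
  using pick_in_set_le[of a S] assms by auto

definition residue :: "nat \<Rightarrow> int \<Rightarrow> nat" where
  "residue n x = nat ((x - 1) mod int n)"

lemma red_residue: "red n x = Suc (residue n x)"
  by (simp add: red_def residue_def)

lemma residue_less: "0 < n \<Longrightarrow> residue n x < n"
  by (simp add: residue_def nat_less_iff)

lemma col_space_in_Gr:
  assumes C: "C \<in> carrier_mat n k" and S: "S \<subseteq> {..<n}" "card S = k" "det (rows_mat k C (pick S)) \<noteq> 0"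
  shows "C \<in> full_rank_mats n k"
proof -
  have "minor (Suc ` S) {1..k} C \<noteq> 0" using S(3) unfolding minor_eq_det_rows_mat[OF C S(1,2)] .
  then have "det (submatrix C ((\<lambda>i. i - 1) ` Suc ` S) ((\<lambda>i. i - 1) ` {1..k})) \<noteq> 0"
    by (simp add: minor_def)
  from vec_space.rank_gt_minor[OF C this]
  have "card {j. j < k \<and> j \<in> (\<lambda>i. i - 1) ` {1..k}} \<le> vec_space.rank n C" .
  moreover have "{j. j < k \<and> j \<in> (\<lambda>i. i - 1) ` {1..k}} = {0..<k}"
    using shifted_interval[of 0 k] by auto
  ultimately have "vec_space.rank n C = k"
    using vec_space.rank_le_nc[OF C] by simp
  then show ?thesis using C by (simp add: full_rank_mats_def)
qed

lemma col_space_eq_imp_factor: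
  fixes A C :: "complex mat"
  assumes A: "A \<in> carrier_mat n k" and C: "C \<in> carrier_mat n k"
    and eq: "vec_space.col_space n A = vec_space.col_space n C"
  shows "\<exists>X \<in> carrier_mat k k. C = A * X"
proof -
  have "\<exists>x \<in> carrier_vec k. A *\<^sub>v x = col C j" if "j < k" for j
  proof -
    have "C *\<^sub>v unit_vec k j = col C j"
      by (rule eq_vecI) (use C that in auto)
    then have "col C j \<in> vec_space.col_space n C"
      unfolding vec_space.col_space_eq[OF C] using C
      by (auto intro!: bexI[of _ "unit_vec k j"])
    then show ?thesis unfolding eq[symmetric] vec_space.col_space_eq[OF A] using A by auto
  qed
  then obtain x where x: "\<And>j. j < k \<Longrightarrow> x j \<in> carrier_vec k \<and> A *\<^sub>v x j = col C j" by metis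
  define X where "X = mat k k (\<lambda>(i, j). x j $ i)"
  have col: "col X j = x j" if "j < k" for j
    using x[OF that] that by (auto simp: X_def)
  have "C = A * X"
  proof (rule eq_matI)
    fix i j assume "i < dim_row (A * X)" "j < dim_col (A * X)"
    then have ij: "i < n" "j < k" using A by (auto simp: X_def)
    have "(A * X) $$ (i, j) = row A i \<bullet> col X j" using ij A by (simp add: X_def)
    also have "\<dots> = (A *\<^sub>v x j) $ i" using ij A by (simp add: col)
    also have "\<dots> = C $$ (i, j)" using x[OF ij(2)] ij C by simp
    finally show "C $$ (i, j) = (A * X) $$ (i, j)" by simp
  qed (use A C in \<open>auto simp: X_def\<close>)
  then show ?thesis by (intro bexI[of _ X]) (auto simp: X_def)
qed

text \<open>
  Two matrices with the same column space differ by an invertible factor on the right, whose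
  determinant is \<open>\<delta>\<close>.
\<close>
lemma plucker_col_space:
  assumes C: "C \<in> carrier_mat n k" and n: "0 < n"
    and S: "S \<subseteq> {..<n}" "card S = k" "det (rows_mat k C (pick S)) \<noteq> 0"
  shows "\<exists>\<delta>. \<delta> \<noteq> 0 \<and> (\<forall>J. plucker n k (vec_space.col_space n C) J =
    (if card (residue n ` J) = k then det (rows_mat k C (pick (residue n ` J))) / \<delta> else 0))"
proof -
  let ?N = "vec_space.col_space n C"
  define A where "A = (SOME A. A \<in> full_rank_mats n k \<and> vec_space.col_space n A = ?N)"
  have "A \<in> full_rank_mats n k \<and> vec_space.col_space n A = ?N"
    unfolding A_def by (rule someI[of _ C]) (use col_space_in_Gr[OF C S] in simp)
  then have A: "A \<in> carrier_mat n k" "vec_space.col_space n A = ?N" by (auto simp: full_rank_mats_def)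
  obtain X where X: "X \<in> carrier_mat k k" "C = A * X"
    using col_space_eq_imp_factor[OF A(1) C A(2)] by blast
  have factor: "det (rows_mat k C (pick S)) = det (rows_mat k A (pick S)) * det X"
    if "S \<subseteq> {..<n}" "card S = k" for S
  proof -
    have "rows_mat k C (pick S) = rows_mat k A (pick S) * X"
      unfolding X(2) using that by (intro rows_mat_mult[OF A(1) X(1)]) (auto intro: pick_less)
    then show ?thesis using det_mult[OF rows_mat_carrier X(1), of A "pick S"] by simp
  qed
  have X0: "det X \<noteq> 0" using factor[OF S(1,2)] S(3) by auto
  have "plucker n k ?N J =
    (if card (residue n ` J) = k then det (rows_mat k C (pick (residue n ` J))) / det X else 0)" for J
  proof -
    have img: "red n ` J = Suc ` residue n ` J" by (simp add: image_image red_residue)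
    have sub: "residue n ` J \<subseteq> {..<n}" using residue_less[OF n] by auto
    have "plucker n k ?N J = (if card (red n ` J) = k then minor (red n ` J) {1..k} A else 0)"
      by (simp add: plucker_def Let_def A_def)
    also have "card (red n ` J) = card (residue n ` J)" unfolding img by (simp add: card_image)
    finally show ?thesis
      using minor_eq_det_rows_mat[OF A(1) sub] factor[OF sub] X0 by (simp add: img)
  qed
  with X0 show ?thesis by blast
qed

text \<open>
  The index sets of the Pluecker coordinates in column \<open>j\<close> of \<open>g\<close>, all indices reduced modulo \<open>n\<close>
  and shifted to start at 0: \<open>hole\<close> is the cyclic interval \<open>[j - k + 1, j - 1]\<close>; \<open>exchange\<close>
  enumerates its union with \<open>{i}\<close>, and \<open>window\<close> its union with \<open>{j - k}\<close>.
\<close>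
definition hole :: "nat \<Rightarrow> nat \<Rightarrow> nat \<Rightarrow> nat set" where
  "hole n k j = (if j < k then {0..<j} \<union> {n + j + 1 - k..<n} else {j + 1 - k..<j})"

definition exchange :: "nat \<Rightarrow> nat \<Rightarrow> nat \<Rightarrow> nat \<Rightarrow> nat \<Rightarrow> nat" where
  "exchange n k j i a =
     (if j < k then if a < j then a else if a = j then i else n - k + a
      else if a < k - 1 then j + 1 - k + a else i)"

definition window :: "nat \<Rightarrow> nat \<Rightarrow> nat \<Rightarrow> nat \<Rightarrow> nat" where
  "window n k j a = (if j < k then if a < j then a else n - k + a else j - k + a)"

lemma residue_nonneg: "1 \<le> x \<Longrightarrow> x \<le> int n \<Longrightarrow> residue n x = nat (x - 1)"
  by (simp add: residue_def)

lemma residue_neg: "x \<le> 0 \<Longrightarrow> - int n < x \<Longrightarrow> residue n x = nat (x - 1 + int n)"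
proof -
  assume x: "x \<le> 0" "- int n < x"
  have "(x - 1) mod int n = (x - 1 + int n) mod int n" by simp
  also have "\<dots> = x - 1 + int n" using x by (intro mod_pos_pos_trivial) auto
  finally show ?thesis by (simp add: residue_def)
qed

lemma residue_hole:
  assumes "1 \<le> k" "k \<le> n" "j < n"
  shows "residue n ` {int j + 2 - int k..int j} = hole n k j"
proof (rule equalityI; rule subsetI)
  fix y assume "y \<in> residue n ` {int j + 2 - int k..int j}"
  then obtain x where x: "y = residue n x" "int j + 2 - int k \<le> x" "x \<le> int j" by auto
  show "y \<in> hole n k j"
  proof (cases "1 \<le> x")
    case True
    then show ?thesis using x assms residue_nonneg[of x n] by (auto simp: hole_def)
  next
    case False
    then show ?thesis using x assms residue_neg[of x n] by (auto simp: hole_def)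
  qed
next
  fix y assume y: "y \<in> hole n k j"
  show "y \<in> residue n ` {int j + 2 - int k..int j}"
  proof (cases "y < j")
    case True
    then have "residue n (int y + 1) = y" using assms residue_nonneg[of "int y + 1" n] by simp
    then show ?thesis using True y assms
      by (intro image_eqI[of _ _ "int y + 1"]) (auto simp: hole_def split: if_splits)
  next
    case False
    then have y': "j < k" "n + j + 1 - k \<le> y" "y < n" using y by (auto simp: hole_def split: if_splits)
    then have "residue n (int y + 1 - int n) = y" using assms residue_neg[of "int y + 1 - int n" n] by simp
    then show ?thesis using y' False assms
      by (intro image_eqI[of _ _ "int y + 1 - int n"]) auto
  qed
qed

lemma exchange_image:
  assumes "1 \<le> k" "k \<le> n" "j < n"
  shows "exchange n k j i ` {..<k} = hole n k j \<union> {i}"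
proof (rule equalityI; rule subsetI)
  fix y assume "y \<in> exchange n k j i ` {..<k}"
  then show "y \<in> hole n k j \<union> {i}" using assms
    by (auto simp: exchange_def hole_def split: if_splits)
next
  fix y assume y: "y \<in> hole n k j \<union> {i}"
  show "y \<in> exchange n k j i ` {..<k}"
  proof (cases "j < k")
    case True
    consider "y = i" | "y < j" | "y \<ge> n + j + 1 - k" "y < n" using y True by (auto simp: hole_def)
    then show ?thesis
    proof cases
      case 1
      then show ?thesis using True by (intro image_eqI[of _ _ j]) (auto simp: exchange_def)
    next
      case 2
      then show ?thesis using True by (intro image_eqI[of _ _ y]) (auto simp: exchange_def)
    next
      case 3
      then show ?thesis using True assms by (intro image_eqI[of _ _ "y + k - n"]) (auto simp: exchange_def)
    qed
  next
    case False
    then consider "y = i" | "j + 1 - k \<le> y" "y < j" using y by (auto simp: hole_def)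
    then show ?thesis
    proof cases
      case 1
      then show ?thesis using False assms by (intro image_eqI[of _ _ "k - 1"]) (auto simp: exchange_def)
    next
      case 2
      then show ?thesis using False assms by (intro image_eqI[of _ _ "y + k - j - 1"]) (auto simp: exchange_def)
    qed
  qed
qed

lemma residue_exchange:
  assumes "1 \<le> k" "k \<le> n" "j < n" "i < n"
  shows "residue n ` ({int (j + 1) - int k + 1..int (j + 1) - 1} \<union> {int (i + 1)}) = exchange n k j i ` {..<k}"
proof -
  have "{int (j + 1) - int k + 1..int (j + 1) - 1} = {int j + 2 - int k..int j}" by auto
  moreover have "residue n (int (i + 1)) = i" using assms residue_nonneg[of "int (i + 1)" n] by simp
  ultimately show ?thesis
    unfolding image_Un exchange_image[OF assms(1-3)] by (simp only: residue_hole[OF assms(1-3)] image_insert image_empty)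
qed

lemma window_eq_exchange:
  assumes "1 \<le> k" "k \<le> n" "j < n"
  shows "window n k j ` {..<k} = exchange n k j (if j < k then n - k + j else j - k) ` {..<k}"
proof (cases "j < k")
  case True
  then have "window n k j a = exchange n k j (n - k + j) a" for a
    by (auto simp: window_def exchange_def)
  then show ?thesis using True by simp
next
  case False
  have "window n k j ` {..<k} = {j - k..<j}"
    using image_add_atLeastLessThan[of "j - k" 0 k] False
    by (simp add: window_def[abs_def] lessThan_atLeast0 image_add_atLeastLessThan)
  also have "\<dots> = hole n k j \<union> {j - k}" using False assms by (auto simp: hole_def)
  finally show ?thesis using exchange_image[OF assms, of "j - k"] False by simp
qed

lemma residue_window:
  assumes "1 \<le> k" "k < n" "j < n"
  shows "residue n ` {int (j + 1) - int k..int (j + 1) - 1} = window n k j ` {..<k}"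
proof -
  have k: "k \<le> n" using assms by simp
  define i where "i = (if j < k then n - k + j else j - k)"
  have "{int (j + 1) - int k..int (j + 1) - 1} = {int j + 2 - int k..int j} \<union> {int j + 1 - int k}"
    using assms by auto
  moreover have "residue n (int j + 1 - int k) = i"
  proof (cases "j < k")
    case True
    then show ?thesis using residue_neg[of "int j + 1 - int k" n] assms by (simp add: i_def nat_eq_iff)
  next
    case False
    then show ?thesis using residue_nonneg[of "int j + 1 - int k" n] assms by (simp add: i_def nat_eq_iff)
  qed
  ultimately have "residue n ` {int (j + 1) - int k..int (j + 1) - 1} = hole n k j \<union> {i}"
    using residue_hole[OF assms(1) k assms(3)] by simp
  then show ?thesis using window_eq_exchange[OF assms(1) k assms(3)] exchange_image[OF assms(1) k assms(3)]
    by (simp add: i_def)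
qed

lemma window_mono: "strict_mono_on {..<k} (window n k j)" if "k \<le> n"
  using that by (auto simp: strict_mono_on_def window_def)

lemma exchange_mono:
  assumes "k \<le> n" "j \<le> i" "j < k \<Longrightarrow> i \<le> n - k + j"
  shows "strict_mono_on {..<k} (exchange n k j i)"
  using assms by (auto simp: strict_mono_on_def exchange_def)

context banded
begin

definition front :: "'a mat" where
  "front = mat n k (\<lambda>(i, j). tw m $$ (i, j))"

lemma front_carrier: "front \<in> carrier_mat n k" by (simp add: front_def)

lemma front_index: "i < n \<Longrightarrow> j < k \<Longrightarrow> front $$ (i, j) = tw m $$ (i, j)"
  by (simp add: front_def)

lemma k_le: "k \<le> n" and nk: "n - k = m" using n by simp_all

text \<open>
  For \<open>j < k\<close> column \<open>j\<close> of the tower itself vanishes on \<open>hole\<close> and has the entry 1 at \<open>j - k + n\<close>.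
  For \<open>j \<ge> k\<close> the vector of \<open>exists_span_vec\<close> is used; its sign cancels, because \<open>j - k\<close> is the first
  and \<open>i\<close> the last of the \<open>k\<close> rows.
\<close>
lemma window_exchange:
  assumes j: "j < n" and i: "j \<le> i" "i < n" "j < k \<Longrightarrow> i \<le> n - k + j"
  shows "det (rows_mat k front (window n k j)) * tw m $$ (i, j) =
    (if j < k then 1 else t) * det (rows_mat k front (exchange n k j i))"
proof (cases "j < k")
  case True
  define x where "x b = (if b = j then 1 else 0 :: 'a)" for b
  have sum: "(\<Sum>b<k. front $$ (a, b) * x b) = tw m $$ (a, j)" if "a < n" for a
  proof -
    have "(\<Sum>b<k. front $$ (a, b) * x b) = (\<Sum>b<k. if b = j then front $$ (a, j) else 0)"
      by (rule sum.cong) (auto simp: x_def)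
    then show ?thesis using that True by (simp add: front_index)
  qed
  have "det (rows_mat k front (window n k j)) * tw m $$ (i, j) * (-1) ^ j =
     det (rows_mat k front (exchange n k j i)) * 1 * (-1) ^ j"
  proof (rule cramer_exchange[where x = x])
    fix a assume a: "a < k"
    show "(\<Sum>b<k. front $$ (window n k j a, b) * x b) = (if a = j then 1 else 0)"
    proof -
      have "window n k j a < n" using a True n by (auto simp: window_def)
      moreover have "tw m $$ (window n k j a, j) = (if a = j then 1 else 0)"
        using tw_shape(1-3)[of m "window n k j a" j] a True n j by (auto simp: window_def add.commute)
      ultimately show ?thesis by (simp add: sum)
    qed
    show "(\<Sum>b<k. front $$ (exchange n k j i a, b) * x b) = (if a = j then tw m $$ (i, j) else 0)"
    proof -
      have "exchange n k j i a < n" using a True n i by (auto simp: exchange_def)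
      moreover have "tw m $$ (exchange n k j i a, j) = (if a = j then tw m $$ (i, j) else 0)"
        using tw_shape(1,2)[of m "exchange n k j i a" j] a True n j by (auto simp: exchange_def)
      ultimately show ?thesis by (simp add: sum)
    qed
  qed (use True in \<open>auto simp: window_def exchange_def skip_def\<close>)
  then show ?thesis using True by simp
next
  case False
  obtain y where y: "\<And>i. i < n \<Longrightarrow> j \<le> i \<Longrightarrow> span_vec m y i = tw m $$ (i, j)"
      "\<And>i. j - k < i \<Longrightarrow> i < j \<Longrightarrow> span_vec m y i = 0" "span_vec m y (j - k) = (-1) ^ (k - 1) * t"
    using exists_span_vec[of m j] False j n by auto
  have sum: "(\<Sum>b<k. front $$ (a, b) * y b) = span_vec m y a" if "a < n" for a
    unfolding span_vec_def by (rule sum.cong) (use that in \<open>auto simp: front_def\<close>)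
  have "det (rows_mat k front (window n k j)) * tw m $$ (i, j) * (-1) ^ (k - 1) =
     det (rows_mat k front (exchange n k j i)) * ((-1) ^ (k - 1) * t) * (-1) ^ 0"
  proof (rule cramer_exchange[where x = y])
    fix a assume a: "a < k"
    show "(\<Sum>b<k. front $$ (window n k j a, b) * y b) = (if a = 0 then (-1) ^ (k - 1) * t else 0)"
    proof -
      have "window n k j a < n" using a False j by (auto simp: window_def)
      then show ?thesis using y(2)[of "window n k j a"] y(3) a False by (auto simp: sum window_def)
    qed
    show "(\<Sum>b<k. front $$ (exchange n k j i a, b) * y b) = (if a = k - 1 then tw m $$ (i, j) else 0)"
    proof -
      have "exchange n k j i a < n" using a False j i by (auto simp: exchange_def)
      then show ?thesis using y(2)[of "exchange n k j i a"] y(1)[of i] i a False by (auto simp: sum exchange_def)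
    qed
  qed (use False k in \<open>auto simp: window_def exchange_def skip_def\<close>)
  then have "((-1) ^ (k - 1) * (-1) ^ (k - 1)) * (det (rows_mat k front (window n k j)) * tw m $$ (i, j)) =
    ((-1) ^ (k - 1) * (-1) ^ (k - 1)) * (t * det (rows_mat k front (exchange n k j i)))"
    by (simp add: ac_simps)
  moreover have "(-1) ^ (k - 1) * (-1) ^ (k - 1) = (1 :: 'a)" by (simp flip: power_mult_distrib)
  ultimately show ?thesis using False by simp
qed

text \<open>
  The window at 0 consists of the last \<open>k\<close> rows, which are unitriangular. By \<open>window_exchange\<close> with
  \<open>i = j\<close>, consecutive windows have determinants that differ by a nonzero factor.
\<close>
lemma det_window_nonzero: "j \<le> n \<Longrightarrow> det (rows_mat k front (window n k j)) \<noteq> 0"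
proof (induction j)
  case 0
  have entry: "rows_mat k front (window n k 0) $$ (a, b) = tw m $$ (m + a, b)" if "a < k" "b < k" for a b
    using that k k_le nk by (simp add: window_def front_index)
  have "det (rows_mat k front (window n k 0)) = prod_list (diag_mat (rows_mat k front (window n k 0)))"
  proof (rule det_upper_triangular[OF upper_triangularI])
    fix a b assume ab: "b < a" "a < dim_row (rows_mat k front (window n k 0))"
    then show "rows_mat k front (window n k 0) $$ (a, b) = 0"
      using tw_shape(2)[of m "m + a" b] entry[of a b] k_le nk by simp
  qed (rule rows_mat_carrier)
  also have "\<dots> = 1"
    unfolding prod_list_diag_prod
  proof (rule prod.neutral, rule ballI)
    fix a assume "a \<in> {0..<dim_row (rows_mat k front (window n k 0))}"
    then show "rows_mat k front (window n k 0) $$ (a, a) = 1"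
      using tw_shape(3)[of m "m + a" a] entry[of a a] k_le nk by simp
  qed
  finally show ?case by simp
next
  case (Suc j)
  have "det (rows_mat k front (window n k (Suc j))) = det (rows_mat k front (exchange n k j j))"
  proof (rule arg_cong[where f = det], rule rows_mat_cong)
    fix a assume "a < k"
    then show "window n k (Suc j) a = exchange n k j j a"
      using n by (auto simp: window_def exchange_def)
  qed
  moreover have "det (rows_mat k front (window n k j)) * tw m $$ (j, j) \<noteq> 0"
    using Suc tw_shape(4)[of m j j] by simp
  ultimately show ?case using window_exchange[of j j] Suc.prems n by (auto split: if_splits)
qed

end

locale complex_banded = banded n m k t c x
  for n m k :: nat and t :: complex and c :: "nat \<Rightarrow> nat \<Rightarrow> bool" and x :: "nat \<Rightarrow> nat \<Rightarrow> complex" +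
  assumes m_pos: "1 \<le> m"
begin

lemma kn: "k < n" "k \<le> n" using n m_pos by auto

lemma window_set:
  assumes "j < n"
  shows "window n k j ` {..<k} \<subseteq> {..<n}" "card (window n k j ` {..<k}) = k"
    "rows_mat k A (pick (window n k j ` {..<k})) = rows_mat k A (window n k j)"
proof -
  show "window n k j ` {..<k} \<subseteq> {..<n}" using assms kn by (auto simp: window_def)
  show "card (window n k j ` {..<k}) = k"
    using strict_mono_on_imp_inj_on[OF window_mono[OF kn(2), of j]] by (simp add: card_image)
  show "rows_mat k A (pick (window n k j ` {..<k})) = rows_mat k A (window n k j)"
    by (rule rows_mat_cong, rule pick_enum[OF refl window_mono[OF kn(2)]])
qed

lemma front_full_rank: "front \<in> full_rank_mats n k"
  using kn window_set(1,2)[of 0] window_set(3)[of 0 front] det_window_nonzero[of 0]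
  by (intro col_space_in_Gr[OF front_carrier, of "window n k 0 ` {..<k}"]) auto

text \<open>
  The first \<open>k\<close> columns and the last \<open>k\<close> rows of \<open>g\<close> do not contain the indeterminate: entries
  above the diagonal vanish there since \<open>i\<close> lies in \<open>hole\<close>.
\<close>
lemma g_mat_entry:
  assumes ij: "i < n" "j < n" and part: "j < k \<or> n - k \<le> i"
  shows "g_mat n k (vec_space.col_space n front, t) $$ (i, j) = [:tw m $$ (i, j):]"
proof -
  let ?N = "vec_space.col_space n front"
  let ?J = "{int (j + 1) - int k + 1..int (j + 1) - 1} \<union> {int (i + 1)}"
  let ?J' = "{int (j + 1) - int k..int (j + 1) - 1}"
  obtain \<delta> where \<delta>: "\<delta> \<noteq> 0" "\<And>J. plucker n k ?N J =
    (if card (residue n ` J) = k then det (rows_mat k front (pick (residue n ` J))) / \<delta> else 0)"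
    using plucker_col_space[OF front_carrier, of "window n k 0 ` {..<k}"] kn window_set(1,2)[of 0]
      window_set(3)[of 0 front] det_window_nonzero[of 0] by auto
  have g: "g_mat n k (?N, t) $$ (i, j) =
     g_coeff k t (i + 1) (j + 1) * [:plucker n k ?N ?J / plucker n k ?N ?J':]"
    using ij by (simp add: g_mat_def Let_def)
  have den: "plucker n k ?N ?J' = det (rows_mat k front (window n k j)) / \<delta>"
    unfolding \<delta>(2) residue_window[OF k kn(1) ij(2)] using window_set(2)[OF ij(2)] window_set(3)[OF ij(2), of front] by simp
  have W: "det (rows_mat k front (window n k j)) \<noteq> 0" using det_window_nonzero[of j] ij by simp
  have res: "residue n ` ?J = exchange n k j i ` {..<k}"
    by (rule residue_exchange[OF k kn(2) ij(2) ij(1)])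
  show ?thesis
  proof (cases "i \<in> hole n k j")
    case True
    have "exchange n k j i ` {..<k} = hole n k j"
      using exchange_image[OF k kn(2) ij(2), of i] True by auto
    moreover have "card (hole n k j) < k"
    proof (cases "j < k")
      case True
      have "card (hole n k j) \<le> card {0..<j} + card {n + j + 1 - k..<n}"
        using True by (simp add: hole_def card_Un_le del: card_atLeastLessThan)
      then show ?thesis using True kn by simp
    next
      case False
      then show ?thesis using k by (simp add: hole_def)
    qed
    ultimately have "plucker n k ?N ?J = 0" unfolding \<delta>(2) res by simp
    moreover have "tw m $$ (i, j) = 0"
      using True tw_shape(1,2)[of m i j] ij n by (auto simp: hole_def split: if_splits)
    ultimately show ?thesis unfolding g by simp
  next
    case False
    have valid: "j \<le> i" "j < k \<Longrightarrow> i \<le> n - k + j"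
      using False part ij kn by (auto simp: hole_def split: if_splits)
    have "exchange n k j i ` {..<k} \<subseteq> {..<n}" "card (exchange n k j i ` {..<k}) = k"
      "rows_mat k front (pick (exchange n k j i ` {..<k})) = rows_mat k front (exchange n k j i)"
    proof -
      note mono = exchange_mono[OF kn(2) valid]
      show "exchange n k j i ` {..<k} \<subseteq> {..<n}" using ij kn by (auto simp: exchange_def)
      show "card (exchange n k j i ` {..<k}) = k"
        using strict_mono_on_imp_inj_on[OF mono] by (simp add: card_image)
      show "rows_mat k front (pick (exchange n k j i ` {..<k})) = rows_mat k front (exchange n k j i)"
        by (rule rows_mat_cong, rule pick_enum[OF refl mono])
    qed
    then have num: "plucker n k ?N ?J = det (rows_mat k front (exchange n k j i)) / \<delta>"
      unfolding \<delta>(2) res by simp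
    have "tw m $$ (i, j) = (if j < k then 1 else t) * (plucker n k ?N ?J / plucker n k ?N ?J')"
      unfolding num den using window_exchange[OF ij(2) valid(1) ij(1) valid(2)] W \<delta>(1)
      by (simp add: field_simps)
    then show ?thesis unfolding g using valid by (auto simp: g_coeff_def)
  qed
qed

end

section \<open>The parametrization and the matrix \<open>g\<close>\<close>

definition phi_pat :: "nat \<Rightarrow> nat \<Rightarrow> nat \<Rightarrow> nat \<Rightarrow> bool" where
  "phi_pat n m r p \<longleftrightarrow> r + 1 < p \<and> p \<le> r + 1 + (n - m)"

definition phi_val :: "nat \<Rightarrow> nat \<Rightarrow> (coord \<Rightarrow> complex) \<Rightarrow> nat \<Rightarrow> nat \<Rightarrow> complex" where
  "phi_val n m z r p = (if r + 1 \<le> p \<and> p \<le> r + 1 + (n - m) then x_ratio n m z (r + 1) p else 1)"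

lemma Phi_eq_row_tower:
  assumes "m \<le> n"
  shows "Phi n m z = row_tower n (phi_pat n m) (phi_val n m z) m"
proof -
  have M: "M_mat n (Suc r) (Suc r + n - m) (x_ratio n m z (Suc r)) = row_mat n (phi_pat n m r) (phi_val n m z r)" for r
    by (rule eq_matI) (use assms in \<open>auto simp: M_mat_def row_mat_def phi_pat_def phi_val_def Let_def\<close>)
  have "foldr (*) (map (\<lambda>i. M_mat n i (i + n - m) (x_ratio n m z i)) (rev [1..<r + 1])) (1\<^sub>m n) =
        row_tower n (phi_pat n m) (phi_val n m z) r" for r
  proof (induction r)
    case (Suc r)
    have "rev [1..<Suc r + 1] = Suc r # rev [1..<r + 1]" by simp
    then show ?case by (simp only: list.map foldr.simps o_apply Suc.IH M row_tower.simps)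
  qed simp
  from this[of m] show ?thesis by (simp add: Phi_def)
qed

lemma X_ext_nonzero:
  assumes z: "z \<in> torus (coords n m)" and "1 \<le> i" "i \<le> m" "m < n" "i \<le> p + 1" "p \<le> i + n - m"
  shows "X_ext n m z i p \<noteq> 0"
proof -
  have nz: "z v \<noteq> 0" if "v \<in> coords n m" for v using z that by (auto simp: torus_def)
  have "Xc i p \<in> coords n m" if "p + 1 \<noteq> i" "p \<noteq> i + n - m"
  proof -
    have "(i, p) \<in> RR n m" using assms(2-) that by (auto simp: RR_def)
    then show ?thesis unfolding coords_def by force
  qed
  then show ?thesis by (auto simp: X_ext_def coords_def intro!: nz)
qed

lemma X_ext_last: "m < n \<Longrightarrow> X_ext n m z i (i + (n - m)) = z Tc"
  and B_ext_last: "m < n \<Longrightarrow> B_ext n m b i (i + (n - m)) = b Tc"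
  by (simp_all add: X_ext_def B_ext_def)

lemma X_ext_first: "1 \<le> i \<Longrightarrow> X_ext n m z i (i - 1) = 1"
  by (simp add: X_ext_def)

lemma prod_telescope:
  fixes g :: "nat \<Rightarrow> 'a::field"
  assumes "\<And>p. a \<le> p + 1 \<Longrightarrow> p \<le> a + k \<Longrightarrow> g p \<noteq> 0" "1 \<le> a"
  shows "(\<Prod>p = a..a + k. g p / g (p - 1)) = g (a + k) / g (a - 1)"
  using assms
proof (induction k)
  case 0
  then show ?case by simp
next
  case (Suc k)
  then have "(\<Prod>p = a..a + k. g p / g (p - 1)) = g (a + k) / g (a - 1)" by simp
  moreover have "g (a + k) \<noteq> 0" using Suc.prems by simp
  ultimately show ?case by simp
qed

lemma complex_banded_Phi:
  assumes z: "z \<in> torus (coords n m)" and m: "1 \<le> m" "m < n"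
  shows "complex_banded n m (n - m) (z Tc) (phi_pat n m) (phi_val n m z)"
proof unfold_locales
  fix r assume r: "r < m"
  show "(\<Prod>p = r + 1..r + 1 + (n - m). phi_val n m z r p) = z Tc"
  proof -
    have "(\<Prod>p = r + 1..r + 1 + (n - m). phi_val n m z r p) =
       (\<Prod>p = r + 1..r + 1 + (n - m). X_ext n m z (r + 1) p / X_ext n m z (r + 1) (p - 1))"
      by (rule prod.cong) (auto simp: phi_val_def x_ratio_def)
    also have "\<dots> = X_ext n m z (r + 1) (r + 1 + (n - m)) / X_ext n m z (r + 1) (r + 1 - 1)"
      by (rule prod_telescope) (use X_ext_nonzero[OF z, of "r + 1"] r m in auto)
    also have "\<dots> = z Tc" unfolding X_ext_last[OF m(2)] X_ext_first[OF le_add2] by simp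
    finally show ?thesis .
  qed
next
  show "z Tc \<noteq> 0" using z by (auto simp: torus_def coords_def)
qed (use m in \<open>auto simp: phi_pat_def phi_val_def\<close>)

lemma Theta_eq:
  assumes "1 \<le> k" "k < n"
  shows "Theta n k z = (vec_space.col_space n (mat n k (\<lambda>(i, j).
     row_tower n (phi_pat n (n - k)) (phi_val n (n - k) z) (n - k) $$ (i, j))), z Tc)"
  using assms by (simp add: Theta_def Phi_eq_row_tower)

lemma Theta_in_XX:
  assumes z: "z \<in> torus (coords n (n - k))" and kb: "1 \<le> k" "k < n"
  shows "Theta n k z \<in> XX n k"
proof -
  interpret complex_banded n "n - k" "n - (n - k)" "z Tc" "phi_pat n (n - k)" "phi_val n (n - k) z"
    by (rule complex_banded_Phi[OF z]) (use kb in auto)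
  have kk: "n - (n - k) = k" using kb by simp
  have "Theta n k z = (vec_space.col_space n front, z Tc)"
    unfolding Theta_eq[OF kb] front_def by (simp only: kk)
  then show ?thesis using front_full_rank t0 by (auto simp: XX_def Gr_def kk)
qed

lemma g_mat_Theta:
  assumes z: "z \<in> torus (coords n (n - k))" and kb: "1 \<le> k" "k < n"
    and ij: "i < n" "j < n" "j < k \<or> n - k \<le> i"
  shows "g_mat n k (Theta n k z) $$ (i, j) = [:Phi n (n - k) z $$ (i, j):]"
proof -
  interpret complex_banded n "n - k" "n - (n - k)" "z Tc" "phi_pat n (n - k)" "phi_val n (n - k) z"
    by (rule complex_banded_Phi[OF z]) (use kb in auto)
  have kk: "n - (n - k) = k" using kb by simp
  have "Theta n k z = (vec_space.col_space n front, z Tc)"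
    unfolding Theta_eq[OF kb] front_def by (simp only: kk)
  then show ?thesis using g_mat_entry[OF ij(1,2)] ij(3) by (simp add: kk Phi_eq_row_tower)
qed

interpretation const_poly: comm_ring_hom "\<lambda>c::complex. [:c:]"
  by unfold_locales (auto simp: one_pCons)

lemma sum_const_poly: "(\<Sum>i\<in>A. [:f i:]) = [:\<Sum>i\<in>A. f i:]" for f :: "'i \<Rightarrow> complex"
  by (induction A rule: infinite_finite_induct) auto

lemma Phi_carrier [simp]: "m \<le> n \<Longrightarrow> Phi n m z \<in> carrier_mat n n"
  by (simp add: Phi_eq_row_tower)

text \<open>
  Only the last rows of the first factor and the first columns of the second one enter the minor.
\<close>
lemma E_fun_Theta:
  assumes z: "z \<in> torus (coords n (n - k1))" "z' \<in> torus (coords n (n - k2))"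
    and k: "1 \<le> k1" "k1 < n" "1 \<le> k2" "k2 < n"
  shows "E_fun n k1 k2 (Theta n k1 z, Theta n k2 z') =
    minor {n - min k1 k2 + 1..n} {1..min k1 k2} (Phi n (n - k1) z * Phi n (n - k2) z')"
proof -
  define l where "l = min k1 k2"
  let ?G1 = "g_mat n k1 (Theta n k1 z)" and ?G2 = "g_mat n k2 (Theta n k2 z')"
  let ?P1 = "Phi n (n - k1) z" and ?P2 = "Phi n (n - k2) z'"
  have dims: "?G1 \<in> carrier_mat n n" "?G2 \<in> carrier_mat n n"
    by (auto simp: g_mat_def split: prod.splits)
  have l: "l \<le> n" using k by (simp add: l_def)
  have Pd: "?P1 \<in> carrier_mat n n" "?P2 \<in> carrier_mat n n" by simp_all
  have mats: "mat l l (\<lambda>(a, b). (?G1 * ?G2) $$ (n - l + a, b)) =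
     map_mat (\<lambda>c. [:c:]) (mat l l (\<lambda>(a, b). (?P1 * ?P2) $$ (n - l + a, b)))"
  proof (rule eq_matI)
    fix a b assume "a < dim_row (map_mat (\<lambda>c. [:c:]) (mat l l (\<lambda>(a, b). (?P1 * ?P2) $$ (n - l + a, b))))"
      "b < dim_col (map_mat (\<lambda>c. [:c:]) (mat l l (\<lambda>(a, b). (?P1 * ?P2) $$ (n - l + a, b))))"
    then have ab: "a < l" "b < l" by auto
    have "(?G1 * ?G2) $$ (n - l + a, b) = (\<Sum>q = 0..<n. ?G1 $$ (n - l + a, q) * ?G2 $$ (q, b))"
      using ab l dims by (simp add: scalar_prod_def)
    also have "\<dots> = (\<Sum>q = 0..<n. [:?P1 $$ (n - l + a, q) * ?P2 $$ (q, b):])"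
    proof (rule sum.cong)
      fix q assume "q \<in> {0..<n}"
      then have q: "q < n" by simp
      have "?G1 $$ (n - l + a, q) = [:?P1 $$ (n - l + a, q):]"
        using ab k q by (intro g_mat_Theta[OF z(1)]) (auto simp: l_def)
      moreover have "?G2 $$ (q, b) = [:?P2 $$ (q, b):]"
        using ab k q by (intro g_mat_Theta[OF z(2)]) (auto simp: l_def)
      ultimately show "?G1 $$ (n - l + a, q) * ?G2 $$ (q, b) = [:?P1 $$ (n - l + a, q) * ?P2 $$ (q, b):]"
        by simp
    qed simp
    also have "\<dots> = [:\<Sum>q = 0..<n. ?P1 $$ (n - l + a, q) * ?P2 $$ (q, b):]"
      by (rule sum_const_poly)
    also have "(\<Sum>q = 0..<n. ?P1 $$ (n - l + a, q) * ?P2 $$ (q, b)) = (?P1 * ?P2) $$ (n - l + a, b)"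
      using ab l carrier_matD[OF Pd(1)] carrier_matD[OF Pd(2)] by (simp add: scalar_prod_def)
    finally show "mat l l (\<lambda>(a, b). (?G1 * ?G2) $$ (n - l + a, b)) $$ (a, b) =
      map_mat (\<lambda>c. [:c:]) (mat l l (\<lambda>(a, b). (?P1 * ?P2) $$ (n - l + a, b))) $$ (a, b)"
      using ab by simp
  qed auto
  have "minor {n - l + 1..n} {1..l} (?G1 * ?G2) =
      det (map_mat (\<lambda>c. [:c:]) (mat l l (\<lambda>(a, b). (?P1 * ?P2) $$ (n - l + a, b))))"
    using minor_bottom_left[OF mult_carrier_mat[OF dims] l] unfolding mats .
  also have "\<dots> = [:minor {n - l + 1..n} {1..l} (?P1 * ?P2):]"
    using minor_bottom_left[OF mult_carrier_mat[OF Pd] l] by (simp only: const_poly.hom_det)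
  finally have "minor {n - l + 1..n} {1..l} (?G1 * ?G2) = [:minor {n - l + 1..n} {1..l} (?P1 * ?P2):]" .
  then show ?thesis
    using Theta_in_XX[OF z(1)] Theta_in_XX[OF z(2)] k by (simp add: E_fun_def Let_def l_def)
qed

section \<open>Rectangular tableaux as counts\<close>

text \<open>The number of letters \<open>p\<close> in row \<open>r\<close>, counted from 0, of the rectangular tableau of \<open>b\<close>.\<close>
definition cnt :: "nat \<Rightarrow> nat \<Rightarrow> (coord \<Rightarrow> int) \<Rightarrow> nat \<Rightarrow> nat \<Rightarrow> nat" where
  "cnt n m b r p = (if r < m \<and> r + 1 \<le> p \<and> p \<le> r + 1 + (n - m)
     then nat (B_ext n m b (r + 1) p - B_ext n m b (r + 1) (p - 1)) else 0)"

context
  fixes n m L :: nat and b :: "coord \<Rightarrow> int"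
  assumes b: "b \<in> BB n m L" and m: "1 \<le> m" "m < n"
begin

lemma rect_array_mono:
  assumes "r < m" "r + 1 < p" "p \<le> n"
  shows "rect_array n m b (r + 1) (p - 1) \<le> rect_array n m b (r + 1) p"
proof -
  have "gt_pattern n (rect_array n m b)" using b by (simp add: BB_def)
  then have "1 \<le> r + 1 \<and> r + 1 \<le> p - 1 \<and> p - 1 \<le> n - 1 \<longrightarrow>
      rect_array n m b (r + 1) (p - 1) \<le> rect_array n m b (r + 1) (p - 1 + 1)"
    unfolding gt_pattern_def by blast
  moreover have "1 \<le> r + 1 \<and> r + 1 \<le> p - 1 \<and> p - 1 \<le> n - 1" "p - 1 + 1 = p" "r + 1 + 1 = r + 2"
    using assms by linarith+
  ultimately show ?thesis by metis
qed

lemma rect_array_diag: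
  assumes "r + 1 < m" "r + 1 < p" "p \<le> n"
  shows "rect_array n m b (r + 2) p \<le> rect_array n m b (r + 1) (p - 1)"
proof -
  have "gt_pattern n (rect_array n m b)" using b by (simp add: BB_def)
  then have "1 \<le> r + 1 \<and> r + 1 \<le> p - 1 \<and> p - 1 \<le> n - 1 \<longrightarrow>
      rect_array n m b (r + 1 + 1) (p - 1 + 1) \<le> rect_array n m b (r + 1) (p - 1)"
    unfolding gt_pattern_def by blast
  moreover have "1 \<le> r + 1 \<and> r + 1 \<le> p - 1 \<and> p - 1 \<le> n - 1" "p - 1 + 1 = p" "r + 1 + 1 = r + 2"
    using assms by linarith+
  ultimately show ?thesis by metis
qed

lemma rect_array_nonneg: "r + 1 \<le> p \<Longrightarrow> p \<le> n \<Longrightarrow> 0 \<le> rect_array n m b (r + 1) p"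
  using b by (simp add: BB_def gt_pattern_def)

lemma B_ext_eq:
  assumes "r < m" "r \<le> p" "p \<le> r + 1 + (n - m)"
  shows "B_ext n m b (r + 1) p = (if p = r then 0 else rect_array n m b (r + 1) p)"
  using assms m by (auto simp: B_ext_def rect_array_def)

lemma B_ext_mono:
  assumes "r < m" "r + 1 \<le> p" "p \<le> r + 1 + (n - m)"
  shows "B_ext n m b (r + 1) (p - 1) \<le> B_ext n m b (r + 1) p"
proof -
  have "p \<le> n" using assms m by simp
  then show ?thesis
    using B_ext_eq[of r p] B_ext_eq[of r "p - 1"] rect_array_mono[of r p] rect_array_nonneg[of r p] assms
    by (auto split: if_splits)
qed

lemma cnt_diff:
  assumes "r < m" "r + 1 \<le> p" "p \<le> r + 1 + (n - m)"
  shows "int (cnt n m b r p) = B_ext n m b (r + 1) p - B_ext n m b (r + 1) (p - 1)"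
  using assms B_ext_mono[OF assms] by (simp add: cnt_def)

lemma cum_cnt:
  assumes "r < m" "p \<le> n"
  shows "int (cum (cnt n m b r) p) = (if p \<le> r then 0 else rect_array n m b (r + 1) p)"
  using assms(2)
proof (induction p)
  case 0
  then show ?case by simp
next
  case (Suc p)
  then have IH: "int (cum (cnt n m b r) p) = (if p \<le> r then 0 else rect_array n m b (r + 1) p)" by simp
  show ?case
  proof (cases "r \<le> p \<and> p \<le> r + (n - m)")
    case True
    then have "int (cnt n m b r (Suc p)) = B_ext n m b (r + 1) (Suc p) - B_ext n m b (r + 1) p"
      using cnt_diff[of r "Suc p"] assms(1) by simp
    then show ?thesis
      using IH True B_ext_eq[of r p] B_ext_eq[of r "Suc p"] assms(1) by auto
  next
    case False
    then have "cnt n m b r (Suc p) = 0" by (auto simp: cnt_def)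
    moreover have "\<not> Suc p \<le> r \<Longrightarrow> rect_array n m b (r + 1) (Suc p) = rect_array n m b (r + 1) p"
      using False assms(1) m by (auto simp: rect_array_def)
    ultimately show ?thesis using IH False by auto
  qed
qed

lemma cum_cnt_total: "r < m \<Longrightarrow> cum (cnt n m b r) n = L"
proof -
  assume r: "r < m"
  have "rect_array n m b (r + 1) n = int L" using b r m by (auto simp: rect_array_def BB_def)
  then show ?thesis using cum_cnt[OF r, of n] r m by simp
qed

lemma cum_cnt_strict:
  assumes "r + 1 < m" "p \<le> n"
  shows "cum (cnt n m b (r + 1)) p \<le> cum (cnt n m b r) (p - 1)"
proof (cases "p \<le> r + 1")
  case True
  then show ?thesis using cum_cnt[of "r + 1" p] assms by simp
next
  case False
  then have "int (cum (cnt n m b (r + 1)) p) \<le> int (cum (cnt n m b r) (p - 1))"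
    using cum_cnt[of "r + 1" p] cum_cnt[of r "p - 1"] rect_array_diag[of r p] assms by auto
  then show ?thesis by simp
qed

end

lemma concat_replicate_row:
  "sorted (concat (map (\<lambda>j. replicate (f j) j) [a..<c])) \<and>
   set (concat (map (\<lambda>j. replicate (f j) j) [a..<c])) \<subseteq> {a..<c} \<and>
   count_list (concat (map (\<lambda>j. replicate (f j) j) [a..<c])) = (\<lambda>p. if a \<le> p \<and> p < c then f p else 0)"
proof (induction c)
  case 0
  then show ?case by auto
next
  case (Suc c)
  have rep: "count_list (replicate k c) p = (if p = c then k else 0)" for k p
    by (induction k) auto
  show ?case
  proof (cases "a \<le> c")
    case True
    have "set (replicate (f c) c) \<subseteq> {c}" by auto
    with Suc True show ?thesis by (force simp: sorted_append rep fun_eq_iff)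
  next
    case False
    then show ?thesis by auto
  qed
qed

lemma tableau_row:
  assumes "r < m" "m < n"
  shows "sorted (tableau n m b ! r) \<and> 0 \<notin> set (tableau n m b ! r) \<and> count_list (tableau n m b ! r) = cnt n m b r"
proof -
  have "tableau n m b ! r = concat (map (\<lambda>j. replicate (nat (B_ext n m b (r + 1) j - B_ext n m b (r + 1) (j - 1))) j)
          [r + 1..<r + 1 + (n - m) + 1])"
  proof -
    have "[1..<m + 1] ! r = r + 1" using assms(1) nth_upt[of 1 r "m + 1"] by linarith
    moreover have "r < length [1..<m + 1]" using assms(1) by simp
    moreover have "r + 1 + n - m + 1 = r + 1 + (n - m) + 1" using assms(2) by simp
    ultimately show ?thesis by (simp only: tableau_def nth_map)
  qed
  then show ?thesis
    using concat_replicate_row[of "\<lambda>j. nat (B_ext n m b (r + 1) j - B_ext n m b (r + 1) (j - 1))" "r + 1" "r + 1 + (n - m) + 1"]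
      assms by (auto simp: cnt_def fun_eq_iff)
qed

lemma rect_pair_tableaux:
  assumes b: "b \<in> BB n m1 L1" and b': "b' \<in> BB n m2 L2" and m: "1 \<le> m1" "m1 < n" "1 \<le> m2" "m2 < n"
  shows "rect_pair n m1 m2 L1 (cnt n m1 b) (\<lambda>j. cnt n m2 b' (m2 - 1 - j))"
proof unfold_locales
  fix j p assume j: "j + 1 < m2" "p \<le> n"
  then have "m2 - 1 - j = (m2 - 1 - (j + 1)) + 1" by simp
  then show "cum (cnt n m2 b' (m2 - 1 - j)) p \<le> cum (cnt n m2 b' (m2 - 1 - (j + 1))) (p - 1)"
    using cum_cnt_strict[OF b' m(3,4), of "m2 - 1 - (j + 1)" p] j by simp
next
  fix j p assume "j < m2" "cnt n m2 b' (m2 - 1 - j) p \<noteq> 0"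
  then show "m2 - j \<le> p \<and> p \<le> n" using m by (auto simp: cnt_def split: if_splits)
qed (use m cum_cnt_total[OF b] cum_cnt_strict[OF b] in \<open>auto simp: cnt_def split: if_splits\<close>)

section \<open>Tropicalizing the energy function\<close>

text \<open>
  The first \<open>k\<close> columns of a tower depend only on few subdiagonal entries, since a product of \<open>r\<close>
  factors reaches at most \<open>r\<close> positions below the diagonal. Hence the bands of the rows of \<open>U\<close> may be
  extended up to \<open>n\<close>.
\<close>
lemma row_tower_front_cong:
  assumes "\<And>r p. r < m \<Longrightarrow> p \<le> r + 1 + k \<Longrightarrow> c r p = c' r p" "j < k" "j < n"
  shows "r \<le> m \<Longrightarrow> a < n \<Longrightarrow> row_tower n c x r $$ (a, j) = row_tower n c' x r $$ (a, j)"
proof (induction r arbitrary: a)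
  case 0
  then show ?case by simp
next
  case (Suc r)
  have "c r (a + 1) = c' r (a + 1) \<or> row_tower n c' x r $$ (a - 1, j) = 0"
  proof (cases "a \<le> j + r + 1")
    case True
    then show ?thesis using assms(1)[of r "a + 1"] assms(2) Suc.prems by simp
  next
    case False
    then show ?thesis using row_tower_below[of "a - 1" n j r c' x] Suc.prems assms(3) by simp
  qed
  then show ?case using Suc.IH[of a] Suc.IH[of "a - 1"] Suc.prems assms(3)
    by (auto simp del: index_mult_mat(1) simp: row_mat_mult_index[OF row_tower_carrier])
qed

lemma row_mat_identity:
  assumes "\<And>p. 1 \<le> p \<Longrightarrow> p \<le> n \<Longrightarrow> x p = 1" "\<And>p. 2 \<le> p \<Longrightarrow> p \<le> n \<Longrightarrow> \<not> c p"
  shows "row_mat n c x = 1\<^sub>m n"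
  by (rule eq_matI) (use assms in \<open>auto simp: row_mat_def\<close>)

context rect_pair
begin

text \<open>The rows added to \<open>T\<close> contribute identity matrices.\<close>
lemma tower_0_eq:
  assumes "\<And>i. i < m1 \<Longrightarrow> X i = x i" "\<And>i. m1 \<le> i \<Longrightarrow> X i = (\<lambda>_. 1)"
  shows "tower X W 0 m = row_tower n (phi_pat n m1) x m1"
proof -
  have 1: "i \<le> m1 \<Longrightarrow> tower X W 0 i = row_tower n (phi_pat n m1) x i" for i
  proof (induction i)
    case (Suc i)
    have "row_mat n (res_pat 0 i) (xv X W 0 i) = row_mat n (phi_pat n m1 i) (x i)"
      by (rule row_mat_cong) (use Suc.prems assms in \<open>auto simp: xv_simps res_pat_def ext_def base_def phi_pat_def\<close>)
    then show ?case using Suc by simp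
  qed simp
  have "tower X W 0 i = tower X W 0 m1" if "m1 \<le> i" for i
    using that
  proof (induction i rule: dec_induct)
    case (step i)
    have "row_mat n (res_pat 0 i) (xv X W 0 i) = 1\<^sub>m n"
      by (rule row_mat_identity) (use step.hyps assms in \<open>auto simp: xv_simps res_pat_def ext_def base_def\<close>)
    then show ?case using step left_mult_one_mat[OF row_tower_carrier, of n "res_pat 0" "xv X W 0" i] by simp
  qed simp
  then show ?thesis using 1[of m1] by (simp add: m_def)
qed

text \<open>Words are numbered from the bottom row of \<open>U\<close> upwards, the factors of a tower downwards.\<close>
lemma in_prod_eq:
  assumes "\<And>j. j < m2 \<Longrightarrow> W j = x (m2 - 1 - j)"
  shows "in_prod X W m2 = row_tower n (\<lambda>r p. r + 1 < p \<and> p \<le> n) x m2"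
proof -
  let ?T = "row_tower n (\<lambda>r p. r + 1 < p \<and> p \<le> n) x"
  have "j \<le> m2 \<Longrightarrow> in_prod X W j * ?T (m2 - j) = ?T m2" for j
  proof (induction j)
    case 0
    then show ?case using left_mult_one_mat[OF row_tower_carrier, of n "\<lambda>r p. r + 1 < p \<and> p \<le> n" x m2] by simp
  next
    case (Suc j)
    define r where "r = m2 - Suc j"
    have r: "m2 - j = Suc r" "m2 - 1 - j = r" using Suc.prems by (auto simp: r_def)
    have R: "row_mat n (inc_pat j 0) (wv X W j 0) = row_mat n (\<lambda>p. r + 1 < p \<and> p \<le> n) (x r)"
      by (rule row_mat_cong) (use Suc.prems assms r m1 in \<open>auto simp: wv_simps inc_pat_def upper_def ext_def\<close>)
    have "in_prod X W (Suc j) * ?T r = in_prod X W j * (row_mat n (\<lambda>p. r + 1 < p \<and> p \<le> n) (x r) * ?T r)"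
      unfolding in_prod.simps R by (rule assoc_mult_mat[of _ n n _ n _ n]) auto
    also have "\<dots> = in_prod X W j * ?T (m2 - j)" unfolding r by simp
    also have "\<dots> = ?T m2" using Suc by simp
    finally show ?case unfolding r_def .
  qed
  from this[of m2] show ?thesis
    using right_mult_one_mat[OF in_prod_carrier, of X W m2] by simp
qed

end

lemma minor_front_cong:
  fixes A B B' :: "'a::comm_ring_1 mat"
  assumes "A \<in> carrier_mat n n" "B \<in> carrier_mat n n" "B' \<in> carrier_mat n n" "k \<le> n"
    and "\<And>q b. q < n \<Longrightarrow> b < k \<Longrightarrow> B $$ (q, b) = B' $$ (q, b)"
  shows "minor {n - k + 1..n} {1..k} (A * B) = minor {n - k + 1..n} {1..k} (A * B')"
proof -
  have "mat k k (\<lambda>(a, b). (A * B) $$ (n - k + a, b)) = mat k k (\<lambda>(a, b). (A * B') $$ (n - k + a, b))"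
    by (rule eq_matI) (use assms in \<open>auto simp: scalar_prod_def intro!: sum.cong\<close>)
  then show ?thesis
    unfolding minor_bottom_left[OF mult_carrier_mat[OF assms(1,2)] assms(4)]
      minor_bottom_left[OF mult_carrier_mat[OF assms(1,3)] assms(4)] by (simp only:)
qed

lemma phi_val_trop:
  assumes b: "b \<in> BB n m L" and m: "1 \<le> m" "m < n" and r: "r < m"
    and v: "\<And>w. w \<in> coords n m \<Longrightarrow> \<iota> w \<in> V \<and> \<beta> (\<iota> w) = b w"
  shows "has_trop V \<beta> (\<lambda>z. phi_val n m (z \<circ> \<iota>) r p) (int (cnt n m b r p))"
proof (cases "r + 1 \<le> p \<and> p \<le> r + 1 + (n - m)")
  case False
  then show ?thesis using has_trop_one[of V \<beta>] by (auto simp: phi_val_def cnt_def)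
next
  case True
  have var: "has_trop V \<beta> (\<lambda>z. (z \<circ> \<iota>) w) (b w)" if "w \<in> coords n m" for w
    using has_trop_var[of "\<iota> w" V \<beta>] v[OF that] by simp
  have X: "has_trop V \<beta> (\<lambda>z. X_ext n m (z \<circ> \<iota>) (r + 1) q) (B_ext n m b (r + 1) q)"
    if "r \<le> q" "q \<le> r + 1 + (n - m)" for q
  proof -
    consider "q = r" | "q = r + 1 + (n - m)" | "r < q" "q < r + 1 + (n - m)" using \<open>r \<le> q\<close> \<open>q \<le> _\<close> by linarith
    then show ?thesis
    proof cases
      case 1
      then show ?thesis using has_trop_one[of V \<beta>] by (simp add: X_ext_def B_ext_def)
    next
      case 2
      show ?thesis unfolding 2 X_ext_last[OF m(2)] B_ext_last[OF m(2)]
        by (rule var) (simp add: coords_def)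
    next
      case 3
      then have "Xc (r + 1) q \<in> coords n m" using r m by (auto simp: coords_def RR_def)
      from var[OF this] show ?thesis using 3 m by (auto simp: X_ext_def B_ext_def)
    qed
  qed
  have "has_trop V \<beta> (\<lambda>z. X_ext n m (z \<circ> \<iota>) (r + 1) p / X_ext n m (z \<circ> \<iota>) (r + 1) (p - 1))
      (B_ext n m b (r + 1) p - B_ext n m b (r + 1) (p - 1))"
    by (intro has_trop_divide X) (use True in auto)
  then show ?thesis using True cnt_diff[OF b m r, of p] by (simp add: phi_val_def x_ratio_def)
qed

theorem theorem6p6:
  fixes n k1 k2 L1 L2 :: nat
  assumes "n \<ge> 2" and "k1 \<in> {1..n - 1}" and "k2 \<in> {1..n - 1}"
  shows "\<forall>b \<in> BB n (n - k1) L1. \<forall>b' \<in> BB n (n - k2) L2.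
    E_hat n k1 k2 (b, b') = int (coenergy n k1 k2 (tableau n (n - k1) b) (tableau n (n - k2) b'))"
proof (intro ballI)
  fix b b' assume b: "b \<in> BB n (n - k1) L1" and b': "b' \<in> BB n (n - k2) L2"
  define m1 where "m1 = n - k1"
  define m2 where "m2 = n - k2"
  have k: "1 \<le> k1" "k1 < n" "1 \<le> k2" "k2 < n" using assms by auto
  have m12: "1 \<le> m1" "m1 < n" "1 \<le> m2" "m2 < n" using k by (auto simp: m1_def m2_def)
  define V where "V = coords n m1 <+> coords n m2"
  define \<beta> where "\<beta> = case_sum b b'"
  define f where "f z = E_fun n k1 k2 (Theta n k1 (z \<circ> Inl), Theta n k2 (z \<circ> Inr))" for z :: "coord + coord \<Rightarrow> complex"
  interpret rect_pair n m1 m2 L1 "cnt n m1 b" "\<lambda>j. cnt n m2 b' (m2 - 1 - j)"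
    by (rule rect_pair_tableaux[OF b[folded m1_def] b'[folded m2_def] m12])
  define X where "X z i = (if i < m1 then phi_val n m1 (z \<circ> Inl) i else (\<lambda>_. 1))" for z :: "coord + coord \<Rightarrow> complex" and i
  define W where "W z j = phi_val n m2 (z \<circ> Inr) (m2 - 1 - j)" for z :: "coord + coord \<Rightarrow> complex" and j
  have Xt: "has_trop V \<beta> (\<lambda>z. X z i p) (int (cnt n m1 b i p))" for i p
  proof (cases "i < m1")
    case True
    then show ?thesis
      using phi_val_trop[where V = V and \<beta> = \<beta> and \<iota> = Inl, OF b[folded m1_def] m12(1,2) True, of p]
      by (simp add: X_def V_def \<beta>_def InlI)
  next
    case False
    then show ?thesis using has_trop_one[of V \<beta>] by (simp add: X_def cnt_def)
  qed
  have Wt: "has_trop V \<beta> (\<lambda>z. W z j p) (int (cnt n m2 b' (m2 - 1 - j) p))" if "j < m2" for j p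
    unfolding W_def using that m12
    by (intro phi_val_trop[where V = V and \<beta> = \<beta> and \<iota> = Inr, OF b'[folded m2_def]]) (auto simp: V_def \<beta>_def)
  note wt = wv_trop[where X = X and W = W, OF Xt Wt]
  have nz: "generically V (\<lambda>z. \<forall>(j, i, p) \<in> {..<m2} \<times> {..<m} \<times> {1..n}. wv (X z) (W z) j (Suc i) p \<noteq> 0)"
    by (rule generically_ball) (auto intro!: has_trop_nonzero[OF wt])
  have eq: "generically V (\<lambda>z. (\<Prod>a\<in>{m..<n}. \<Prod>j<m2. wv (X z) (W z) j m (a + 1)) = f z)"
  proof (rule generically_mono[OF nz])
    fix z assume z: "z \<in> torus V"
      and nz: "\<forall>(j, i, p) \<in> {..<m2} \<times> {..<m} \<times> {1..n}. wv (X z) (W z) j (Suc i) p \<noteq> 0"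
    have zz: "z \<circ> Inl \<in> torus (coords n (n - k1))" "z \<circ> Inr \<in> torus (coords n (n - k2))"
      using z by (auto simp: torus_def V_def m1_def m2_def PiE_def extensional_def)
    have l: "n - min k1 k2 = m" "min k1 k2 = n - m" "n - (n - m) = m" "n - m \<le> n"
      using k unfolding m_def unfolding m1_def m2_def by (auto simp: min_def max_def)
    let ?P1 = "row_tower n (phi_pat n m1) (phi_val n m1 (z \<circ> Inl)) m1"
    let ?P2 = "row_tower n (phi_pat n m2) (phi_val n m2 (z \<circ> Inr)) m2"
    have "f z = minor {m + 1..n} {1..n - m} (?P1 * ?P2)"
      unfolding f_def E_fun_Theta[OF zz k] l(2) l(3) using k by (simp add: m1_def m2_def Phi_eq_row_tower)
    also have "\<dots> = minor {m + 1..n} {1..n - m} (?P1 * in_prod (X z) (W z) m2)"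
    proof -
      have "in_prod (X z) (W z) m2 $$ (q, c) = ?P2 $$ (q, c)" if "q < n" "c < n - m" for q c
      proof -
        have in_eq: "in_prod (X z) (W z) m2 = row_tower n (\<lambda>r p. r + 1 < p \<and> p \<le> n) (phi_val n m2 (z \<circ> Inr)) m2"
          by (rule in_prod_eq) (simp add: W_def)
        show ?thesis unfolding in_eq
          by (rule row_tower_front_cong[where m = m2 and k = "n - m2"])
            (use that m12 in \<open>auto simp: phi_pat_def m_def\<close>)
      qed
      then show ?thesis
        using minor_front_cong[of ?P1 n ?P2 "in_prod (X z) (W z) m2" "n - m"] l by simp
    qed
    also have "?P1 = tower (X z) (W z) 0 m"
      by (rule tower_0_eq[symmetric]) (auto simp: X_def)
    also have "minor {m + 1..n} {1..n - m} (tower (X z) (W z) 0 m * in_prod (X z) (W z) m2) =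
      (\<Prod>a\<in>{m..<n}. \<Prod>j<m2. wv (X z) (W z) j m (a + 1))"
      by (rule minor_eq_prod_out) (use nz in auto)
    finally show "(\<Prod>a\<in>{m..<n}. \<Prod>j<m2. wv (X z) (W z) j m (a + 1)) = f z" ..
  qed
  have "has_trop V \<beta> (\<lambda>z. \<Prod>a\<in>{m..<n}. \<Prod>j<m2. wv (X z) (W z) j m (a + 1))
     (\<Sum>a\<in>{m..<n}. \<Sum>j<m2. int (wc j m (a + 1)))"
    by (intro has_trop_prod wt) auto
  then have "has_trop V \<beta> f (\<Sum>a\<in>{m..<n}. \<Sum>j<m2. int (wc j m (a + 1)))"
    by (rule has_trop_cong[OF _ eq])
  moreover have "\<beta> \<in> trop_torus V"
    using b b' by (auto simp: \<beta>_def V_def m1_def m2_def BB_def trop_torus_def PiE_def extensional_def split: sum.splits)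
  ultimately have "trop V f \<beta> = (\<Sum>a\<in>{m..<n}. \<Sum>j<m2. int (wc j m (a + 1)))"
    by (rule trop_eqI)
  also have "\<dots> = int (\<Sum>j<m2. \<Sum>p = m + 1..n. wc j m p)"
  proof -
    have "(\<Sum>a\<in>{m..<n}. \<Sum>j<m2. int (wc j m (a + 1))) = (\<Sum>j<m2. \<Sum>a\<in>{m..<n}. int (wc j m (a + 1)))"
      by (rule sum.swap)
    also have "\<dots> = (\<Sum>j<m2. \<Sum>p = m + 1..n. int (wc j m p))"
    proof (rule sum.cong)
      fix j
      show "(\<Sum>a\<in>{m..<n}. int (wc j m (a + 1))) = (\<Sum>p = m + 1..n. int (wc j m p))"
        using sum.shift_bounds_Suc_ivl[of "\<lambda>p. int (wc j m p)" m n] by (simp add: atLeastLessThanSuc_atLeastAtMost)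
    qed simp
    finally show ?thesis by simp
  qed
  also have "(\<Sum>j<m2. \<Sum>p = m + 1..n. wc j m p) = coenergy n k1 k2 (tableau n m1 b) (tableau n m2 b')"
  proof (rule coenergy_eq_sum_out[symmetric])
    show "length (tableau n m1 b) = m1" "length (tableau n m2 b') = m2" by (simp_all add: tableau_def)
    then show "sorted (rev (tableau n m2 b') ! j) \<and> 0 \<notin> set (rev (tableau n m2 b') ! j) \<and>
         count_list (rev (tableau n m2 b') ! j) = cnt n m2 b' (m2 - 1 - j)" if "j < m2" for j
      using tableau_row[of "m2 - 1 - j" m2 n b'] m12 that by (simp add: rev_nth)
  qed (use tableau_row[of _ m1 n b] m12 in \<open>auto simp: m1_def m2_def\<close>)
  finally show "E_hat n k1 k2 (b, b') = int (coenergy n k1 k2 (tableau n (n - k1) b) (tableau n (n - k2) b'))"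
    unfolding E_hat_def f_def[abs_def] V_def \<beta>_def m1_def m2_def by simp
qed

end
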